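(* Let $p\ge 3$. If $A_i=T(a_i)+K_i\in\mathcal{QT}$, for $i=1,\ldots,p$, are positive definite operators, then the symbol $g(t)$ associated with the ALM mean $G=G(A_1,\ldots,A_p)$ (which belongs to $\mathcal{QT}$) is such that $g(t)=(a_1(t)\cdots a_p(t))^{1/p}$.
   Context: $\ell^2$ is the complex Hilbert space of square-summable sequences indexed by the positive integers. $C_{2\pi}$ is the set of continuous $a:[0,2\pi]\to\mathbb C$ with $a(0)=a(2\pi)$. For $a\in C_{2\pi}$ with Fourier series $\sum_{k}a_ke^{\mathrm{i}kt}$, $T(a)$ is the bounded operator on $\ell^2$ with matrix $(T(a))_{i,j}=a_{j-i}$, $i,j\ge1$. $\mathcal{QT}=\{T(a)+K: a\in C_{2\pi},\ K \text{ compact on }\ell^2\}$ is the $C^*$-subalgebra of $\mathcal B(\ell^2)$ of quasi-Toeplitz matrices; the decomposition $A=T(a)+K$ of $A\in\mathcal{QT}$ is unique and $a$ is called the symbol of $A$. A bounded operator $A$ is positive definite if it is self-adjoint and there is $\gamma>0$ with $v^*Av\ge\gamma\|v\|_2^2$ for all $v\in\ell^2$; its symbol, if $A\in\mathcal{QT}$, is then strictly positive. For positive definite operators $A,B$ the geometric mean is $A\#B=A^{1/2}(A^{-1/2}BA^{-1/2})^{1/2}A^{1/2}$. The ALM mean of two operators is $G(A,B)=A\#B$, and for $p\ge3$ positive definite operators the ALM mean $G(A_1,\ldots,A_p)$ is defined recursively on $p$ as the common limit of the sequences $A_i^{(0)}=A_i$, $A_i^{(k+1)}=G(A_1^{(k)},\ldots,A_{i-1}^{(k)},A_{i+1}^{(k)},\ldots,A_p^{(k)})$,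 $i=1,\ldots,p$; these are known to converge in the Thompson metric, hence in operator norm, to a common positive definite limit. *)

theory Defs
  imports "HOL-Analysis.Analysis"
begin

section \<open>The Hilbert space of square-summable sequences\<close>

text \<open>
  Indices start at 0 instead of 1.  This does not affect Toeplitz matrices, whose entries
  depend only on the difference of the indices.
\<close>

typedef ell2 = "{x :: nat \<Rightarrow> complex. summable (\<lambda>n. (cmod (x n))\<^sup>2)}"
  morphisms ell2_nth Abs_ell2
  by (rule exI[of _ "\<lambda>_. 0"]) simp

setup_lifting type_definition_ell2

lemma ell2_eqI: "(\<And>n. ell2_nth x n = ell2_nth y n) \<Longrightarrow> x = y"
  by (simp add: ell2_nth_inject[symmetric] fun_eq_iff)

lemma summable_ell2: "summable (\<lambda>n. (cmod (ell2_nth x n))\<^sup>2)"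
  using ell2_nth[of x] by simp

lemma cmod_add_sq_le: "(cmod (a + b))\<^sup>2 \<le> 2 * (cmod a)\<^sup>2 + 2 * (cmod b)\<^sup>2"
proof -
  have "(cmod (a + b))\<^sup>2 \<le> (cmod a + cmod b)\<^sup>2"
    by (intro power_mono norm_triangle_ineq norm_ge_zero)
  also have "\<dots> \<le> 2 * (cmod a)\<^sup>2 + 2 * (cmod b)\<^sup>2"
    using sum_squares_bound[of "cmod a" "cmod b"] by (simp add: power2_sum)
  finally show ?thesis .
qed

lemma square_summable_add:
  assumes "summable (\<lambda>n. (cmod (x n))\<^sup>2)" and "summable (\<lambda>n. (cmod (y n))\<^sup>2)"
  shows "summable (\<lambda>n. (cmod (x n + y n))\<^sup>2)"
proof (rule summable_comparison_test')
  show "summable (\<lambda>n. 2 * (cmod (x n))\<^sup>2 + 2 * (cmod (y n))\<^sup>2)"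
    using assms by (intro summable_add summable_mult)
  show "norm ((cmod (x n + y n))\<^sup>2) \<le> 2 * (cmod (x n))\<^sup>2 + 2 * (cmod (y n))\<^sup>2" for n
    using cmod_add_sq_le[of "x n" "y n"] by simp
qed

lift_definition ell2_scaleC :: "complex \<Rightarrow> ell2 \<Rightarrow> ell2" is "\<lambda>c x n. c * x n"
  by (simp add: norm_mult power_mult_distrib summable_mult)

definition ell2_inner :: "ell2 \<Rightarrow> ell2 \<Rightarrow> complex" where
  "ell2_inner x y = (\<Sum>n. cnj (ell2_nth x n) * ell2_nth y n)"

lemma summable_norm_ell2_inner: "summable (\<lambda>n. cmod (cnj (ell2_nth x n) * ell2_nth y n))"
proof (rule summable_comparison_test')
  show "summable (\<lambda>n. (cmod (ell2_nth x n))\<^sup>2 + (cmod (ell2_nth y n))\<^sup>2)"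
    by (intro summable_add summable_ell2)
  show "norm (cmod (cnj (ell2_nth x n) * ell2_nth y n))
        \<le> (cmod (ell2_nth x n))\<^sup>2 + (cmod (ell2_nth y n))\<^sup>2" for n
  proof -
    have "0 \<le> (cmod (ell2_nth x n))\<^sup>2" "0 \<le> (cmod (ell2_nth y n))\<^sup>2" by simp_all
    then show ?thesis
      using sum_squares_bound[of "cmod (ell2_nth x n)" "cmod (ell2_nth y n)"]
      unfolding norm_mult real_norm_def abs_mult abs_norm_cancel complex_mod_cnj
      by linarith
  qed
qed

lemma summable_ell2_inner: "summable (\<lambda>n. cnj (ell2_nth x n) * ell2_nth y n)"
  by (rule summable_norm_cancel[OF summable_norm_ell2_inner])

text \<open>
  The real inner product is the real part of the complex one; it induces the same norm.
\<close>

instantiation ell2 :: real_inner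
begin

lift_definition zero_ell2 :: ell2 is "\<lambda>_. 0" by simp

lift_definition plus_ell2 :: "ell2 \<Rightarrow> ell2 \<Rightarrow> ell2" is "\<lambda>x y n. x n + y n"
  by (rule square_summable_add)

lift_definition uminus_ell2 :: "ell2 \<Rightarrow> ell2" is "\<lambda>x n. - x n" by simp

lift_definition minus_ell2 :: "ell2 \<Rightarrow> ell2 \<Rightarrow> ell2" is "\<lambda>x y n. x n - y n"
  subgoal for x y using square_summable_add[of x "\<lambda>n. - y n"] by simp
  done

lift_definition scaleR_ell2 :: "real \<Rightarrow> ell2 \<Rightarrow> ell2" is "\<lambda>r x n. r *\<^sub>R x n"
  by (simp add: power_mult_distrib summable_mult)

definition inner_ell2 :: "ell2 \<Rightarrow> ell2 \<Rightarrow> real" where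
  "inner_ell2 x y = Re (ell2_inner x y)"

definition norm_ell2 :: "ell2 \<Rightarrow> real" where "norm_ell2 x = sqrt (inner x x)"

definition sgn_ell2 :: "ell2 \<Rightarrow> ell2" where "sgn_ell2 x = inverse (norm x) *\<^sub>R x"

definition dist_ell2 :: "ell2 \<Rightarrow> ell2 \<Rightarrow> real" where "dist_ell2 x y = norm (x - y)"

definition uniformity_ell2 :: "(ell2 \<times> ell2) filter" where
  "uniformity_ell2 = (INF e\<in>{0<..}. principal {(x, y). dist x y < e})"

definition open_ell2 :: "ell2 set \<Rightarrow> bool" where
  "open_ell2 U = (\<forall>x\<in>U. eventually (\<lambda>(x', y). x' = x \<longrightarrow> y \<in> U) uniformity)"

instance
proof
  have inner_sums: "(\<lambda>n. Re (cnj (ell2_nth x n) * ell2_nth y n)) sums inner x y" for x y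
    unfolding inner_ell2_def ell2_inner_def
    by (intro sums_Re summable_sums summable_ell2_inner)
  have inner_self: "(\<lambda>n. (cmod (ell2_nth x n))\<^sup>2) sums inner x x" for x
    using inner_sums[of x x] by (simp add: cmod_def power2_eq_square)
  fix x y z :: ell2 and r s :: real
  show "x + y + z = x + (y + z)" "x + y = y + x" "0 + x = x" "- x + x = 0" "x - y = x + - y"
    by (transfer; simp add: fun_eq_iff)+
  show "r *\<^sub>R (x + y) = r *\<^sub>R x + r *\<^sub>R y" "(r + s) *\<^sub>R x = r *\<^sub>R x + s *\<^sub>R x"
    "r *\<^sub>R s *\<^sub>R x = (r * s) *\<^sub>R x" "1 *\<^sub>R x = x"
    by (transfer; simp add: fun_eq_iff algebra_simps scaleR_conv_of_real)+
  show "dist x y = norm (x - y)" "sgn x = inverse (norm x) *\<^sub>R x" "norm x = sqrt (inner x x)"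
    "(uniformity :: (ell2 \<times> ell2) filter) = (INF e\<in>{0<..}. principal {(x, y). dist x y < e})"
    by (fact dist_ell2_def sgn_ell2_def norm_ell2_def uniformity_ell2_def)+
  show "open U \<longleftrightarrow> (\<forall>x\<in>U. eventually (\<lambda>(x', y). x' = x \<longrightarrow> y \<in> U) uniformity)" for U :: "ell2 set"
    by (fact open_ell2_def)
  show "inner x y = inner y x"
    using inner_sums[of x y] inner_sums[of y x]
    by (intro sums_unique2[OF inner_sums[of x y]]) (simp add: mult.commute)
  show "inner (x + y) z = inner x z + inner y z"
    using sums_add[OF inner_sums[of x z] inner_sums[of y z]]
    by (intro sums_unique2[OF inner_sums[of "x + y" z]]) (simp add: plus_ell2.rep_eq algebra_simps)
  show "inner (r *\<^sub>R x) y = r * inner x y"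
    using sums_mult[OF inner_sums[of x y], of r]
    by (intro sums_unique2[OF inner_sums[of "r *\<^sub>R x" y]])
      (simp add: scaleR_ell2.rep_eq algebra_simps)
  show "0 \<le> inner x x"
    using inner_self[of x] by (rule sums_le[OF _ sums_zero, rotated]) simp
  show "inner x x = 0 \<longleftrightarrow> x = 0"
  proof
    assume "inner x x = 0"
    then have "(\<Sum>n. (cmod (ell2_nth x n))\<^sup>2) = 0"
      using inner_self[of x] by (simp add: sums_iff)
    then have "\<forall>n. (cmod (ell2_nth x n))\<^sup>2 = 0"
      by (subst (asm) suminf_eq_zero_iff[OF summable_ell2]) auto
    then show "x = 0" by (intro ell2_eqI) (simp add: zero_ell2.rep_eq)
  next
    assume "x = 0"
    then show "inner x x = 0" using inner_self[of x] by (simp add: zero_ell2.rep_eq sums_iff)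
  qed
qed

end

lemma norm_ell2_sums: "(\<lambda>n. (cmod (ell2_nth x n))\<^sup>2) sums (norm x)\<^sup>2"
proof -
  have "(\<lambda>n. Re (cnj (ell2_nth x n) * ell2_nth x n)) sums (x \<bullet> x)"
    unfolding inner_ell2_def ell2_inner_def
    by (intro sums_Re summable_sums summable_ell2_inner)
  then show ?thesis by (simp add: cmod_power2 power2_norm_eq_inner) (simp add: power2_eq_square)
qed

lemma sum_ell2_le: "(\<Sum>n<N. (cmod (ell2_nth x n))\<^sup>2) \<le> (norm x)\<^sup>2"
  using sum_le_suminf[OF summable_ell2[of x], of "{..<N}"] norm_ell2_sums[of x]
  by (simp add: sums_iff)

lemma norm_ell2_nth_le: "cmod (ell2_nth x n) \<le> norm x"
proof -
  have "(cmod (ell2_nth x n))\<^sup>2 \<le> (\<Sum>k<Suc n. (cmod (ell2_nth x k))\<^sup>2)"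
    by (simp add: sum_nonneg)
  also have "\<dots> \<le> (norm x)\<^sup>2" by (rule sum_ell2_le)
  finally show ?thesis by (rule power2_le_imp_le) simp
qed

instance ell2 :: complete_space
proof
  fix X :: "nat \<Rightarrow> ell2"
  assume X: "Cauchy X"
  have "convergent (\<lambda>m. ell2_nth (X m) n)" for n
  proof (rule Cauchy_convergent, rule metric_CauchyI)
    fix e :: real assume "0 < e"
    then obtain M where M: "\<And>k m. k \<ge> M \<Longrightarrow> m \<ge> M \<Longrightarrow> dist (X k) (X m) < e"
      using metric_CauchyD[OF X] by blast
    have "dist (ell2_nth (X k) n) (ell2_nth (X m) n) < e" if "k \<ge> M" "m \<ge> M" for k m
      using M[OF that] norm_ell2_nth_le[of "X k - X m" n]
      by (simp add: dist_norm minus_ell2.rep_eq)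
    then show "\<exists>M. \<forall>k\<ge>M. \<forall>m\<ge>M. dist (ell2_nth (X k) n) (ell2_nth (X m) n) < e" by blast
  qed
  then obtain y where y: "\<And>n. (\<lambda>m. ell2_nth (X m) n) \<longlonglongrightarrow> y n"
    unfolding convergent_def by metis
  have tail: "\<exists>M. \<forall>k\<ge>M. \<forall>N. (\<Sum>n<N. (cmod (ell2_nth (X k) n - y n))\<^sup>2) \<le> e\<^sup>2"
    if "0 < e" for e :: real
  proof -
    obtain M where M: "\<And>k m. k \<ge> M \<Longrightarrow> m \<ge> M \<Longrightarrow> dist (X k) (X m) < e"
      using metric_CauchyD[OF X \<open>0 < e\<close>] by blast
    have "(\<Sum>n<N. (cmod (ell2_nth (X k) n - y n))\<^sup>2) \<le> e\<^sup>2" if "k \<ge> M" for k N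
    proof (rule LIMSEQ_le_const2)
      show "(\<lambda>m. \<Sum>n<N. (cmod (ell2_nth (X k) n - ell2_nth (X m) n))\<^sup>2)
              \<longlonglongrightarrow> (\<Sum>n<N. (cmod (ell2_nth (X k) n - y n))\<^sup>2)"
        by (intro tendsto_intros y)
      have "(\<Sum>n<N. (cmod (ell2_nth (X k) n - ell2_nth (X m) n))\<^sup>2) \<le> e\<^sup>2" if "m \<ge> M" for m
      proof -
        have "(\<Sum>n<N. (cmod (ell2_nth (X k) n - ell2_nth (X m) n))\<^sup>2) \<le> (norm (X k - X m))\<^sup>2"
          using sum_ell2_le[of "X k - X m" N] by (simp add: minus_ell2.rep_eq)
        also have "\<dots> \<le> e\<^sup>2"
          using M[OF \<open>k \<ge> M\<close> \<open>m \<ge> M\<close>] by (intro power_mono) (simp_all add: dist_norm)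
        finally show ?thesis .
      qed
      then show "\<exists>M. \<forall>m\<ge>M. (\<Sum>n<N. (cmod (ell2_nth (X k) n - ell2_nth (X m) n))\<^sup>2) \<le> e\<^sup>2"
        by blast
    qed
    then show ?thesis by blast
  qed
  have summ: "summable (\<lambda>n. (cmod (ell2_nth (X k) n - y n))\<^sup>2)"
    if "\<forall>N. (\<Sum>n<N. (cmod (ell2_nth (X k) n - y n))\<^sup>2) \<le> e\<^sup>2" for k and e :: real
    using that by (intro summableI_nonneg_bounded[of _ "e\<^sup>2"]) auto
  obtain M where "\<forall>k\<ge>M. \<forall>N. (\<Sum>n<N. (cmod (ell2_nth (X k) n - y n))\<^sup>2) \<le> 1\<^sup>2"
    using tail[of 1] by auto
  then have "summable (\<lambda>n. (cmod (y n - ell2_nth (X M) n))\<^sup>2)"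
    using summ[of M 1] by (simp add: norm_minus_commute)
  from square_summable_add[OF this summable_ell2[of "X M"]]
  have "summable (\<lambda>n. (cmod (y n))\<^sup>2)" by simp
  then have Y: "ell2_nth (Abs_ell2 y) = y" by (simp add: Abs_ell2_inverse)
  have "X \<longlonglongrightarrow> Abs_ell2 y"
  proof (rule metric_LIMSEQ_I)
    fix e :: real assume "0 < e"
    then obtain M where M: "\<And>k N. k \<ge> M \<Longrightarrow>
        (\<Sum>n<N. (cmod (ell2_nth (X k) n - y n))\<^sup>2) \<le> (e / 2)\<^sup>2"
      using tail[of "e / 2"] by auto
    have "dist (X k) (Abs_ell2 y) < e" if "k \<ge> M" for k
    proof -
      have "(\<lambda>n. (cmod (ell2_nth (X k) n - y n))\<^sup>2) sums (norm (X k - Abs_ell2 y))\<^sup>2"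
        using norm_ell2_sums[of "X k - Abs_ell2 y"] by (simp add: minus_ell2.rep_eq Y)
      then have "(norm (X k - Abs_ell2 y))\<^sup>2 \<le> (e / 2)\<^sup>2"
        unfolding sums_def by (rule LIMSEQ_le_const2) (use M[OF that] in blast)
      then have "norm (X k - Abs_ell2 y) \<le> e / 2"
        by (rule power2_le_imp_le) (use \<open>0 < e\<close> in simp)
      then show ?thesis using \<open>0 < e\<close> by (simp add: dist_norm)
    qed
    then show "\<exists>M. \<forall>k\<ge>M. dist (X k) (Abs_ell2 y) < e" by blast
  qed
  then show "convergent X" by (rule convergentI)
qed

lemma square_summable_unit: "summable (\<lambda>n. (cmod (if n = i then 1 else 0))\<^sup>2)"
  by (rule summable_finite[of "{i}"]) auto

lift_definition ell2_unit :: "nat \<Rightarrow> ell2" is "\<lambda>i n. if n = i then 1 else 0"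
  by (rule square_summable_unit)


section \<open>Bounded operators\<close>

text \<open>
  Elements of \<^typ>\<open>ell2 \<Rightarrow>\<^sub>L ell2\<close> are only real-linear, so complex homogeneity is imposed
  separately.  The norm and the topology of this type are those of the operator norm.
\<close>

type_synonym operator = "ell2 \<Rightarrow>\<^sub>L ell2"

definition bounded_ops :: "operator set" where
  "bounded_ops = {A :: operator. \<forall>c x. A (ell2_scaleC c x) = ell2_scaleC c (A x)}"

definition self_adjoint :: "operator \<Rightarrow> bool" where
  "self_adjoint A \<longleftrightarrow> (\<forall>x y. ell2_inner (A x) y = ell2_inner x (A y))"

definition compact_op :: "operator \<Rightarrow> bool" where
  "compact_op K \<longleftrightarrow> compact (closure (blinfun_apply K ` cball 0 1))"

text \<open>For self-adjoint operators the quadratic form is real, so \<^const>\<open>Re\<close> loses nothing.\<close>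

definition positive_semidefinite :: "operator \<Rightarrow> bool" where
  "positive_semidefinite A \<longleftrightarrow>
     A \<in> bounded_ops \<and> self_adjoint A \<and> (\<forall>v. 0 \<le> Re (ell2_inner v (A v)))"

definition positive_definite :: "operator \<Rightarrow> bool" where
  "positive_definite A \<longleftrightarrow>
     A \<in> bounded_ops \<and> self_adjoint A \<and>
     (\<exists>\<gamma>>0. \<forall>v. \<gamma> * (norm v)\<^sup>2 \<le> Re (ell2_inner v (A v)))"

definition op_sqrt :: "operator \<Rightarrow> operator" where
  "op_sqrt A = (THE S. positive_semidefinite S \<and> S o\<^sub>L S = A)"

definition op_inverse :: "operator \<Rightarrow> operator" where
  "op_inverse A = (THE B. A o\<^sub>L B = id_blinfun \<and> B o\<^sub>L A = id_blinfun)"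


section \<open>Quasi-Toeplitz operators\<close>

text \<open>
  Functions on \<open>[0, 2\<pi>]\<close> are extensional, that is, they have a fixed value outside of the
  interval.  Thus equality is equality on the interval, and the symbol is unique.
\<close>

definition C2pi :: "(real \<Rightarrow> complex) set" where
  "C2pi = {a \<in> extensional {0..2*pi}. continuous_on {0..2*pi} a \<and> a 0 = a (2*pi)}"

definition fourier_coeff :: "(real \<Rightarrow> complex) \<Rightarrow> int \<Rightarrow> complex" where
  "fourier_coeff a k =
     1 / (2 * of_real pi) * integral {0..2*pi} (\<lambda>t. a t * exp (- \<i> * of_int k * of_real t))"

definition matrix_entry :: "operator \<Rightarrow> nat \<Rightarrow> nat \<Rightarrow> complex" where
  "matrix_entry A i j = ell2_nth (A (ell2_unit j)) i"

definition toeplitz :: "(real \<Rightarrow> complex) \<Rightarrow> operator" where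
  "toeplitz a = (THE T. T \<in> bounded_ops \<and>
     (\<forall>i j. matrix_entry T i j = fourier_coeff a (int j - int i)))"

definition QT :: "operator set" where
  "QT = {toeplitz a + K | a K. a \<in> C2pi \<and> K \<in> bounded_ops \<and> compact_op K}"

definition qt_symbol :: "operator \<Rightarrow> real \<Rightarrow> complex" where
  "qt_symbol A = (THE a. a \<in> C2pi \<and>
     (\<exists>K. K \<in> bounded_ops \<and> compact_op K \<and> A = toeplitz a + K))"


section \<open>Geometric means\<close>

definition geo_mean :: "operator \<Rightarrow> operator \<Rightarrow> operator" (infixl "#\<^sub>g" 70) where
  "A #\<^sub>g B = (let S = op_sqrt A; R = op_inverse S in S o\<^sub>L op_sqrt (R o\<^sub>L B o\<^sub>L R) o\<^sub>L S)"

definition omit :: "nat \<Rightarrow> (nat \<Rightarrow> 'a) \<Rightarrow> nat \<Rightarrow> 'a" where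
  "omit i A j = (if j < i then A j else A (Suc j))"

text \<open>
  \<open>alm_mean p A\<close> is the mean of the \<open>p\<close> operators \<open>A 0, \<dots>, A (p - 1)\<close>; the values of \<open>A\<close> at
  other indices are irrelevant.  The case \<open>p = 0\<close> is a dummy.
\<close>

fun alm_mean :: "nat \<Rightarrow> (nat \<Rightarrow> operator) \<Rightarrow> operator" where
  "alm_mean 0 A = 0"
| "alm_mean (Suc 0) A = A 0"
| "alm_mean (Suc (Suc 0)) A = A 0 #\<^sub>g A 1"
| "alm_mean (Suc (Suc (Suc n))) A =
     (THE L. \<forall>i < Suc (Suc (Suc n)).
        (\<lambda>k. ((\<lambda>B i. alm_mean (Suc (Suc n)) (omit i B)) ^^ k) A i) \<longlonglongrightarrow> L)"

end

theory Submission
  imports Defs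
begin

text \<open>
  For \<open>t \<in> [0, 2\<pi>]\<close>, truncated plane waves of frequency \<open>t\<close> form an orthonormal sequence of
  approximate eigenvectors of every quasi-Toeplitz operator \<open>T(a) + K\<close>, with eigenvalue \<open>a(t)\<close>.
  Hence \<open>A \<mapsto> a(t)\<close> is a well-defined contractive character of \<open>QT\<close>, positive on positive definite
  operators.  As \<open>QT\<close> is a closed algebra (semicommutators \<open>T(a) T(b) - T(a b)\<close> are compact), it
  contains the square roots and inverses of its positive definite elements.  The mean
  \<open>X = A # B\<close> is the positive definite solution of \<open>X A\<^sup>-\<^sup>1 X = B\<close>, so its symbol is the geometric
  mean of the symbols.  The ALM iteration converges because the Thompson distance of neighbouring
  entries is divided by \<open>p - 1\<close> in each step; it preserves the product of the symbols, and in the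
  limit this product is the \<open>p\<close>-th power of the symbol of the mean.
\<close>

section \<open>Symmetric operators on a real Hilbert space\<close>

text \<open>Complex linearity is treated as membership in a closed real algebra. Order, roots and
  inverses are developed for symmetric operators over the reals, and the existence lemmas take an
  arbitrary closed algebra as a parameter. Applied to \<open>bounded_ops\<close>, to commutants and
  to \<open>QT\<close>, the same fixed point arguments yield complex linearity, commutation
  relations and quasi-Toeplitz structure. Square roots given by definite descriptions tell a
  character nothing directly. The Riccati equation replaces them by products, on which a character
  can be evaluated, and the uniqueness of its positive definite solution also gives symmetry and
  homogeneity of the mean. Beyond two operators the mean exists only as a limit of lower means, so
  its well-definedness cannot be separated from quantitative estimates: \<open>alm_regular\<close>
  carries positivity, idempotence and an averaged Thompson bound through one induction. The symbol
  enters only afterwards, through \<open>alm_mean_multiplicative\<close>, which works with an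
  abstract positive function of operators.\<close>

lemmas blinfun_compose_simps =
  bounded_bilinear.add_left[OF bounded_bilinear_blinfun_compose]
  bounded_bilinear.add_right[OF bounded_bilinear_blinfun_compose]
  bounded_bilinear.diff_left[OF bounded_bilinear_blinfun_compose]
  bounded_bilinear.diff_right[OF bounded_bilinear_blinfun_compose]
  bounded_bilinear.scaleR_left[OF bounded_bilinear_blinfun_compose]
  bounded_bilinear.scaleR_right[OF bounded_bilinear_blinfun_compose]

lemma blinfun_compose_assoc: "(A o\<^sub>L B) o\<^sub>L C = A o\<^sub>L (B o\<^sub>L C)"
  by (intro blinfun_eqI) simp

lemma blinfun_compose_id [simp]: "id_blinfun o\<^sub>L A = A" "A o\<^sub>L id_blinfun = A"
  by (auto intro: blinfun_eqI)

definition symmetric_op :: "('a::real_inner \<Rightarrow>\<^sub>L 'a) \<Rightarrow> bool" where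
  "symmetric_op A \<longleftrightarrow> (\<forall>x y. A x \<bullet> y = x \<bullet> A y)"

text \<open>Only quadratic forms are compared, so this is a preorder on all operators; on symmetric
  ones it is antisymmetric by \<open>op_le_antisym\<close>.\<close>

definition op_le :: "('a::real_inner \<Rightarrow>\<^sub>L 'a) \<Rightarrow> ('a \<Rightarrow>\<^sub>L 'a) \<Rightarrow> bool" (infix "\<preceq>" 50) where
  "A \<preceq> B \<longleftrightarrow> (\<forall>v. v \<bullet> A v \<le> v \<bullet> B v)"

text \<open>The lower bound is uniform because in infinite dimension mere positivity of the form
  does not give invertibility.\<close>

definition posdef :: "('a::real_inner \<Rightarrow>\<^sub>L 'a) \<Rightarrow> bool" where
  "posdef A \<longleftrightarrow> symmetric_op A \<and> (\<exists>\<gamma>>0. \<gamma> *\<^sub>R id_blinfun \<preceq> A)"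

lemma symmetric_op_id: "symmetric_op id_blinfun"
  by (simp add: symmetric_op_def)

lemma symmetric_op_add: "symmetric_op A \<Longrightarrow> symmetric_op B \<Longrightarrow> symmetric_op (A + B)"
  by (simp add: symmetric_op_def blinfun.bilinear_simps inner_simps)

lemma symmetric_op_diff: "symmetric_op A \<Longrightarrow> symmetric_op B \<Longrightarrow> symmetric_op (A - B)"
  by (simp add: symmetric_op_def blinfun.bilinear_simps inner_simps)

lemma symmetric_op_scaleR: "symmetric_op A \<Longrightarrow> symmetric_op (r *\<^sub>R A)"
  by (simp add: symmetric_op_def blinfun.bilinear_simps inner_simps)

lemma symmetric_op_congruence:
  "symmetric_op S \<Longrightarrow> symmetric_op A \<Longrightarrow> symmetric_op (S o\<^sub>L A o\<^sub>L S)"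
  by (simp add: symmetric_op_def)

lemma symmetric_op_square: "symmetric_op A \<Longrightarrow> symmetric_op (A o\<^sub>L A)"
  by (simp add: symmetric_op_def)

lemma closed_symmetric_op: "closed {A :: 'a::real_inner \<Rightarrow>\<^sub>L 'a. symmetric_op A}"
proof -
  have "{A :: 'a \<Rightarrow>\<^sub>L 'a. symmetric_op A} = (\<Inter>x. \<Inter>y. {A. blinfun_apply A x \<bullet> y = x \<bullet> blinfun_apply A y})"
    by (auto simp: symmetric_op_def)
  moreover have "closed \<dots>"
    by (intro closed_INT ballI closed_Collect_eq continuous_intros)
  ultimately show ?thesis by simp
qed

section \<open>The order given by quadratic forms\<close>

lemma op_le_refl: "A \<preceq> A"
  by (simp add: op_le_def)

lemma op_le_trans: "A \<preceq> B \<Longrightarrow> B \<preceq> C \<Longrightarrow> A \<preceq> C"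
  unfolding op_le_def by (meson order_trans)

lemma op_le_scaleR: "A \<preceq> B \<Longrightarrow> 0 \<le> c \<Longrightarrow> c *\<^sub>R A \<preceq> c *\<^sub>R B"
  by (simp add: op_le_def blinfun.bilinear_simps mult_left_mono)

lemma op_le_congruence:
  assumes "A \<preceq> B" and "symmetric_op S"
  shows "S o\<^sub>L A o\<^sub>L S \<preceq> S o\<^sub>L B o\<^sub>L S"
proof -
  have "v \<bullet> S (C (S v)) = S v \<bullet> C (S v)" for v and C :: "'a \<Rightarrow>\<^sub>L 'a"
    using assms(2) by (simp add: symmetric_op_def)
  then show ?thesis using assms(1) by (simp add: op_le_def)
qed

lemma op_le_scaleR_left_mono:
  assumes "0 \<preceq> A" "r \<le> s"
  shows "r *\<^sub>R A \<preceq> s *\<^sub>R A"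
  using assms by (simp add: op_le_def blinfun.bilinear_simps mult_right_mono)

lemma op_le_norm_id: "A \<preceq> norm A *\<^sub>R id_blinfun"
  unfolding op_le_def
proof
  fix v
  have "v \<bullet> A v \<le> norm v * norm (A v)" by (rule norm_cauchy_schwarz)
  also have "\<dots> \<le> norm v * (norm A * norm v)" by (intro mult_left_mono norm_blinfun) simp
  finally show "v \<bullet> A v \<le> v \<bullet> (norm A *\<^sub>R id_blinfun) v"
    by (simp add: blinfun.bilinear_simps power2_eq_square mult_ac flip: power2_norm_eq_inner)
qed

lemma op_le_lim:
  assumes "X \<longlonglongrightarrow> A" "Y \<longlonglongrightarrow> B" "\<And>n. X n \<preceq> Y n"
  shows "A \<preceq> B"
  unfolding op_le_def
proof
  fix v
  have "(\<lambda>n. v \<bullet> X n v) \<longlonglongrightarrow> v \<bullet> A v" "(\<lambda>n. v \<bullet> Y n v) \<longlonglongrightarrow> v \<bullet> B v"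
    by (intro tendsto_intros assms)+
  then show "v \<bullet> A v \<le> v \<bullet> B v"
    by (rule LIMSEQ_le) (use assms(3) in \<open>auto simp: op_le_def\<close>)
qed

text \<open>Polarisation: for x parallel to \<open>A y\<close> with the norm of \<open>y\<close>,
  symmetry gives 4 x . A y = q(x + y) - q(x - y), where q is the form of \<open>A\<close>. By the
  parallelogram law the right-hand side is at most 4 e |y|^2, whereas the left-hand side is 4 |y| |A
  y|.\<close>

lemma norm_symmetric_le:
  assumes A: "symmetric_op A" and bd: "\<And>v. \<bar>v \<bullet> A v\<bar> \<le> e * (norm v)\<^sup>2" and e: "0 \<le> e"
  shows "norm A \<le> e"
proof (rule norm_blinfun_bound[OF e])
  fix y
  show "norm (A y) \<le> e * norm y"
  proof (cases "A y = 0 \<or> y = 0")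
    case True
    then show ?thesis using e by (auto simp: blinfun.bilinear_simps)
  next
    case False
    define x where "x = (norm y / norm (A y)) *\<^sub>R A y"
    have nx: "norm x = norm y" using False by (simp add: x_def)
    have ip: "x \<bullet> A y = norm y * norm (A y)"
      using False by (simp add: x_def power2_eq_square flip: power2_norm_eq_inner)
    have "y \<bullet> A x = x \<bullet> A y" using A by (simp add: symmetric_op_def inner_commute)
    then have "4 * (x \<bullet> A y) = (x + y) \<bullet> A (x + y) - (x - y) \<bullet> A (x - y)"
      by (simp add: blinfun.bilinear_simps inner_simps)
    also have "\<dots> \<le> e * (norm (x + y))\<^sup>2 + e * (norm (x - y))\<^sup>2"
      using bd[of "x + y"] bd[of "x - y"] by linarith
    also have "\<dots> = 2 * e * ((norm x)\<^sup>2 + (norm y)\<^sup>2)"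
      by (simp add: power2_norm_eq_inner inner_simps algebra_simps)
    finally have "norm y * norm (A y) \<le> norm y * (e * norm y)"
      unfolding ip nx by (simp add: power2_eq_square algebra_simps)
    then show ?thesis using False by simp
  qed
qed

text \<open>The form of \<open>Q\<close> is nonnegative at v - s Q v. As \<open>Q\<close> is at most
  \<open>C\<close>, the term quadratic in s is at most s^2 C |Q v|^2, and s = 1 / C, the minimiser
  of s^2 C - 2 s, leaves s |Q v|^2 \<le> v . Q v.\<close>

lemma norm_apply_nonneg_sq_le:
  assumes Q: "symmetric_op Q" "0 \<preceq> Q" and C: "norm Q \<le> C" "0 < C"
  shows "(norm (Q v))\<^sup>2 \<le> C * (v \<bullet> Q v)"
proof -
  define s where "s = 1 / C"
  let ?x = "v - s *\<^sub>R Q v"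
  have "v \<bullet> Q (Q v) = Q v \<bullet> Q v" using Q(1) by (simp add: symmetric_op_def)
  then have "?x \<bullet> Q ?x = v \<bullet> Q v - 2 * s * (norm (Q v))\<^sup>2 + s\<^sup>2 * (Q v \<bullet> Q (Q v))"
    by (simp add: blinfun.bilinear_simps inner_simps power2_norm_eq_inner)
      (simp add: power2_eq_square algebra_simps)
  moreover have "0 \<le> ?x \<bullet> Q ?x" using Q(2) by (simp add: op_le_def)
  moreover have "Q v \<bullet> Q (Q v) \<le> C * (norm (Q v))\<^sup>2"
    using op_le_norm_id[of Q] mult_right_mono[OF C(1), of "(norm (Q v))\<^sup>2"]
    by (auto simp: op_le_def blinfun.bilinear_simps power2_norm_eq_inner elim!: allE[of _ "Q v"])
  then have "s\<^sup>2 * (Q v \<bullet> Q (Q v)) \<le> s\<^sup>2 * (C * (norm (Q v))\<^sup>2)"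
    by (intro mult_left_mono) auto
  moreover have "s\<^sup>2 * (C * (norm (Q v))\<^sup>2) = s * (norm (Q v))\<^sup>2"
    using C by (simp add: s_def power2_eq_square)
  ultimately have "s * (norm (Q v))\<^sup>2 \<le> v \<bullet> Q v" by linarith
  then show ?thesis using C by (simp add: s_def field_simps)
qed

section \<open>Uniformly positive operators and their comparison\<close>

lemma posdefE:
  assumes "posdef A"
  obtains \<gamma> where "\<gamma> > 0" "\<And>v. \<gamma> * (norm v)\<^sup>2 \<le> v \<bullet> A v"
  using assms by (auto simp: posdef_def op_le_def blinfun.bilinear_simps power2_norm_eq_inner)

lemma posdefI:
  assumes "symmetric_op A" "\<gamma> > 0" "\<And>v. \<gamma> * (norm v)\<^sup>2 \<le> v \<bullet> A v"
  shows "posdef A"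
  using assms
  by (auto simp: posdef_def op_le_def blinfun.bilinear_simps power2_norm_eq_inner intro!: exI[of _ \<gamma>])

lemma posdef_symmetric: "posdef A \<Longrightarrow> symmetric_op A"
  by (simp add: posdef_def)

lemma posdef_nonneg:
  assumes "posdef A" shows "0 \<preceq> A"
proof -
  obtain \<gamma> where \<gamma>: "\<gamma> > 0" "\<And>v. \<gamma> * (norm v)\<^sup>2 \<le> v \<bullet> A v" using posdefE[OF assms] by metis
  have "0 \<le> v \<bullet> A v" for v
    by (rule order_trans[OF _ \<gamma>(2)]) (use \<gamma>(1) in simp)
  then show ?thesis by (simp add: op_le_def)
qed

lemma posdef_mono: "posdef A \<Longrightarrow> A \<preceq> B \<Longrightarrow> symmetric_op B \<Longrightarrow> posdef B"
  unfolding posdef_def by (blast intro: op_le_trans)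

lemma posdef_scaleR:
  assumes A: "posdef A" and c: "c > 0"
  shows "posdef (c *\<^sub>R A)"
proof -
  obtain \<gamma> where \<gamma>: "\<gamma> > 0" "\<And>v. \<gamma> * (norm v)\<^sup>2 \<le> v \<bullet> A v" using posdefE[OF A] by metis
  show ?thesis
  proof (rule posdefI)
    show "symmetric_op (c *\<^sub>R A)" by (intro symmetric_op_scaleR posdef_symmetric A)
    show "c * \<gamma> > 0" using c \<gamma> by simp
    show "c * \<gamma> * (norm v)\<^sup>2 \<le> v \<bullet> (c *\<^sub>R A) v" for v
      using c \<gamma> by (simp add: blinfun.bilinear_simps mult.assoc mult_left_mono)
  qed
qed

lemma posdef_apply_eq_0:
  assumes "posdef A" "A v = 0"
  shows "v = 0"
proof -
  obtain \<gamma> where "\<gamma> > 0" "\<gamma> * (norm v)\<^sup>2 \<le> v \<bullet> A v" using posdefE[OF assms(1)] by metis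
  then show ?thesis using assms(2) by (simp add: mult_le_0_iff)
qed

text \<open>This makes Thompson distances finite. The constant compares the upper bound |A| |v|^2
  with the lower bound \<gamma> |v|^2; adding 1 to the norm keeps it positive.\<close>

lemma posdef_comparable:
  assumes "posdef A" "posdef B"
  shows "\<exists>c>0. A \<preceq> c *\<^sub>R B"
proof -
  obtain \<gamma> where \<gamma>: "\<gamma> > 0" "\<And>v. \<gamma> * (norm v)\<^sup>2 \<le> v \<bullet> B v" using posdefE[OF assms(2)] by metis
  let ?c = "(norm A + 1) / \<gamma>"
  have c: "?c > 0" using \<gamma> by (simp add: add_nonneg_pos)
  have "v \<bullet> A v \<le> ?c * (v \<bullet> B v)" for v
  proof -
    have "v \<bullet> A v \<le> norm A * (norm v)\<^sup>2"
      using op_le_norm_id[of A] by (simp add: op_le_def blinfun.bilinear_simps power2_norm_eq_inner)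
    also have "\<dots> \<le> ?c * (\<gamma> * (norm v)\<^sup>2)" using \<gamma>(1) by (simp add: mult_right_mono)
    also have "\<dots> \<le> ?c * (v \<bullet> B v)" using \<gamma>(2)[of v] c by (intro mult_left_mono) auto
    finally show ?thesis .
  qed
  then show ?thesis using c by (auto simp: op_le_def blinfun.bilinear_simps intro!: exI[of _ ?c])
qed

lemma op_le_antisym:
  assumes "A \<preceq> B" "B \<preceq> A" "symmetric_op A" "symmetric_op B"
  shows "A = B"
proof -
  have "norm (A - B) \<le> 0"
    by (rule norm_symmetric_le)
      (use assms in \<open>auto simp: op_le_def blinfun.bilinear_simps inner_simps intro: symmetric_op_diff antisym\<close>)
  then show ?thesis by simp
qed

text \<open>
  If \<open>v\<close> almost minimises the quadratic form of \<open>D\<close> on the unit sphere, with minimum \<open>l\<close>, then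
  \<open>D v\<close> is close to \<open>l v\<close>, so the form of \<open>D P + P D\<close> at \<open>v\<close> is close to \<open>2 l (v \<bullet> P v)\<close>.
\<close>

lemma lyapunov_nonneg:
  fixes D P :: "'a::real_inner \<Rightarrow>\<^sub>L 'a"
  assumes D: "symmetric_op D" and P: "posdef P" and DP: "\<And>v. 0 \<le> D v \<bullet> P v"
  shows "0 \<preceq> D"
proof (rule ccontr)
  assume "\<not> 0 \<preceq> D"
  then obtain u where u: "u \<bullet> D u < 0" by (auto simp: op_le_def not_le)
  then have u0: "u \<noteq> 0" by auto
  let ?F = "(\<lambda>v. v \<bullet> D v) ` sphere 0 1"
  define l where "l = Inf ?F"
  have bdd: "bdd_below ?F"
  proof (rule bdd_belowI2)
    fix v :: 'a assume v: "v \<in> sphere 0 1"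
    have "\<bar>v \<bullet> D v\<bar> \<le> norm v * norm (D v)" by (rule Cauchy_Schwarz_ineq2)
    also have "\<dots> \<le> norm D" using norm_blinfun[of D v] v by simp
    finally show "- norm D \<le> v \<bullet> D v" by linarith
  qed
  have usph: "sgn u \<in> sphere 0 1" using u0 by (simp add: norm_sgn)
  have "sgn u \<bullet> D (sgn u) = (u \<bullet> D u) / (norm u)\<^sup>2"
    by (simp add: sgn_div_norm blinfun.bilinear_simps power2_eq_square field_simps)
  also have "\<dots> < 0" using u u0 by (simp add: divide_less_0_iff)
  finally have "\<exists>x\<in>?F. x < 0" using usph by blast
  then have l: "l < 0" unfolding l_def using cInf_lower[OF _ bdd] by (meson le_less_trans)
  \<comment> \<open>The infimum \<open>l\<close> need not be attained. Subtracting it makes the form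
    nonnegative, so that a small value v . Q v forces a small vector \<open>Q v\<close>.\<close>
  define Q where "Q = D - l *\<^sub>R id_blinfun"
  have "l * (norm v)\<^sup>2 \<le> v \<bullet> D v" for v
  proof (cases "v = 0")
    case False
    then have "sgn v \<in> sphere 0 1" by (simp add: norm_sgn)
    then have "l \<le> sgn v \<bullet> D (sgn v)" unfolding l_def by (intro cInf_lower[OF _ bdd]) blast
    also have "\<dots> = (v \<bullet> D v) / (norm v)\<^sup>2"
      by (simp add: sgn_div_norm blinfun.bilinear_simps power2_eq_square field_simps)
    finally show ?thesis using False by (simp add: field_simps)
  qed simp
  then have Q0: "0 \<preceq> Q"
    by (simp add: op_le_def Q_def blinfun.bilinear_simps inner_simps power2_norm_eq_inner)
  have Qs: "symmetric_op Q"
    unfolding Q_def by (intro symmetric_op_diff D symmetric_op_scaleR symmetric_op_id)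
  obtain \<gamma> where \<gamma>: "\<gamma> > 0" "\<And>v. \<gamma> * (norm v)\<^sup>2 \<le> v \<bullet> P v" using posdefE[OF P] by metis
  define C where "C = norm Q + 1"
  have C: "norm Q \<le> C" "0 < C" by (simp_all add: C_def add_nonneg_pos)
  \<comment> \<open>Chosen so that the error \<open>b * norm P\<close> is at most half the absolute
    value of \<open>l * \<gamma>\<close>, which keeps the sum of the two negative.\<close>
  define b where "b = - (l * \<gamma>) / (2 * (norm P + 1))"
  have b: "b > 0" using l \<gamma> by (simp add: b_def divide_simps mult_less_0_iff add_nonneg_pos)
  have "l < l + b\<^sup>2 / C" using b C by simp
  moreover have "?F \<noteq> {}" using usph by blast
  ultimately have "\<exists>x\<in>?F. x < l + b\<^sup>2 / C"
    unfolding l_def by (subst (asm) cInf_less_iff[OF _ bdd])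
  then obtain v where v: "norm v = 1" "v \<bullet> D v < l + b\<^sup>2 / C" by auto
  have "(norm (Q v))\<^sup>2 \<le> C * (v \<bullet> Q v)" by (rule norm_apply_nonneg_sq_le[OF Qs Q0 C])
  also have "v \<bullet> Q v \<le> b\<^sup>2 / C"
    using v by (simp add: Q_def blinfun.bilinear_simps inner_simps flip: power2_norm_eq_inner)
  then have "C * (v \<bullet> Q v) \<le> b\<^sup>2" using C by (simp add: field_simps)
  finally have nQ: "norm (Q v) \<le> b" by (rule power2_le_imp_le) (use b in simp)
  have "D v \<bullet> P v = l * (v \<bullet> P v) + Q v \<bullet> P v"
    by (simp add: Q_def blinfun.bilinear_simps inner_simps)
  also have "\<dots> \<le> l * \<gamma> + b * norm P"
  proof (rule add_mono)
    show "l * (v \<bullet> P v) \<le> l * \<gamma>" using l \<gamma>(2)[of v] v by simp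
    have "Q v \<bullet> P v \<le> norm (Q v) * norm (P v)" by (rule norm_cauchy_schwarz)
    also have "\<dots> \<le> b * (norm P * norm v)" using b by (intro mult_mono nQ norm_blinfun) auto
    finally show "Q v \<bullet> P v \<le> b * norm P" using v by simp
  qed
  also have "\<dots> < 0"
  proof -
    have "b * norm P \<le> b * (norm P + 1)" using b by simp
    also have "\<dots> = - (l * \<gamma>) / 2"
      by (simp add: b_def add_nonneg_eq_0_iff field_simps) 
    finally show ?thesis using mult_neg_pos[OF l \<gamma>(1)] by linarith
  qed
  finally show False using DP[of v] by simp
qed

text \<open>For D = S - R and P = S + R the cross terms in D v . P v cancel, leaving v . S S v - v .
  R R v \<ge> 0, so \<open>lyapunov_nonneg\<close> applies. Monotonicity of the geometric mean rests
  on this.\<close>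

lemma sqrt_op_mono:
  fixes R S :: "'a::real_inner \<Rightarrow>\<^sub>L 'a"
  assumes "posdef R" "posdef S" and le: "R o\<^sub>L R \<preceq> S o\<^sub>L S"
  shows "R \<preceq> S"
proof -
  have sym: "symmetric_op R" "symmetric_op S" using assms by (auto intro: posdef_symmetric)
  have "R \<preceq> S + R"
    using posdef_nonneg[OF assms(2)] by (simp add: op_le_def blinfun.bilinear_simps inner_simps)
  then have "posdef (S + R)"
    by (rule posdef_mono[OF assms(1)]) (intro symmetric_op_add sym)
  moreover have "0 \<le> (S - R) v \<bullet> (S + R) v" for v
  proof -
    have "(S - R) v \<bullet> (S + R) v = v \<bullet> S (S v) - v \<bullet> R (R v)"
      using sym by (simp add: blinfun.bilinear_simps inner_simps symmetric_op_def)
        (metis inner_commute)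
    then show ?thesis using le by (simp add: op_le_def)
  qed
  ultimately have "0 \<preceq> S - R" by (intro lyapunov_nonneg[of _ "S + R"] symmetric_op_diff sym)
  then show ?thesis by (simp add: op_le_def blinfun.bilinear_simps inner_simps)
qed


section \<open>Square roots and inverses inside closed algebras\<close>

definition closed_algebra :: "('a::real_normed_vector \<Rightarrow>\<^sub>L 'a) set \<Rightarrow> bool" where
  "closed_algebra \<A> \<longleftrightarrow> closed \<A> \<and> id_blinfun \<in> \<A> \<and>
     (\<forall>A\<in>\<A>. \<forall>B\<in>\<A>. A + B \<in> \<A> \<and> A o\<^sub>L B \<in> \<A>) \<and> (\<forall>r. \<forall>A\<in>\<A>. r *\<^sub>R A \<in> \<A>)"

text \<open>An existence result inside a commutant delivers commutation relations for the
  constructed operator, in place of approximating it by polynomials.\<close>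

definition commutant :: "('a::real_normed_vector \<Rightarrow>\<^sub>L 'a) set \<Rightarrow> ('a \<Rightarrow>\<^sub>L 'a) set" where
  "commutant M = {A. \<forall>X\<in>M. A o\<^sub>L X = X o\<^sub>L A}"

lemma closed_algebra_commutant: "closed_algebra (commutant M)"
proof -
  have "commutant M = (\<Inter>X\<in>M. {A. A o\<^sub>L X = X o\<^sub>L A})" by (auto simp: commutant_def)
  moreover have "closed \<dots>"
    by (intro closed_INT ballI closed_Collect_eq continuous_intros)
  moreover have "(A o\<^sub>L B) o\<^sub>L X = X o\<^sub>L (A o\<^sub>L B)"
    if "A o\<^sub>L X = X o\<^sub>L A" "B o\<^sub>L X = X o\<^sub>L B" for A B X :: "'a \<Rightarrow>\<^sub>L 'a"
  proof -
    have "(A o\<^sub>L B) o\<^sub>L X = A o\<^sub>L (X o\<^sub>L B)" by (simp add: blinfun_compose_assoc that)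
    also have "\<dots> = (X o\<^sub>L A) o\<^sub>L B" by (simp add: that(1) flip: blinfun_compose_assoc)
    finally show ?thesis by (simp add: blinfun_compose_assoc)
  qed
  ultimately show ?thesis
    by (auto simp: closed_algebra_def commutant_def blinfun_compose_simps)
qed

lemma closed_algebra_Int:
  "closed_algebra \<A> \<Longrightarrow> closed_algebra \<B> \<Longrightarrow> closed_algebra (\<A> \<inter> \<B>)"
  by (auto simp: closed_algebra_def closed_Int)

lemma closed_algebra_diff:
  assumes "closed_algebra \<A>" "A \<in> \<A>" "B \<in> \<A>" shows "A - B \<in> \<A>"
proof -
  have "(- 1) *\<^sub>R B \<in> \<A>" using assms unfolding closed_algebra_def by blast
  then have "A + (- 1) *\<^sub>R B \<in> \<A>" using assms unfolding closed_algebra_def by blast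
  then show ?thesis by simp
qed

text \<open>Scaling by an upper bound \<open>M\<close> of the form puts the form of \<open>X\<close>
  between 0 and r |v|^2, and for symmetric operators the form controls the norm.\<close>

lemma posdef_eq_id_minus_contraction:
  fixes A :: "'a::real_inner \<Rightarrow>\<^sub>L 'a"
  assumes "closed_algebra \<A>" "A \<in> \<A>" "posdef A"
  obtains M r X where "M > 0" "0 \<le> r" "r < 1" "X \<in> \<A>" "symmetric_op X" "norm X \<le> r"
    "A = M *\<^sub>R (id_blinfun - X)"
proof -
  obtain \<gamma> where \<gamma>: "\<gamma> > 0" "\<And>v. \<gamma> * (norm v)\<^sup>2 \<le> v \<bullet> A v" using posdefE[OF assms(3)] by metis
  \<comment> \<open>Adding \<gamma> instead of another positive number ensures \<gamma> \<le> M,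
    hence 0 \<le> r < 1.\<close>
  define M where "M = norm A + \<gamma>"
  define r where "r = 1 - \<gamma> / M"
  define X where "X = id_blinfun - (1 / M) *\<^sub>R A"
  have M: "M > 0" "\<gamma> \<le> M" using \<gamma> by (auto simp: M_def add_nonneg_pos)
  have r: "0 \<le> r" "r < 1" using M \<gamma> by (auto simp: r_def)
  have X: "X \<in> \<A>" unfolding X_def
    using assms by (intro closed_algebra_diff[OF assms(1)]) (auto simp: closed_algebra_def)
  have Xs: "symmetric_op X" unfolding X_def
    by (intro symmetric_op_diff symmetric_op_id symmetric_op_scaleR posdef_symmetric assms)
  have "norm X \<le> r"
  proof (rule norm_symmetric_le[OF Xs _ r(1)])
    fix v
    have e: "v \<bullet> X v = (norm v)\<^sup>2 - (v \<bullet> A v) / M"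
      by (simp add: X_def blinfun.bilinear_simps inner_simps power2_norm_eq_inner)
    have "v \<bullet> A v \<le> norm A * (norm v)\<^sup>2"
      using op_le_norm_id[of A] by (simp add: op_le_def blinfun.bilinear_simps power2_norm_eq_inner)
    also have "\<dots> \<le> M * (norm v)\<^sup>2" using \<gamma>(1) by (simp add: M_def mult_right_mono)
    finally have "(v \<bullet> A v) / M \<le> (norm v)\<^sup>2" using M by (simp add: field_simps)
    moreover have "\<gamma> / M * (norm v)\<^sup>2 \<le> (v \<bullet> A v) / M"
      using M \<gamma>(2)[of v] by (simp add: divide_right_mono)
    ultimately show "\<bar>v \<bullet> X v\<bar> \<le> r * (norm v)\<^sup>2"
      unfolding e r_def by (simp add: left_diff_distrib)
  qed
  moreover have "A = M *\<^sub>R (id_blinfun - X)" using M by (simp add: X_def)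
  ultimately show ?thesis using that M r X Xs by blast
qed

text \<open>\<open>(1 - Y)\<^sup>2 = 1 - X\<close> is the fixed point equation \<open>Y = (X + Y\<^sup>2) / 2\<close>.\<close>

lemma posdef_sqrt_exists:
  fixes A :: "'a::{real_inner,banach} \<Rightarrow>\<^sub>L 'a"
  assumes alg: "closed_algebra \<A>" and "A \<in> \<A>" "posdef A"
  shows "\<exists>R\<in>\<A>. posdef R \<and> R o\<^sub>L R = A"
proof -
  obtain M r X where M: "M > 0" and r: "0 \<le> r" "r < 1"
    and X: "X \<in> \<A>" "symmetric_op X" "norm X \<le> r" and A: "A = M *\<^sub>R (id_blinfun - X)"
    using posdef_eq_id_minus_contraction[OF assms] .
  \<comment> \<open>The smaller root of (r + q^2) / 2 = q. The ball of radius \<open>q\<close> is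
    thus mapped into itself, and \<open>q\<close> is also the contraction constant on it.\<close>
  define q where "q = 1 - sqrt (1 - r)"
  have q: "0 \<le> q" "q < 1" using r by (auto simp: q_def)
  have "q\<^sup>2 = 1 - 2 * sqrt (1 - r) + (1 - r)" using r by (simp add: q_def power2_diff)
  then have rq: "(r + q\<^sup>2) / 2 = q" by (simp add: q_def)
  define f where "f Y = (1/2) *\<^sub>R (X + (Y o\<^sub>L Y))" for Y
  let ?S = "\<A> \<inter> {Y. symmetric_op Y} \<inter> cball 0 q"
  have "\<exists>!Y\<in>?S. f Y = Y"
  proof (rule Banach_fix)
    have "closed ?S"
      using alg by (intro closed_Int closed_symmetric_op closed_cball) (simp add: closed_algebra_def)
    then show "complete ?S" by (simp add: complete_eq_closed)
    have "0 *\<^sub>R id_blinfun \<in> \<A>" using alg by (auto simp: closed_algebra_def simp del: scale_zero_left)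
    then have "0 \<in> ?S" using q by (simp add: symmetric_op_def)
    then show "?S \<noteq> {}" by blast
    show "0 \<le> q" "q < 1" by (fact q)+
    show "f ` ?S \<subseteq> ?S"
    proof (rule image_subsetI)
      fix Y assume Y: "Y \<in> ?S"
      have "norm (f Y) \<le> (norm X + norm (Y o\<^sub>L Y)) / 2"
        unfolding f_def using norm_triangle_ineq[of X "Y o\<^sub>L Y"] by simp
      also have "norm (Y o\<^sub>L Y) \<le> q\<^sup>2"
        using norm_blinfun_compose[of Y Y] mult_mono[of "norm Y" q "norm Y" q] Y q
        by (simp add: power2_eq_square)
      finally have "norm (f Y) \<le> q" using X(3) rq by simp
      moreover have "f Y \<in> \<A>" using alg X Y by (simp add: f_def closed_algebra_def)
      moreover have "symmetric_op (f Y)"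
        unfolding f_def using X Y
        by (intro symmetric_op_scaleR symmetric_op_add symmetric_op_square) auto
      ultimately show "f Y \<in> ?S" by simp
    qed
    fix Y Z assume Y: "Y \<in> ?S" and Z: "Z \<in> ?S"
    \<comment> \<open>This splitting of Y^2 - Z^2 is valid without commutativity.\<close>
    have "f Y - f Z = (1/2) *\<^sub>R ((Y o\<^sub>L (Y - Z)) + ((Y - Z) o\<^sub>L Z))"
      by (simp add: f_def blinfun_compose_simps algebra_simps)
    then have "norm (f Y - f Z) = norm ((Y o\<^sub>L (Y - Z)) + ((Y - Z) o\<^sub>L Z)) / 2" by simp
    also have "\<dots> \<le> (norm Y * norm (Y - Z) + norm (Y - Z) * norm Z) / 2"
      by (intro divide_right_mono order_trans[OF norm_triangle_ineq] add_mono norm_blinfun_compose) auto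
    also have "\<dots> \<le> (q * norm (Y - Z) + norm (Y - Z) * q) / 2"
      using Y Z by (intro divide_right_mono add_mono mult_right_mono mult_left_mono) auto
    finally show "dist (f Y) (f Z) \<le> q * dist Y Z" by (simp add: dist_norm)
  qed
  then obtain Y where Y: "Y \<in> \<A>" "symmetric_op Y" "norm Y \<le> q" "f Y = Y" by auto
  define R where "R = sqrt M *\<^sub>R (id_blinfun - Y)"
  have "R \<in> \<A>"
    unfolding R_def using closed_algebra_diff[OF alg _ Y(1), of id_blinfun] alg
    by (auto simp: closed_algebra_def)
  moreover have "posdef R"
    unfolding R_def
  proof (intro posdef_scaleR posdefI[of _ "1 - q"] symmetric_op_diff symmetric_op_id Y(2))
    fix v
    have "v \<bullet> Y v \<le> norm Y * (norm v)\<^sup>2"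
      using op_le_norm_id[of Y] by (simp add: op_le_def blinfun.bilinear_simps power2_norm_eq_inner)
    also have "\<dots> \<le> q * (norm v)\<^sup>2" using Y by (intro mult_right_mono) auto
    finally show "(1 - q) * (norm v)\<^sup>2 \<le> v \<bullet> (id_blinfun - Y) v"
      by (simp add: blinfun.bilinear_simps inner_simps power2_norm_eq_inner left_diff_distrib)
  qed (use M q in auto)
  moreover have "R o\<^sub>L R = A"
  proof -
    have YY: "Y o\<^sub>L Y = 2 *\<^sub>R Y - X"
    proof -
      have "2 *\<^sub>R f Y = X + (Y o\<^sub>L Y)" by (simp add: f_def)
      then show ?thesis by (simp add: Y(4) algebra_simps)
    qed
    have "R o\<^sub>L R = (sqrt M * sqrt M) *\<^sub>R ((id_blinfun - Y) o\<^sub>L (id_blinfun - Y))"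
      unfolding R_def blinfun_compose_simps(5,6) scaleR_scaleR ..
    also have "(id_blinfun - Y) o\<^sub>L (id_blinfun - Y) = id_blinfun - X"
      by (simp add: blinfun_compose_simps YY) (simp add: algebra_simps scaleR_2)
    finally show ?thesis using M by (simp add: A)
  qed
  ultimately show ?thesis by blast
qed

text \<open>Both roots are compared with a third one, \<open>R\<close>, which commutes with both
  because it is built in their commutant. Commutation gives (U + R)(U - R) = 0 for U = S and U = T,
  and U + R is injective since \<open>R\<close> is positive definite. The roots are only
  semidefinite by hypothesis, matching the definition of \<open>op_sqrt\<close>.\<close>

lemma sqrt_op_unique:
  fixes S T :: "'a::{real_inner,banach} \<Rightarrow>\<^sub>L 'a"
  assumes S: "symmetric_op S" "0 \<preceq> S" and T: "symmetric_op T" "0 \<preceq> T"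
    and eq: "S o\<^sub>L S = T o\<^sub>L T" and pd: "posdef (S o\<^sub>L S)"
  shows "S = T"
proof -
  let ?A = "S o\<^sub>L S"
  have "?A \<in> commutant {S, T}"
    using blinfun_compose_assoc[of S S S] blinfun_compose_assoc[of T T T] eq
    by (simp add: commutant_def)
  from posdef_sqrt_exists[OF closed_algebra_commutant this pd]
  obtain R where R: "posdef R" "R o\<^sub>L R = ?A" "R o\<^sub>L S = S o\<^sub>L R" "R o\<^sub>L T = T o\<^sub>L R"
    by (auto simp: commutant_def)
  have "U = R" if U: "symmetric_op U" "0 \<preceq> U" "R o\<^sub>L U = U o\<^sub>L R" "U o\<^sub>L U = ?A" for U
  proof (rule blinfun_eqI)
    fix v
    have "R \<preceq> U + R"
      using U(2) by (simp add: op_le_def blinfun.bilinear_simps inner_simps)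
    then have "posdef (U + R)"
      by (rule posdef_mono[OF R(1)]) (intro symmetric_op_add U posdef_symmetric R)
    moreover have "(U + R) o\<^sub>L (U - R) = 0"
      using U R by (simp add: blinfun_compose_simps)
    then have "(U + R) ((U - R) v) = 0"
      by (metis blinfun_apply_blinfun_compose zero_blinfun.rep_eq)
    ultimately have "(U - R) v = 0" by (rule posdef_apply_eq_0)
    then show "U v = R v" by (simp add: blinfun.bilinear_simps)
  qed
  from this[OF S R(3)] this[OF T R(4)] eq show ?thesis by metis
qed

text \<open>The inverse of \<open>1 - X\<close> solves the fixed point equation \<open>Y = 1 + X Y\<close>.\<close>

lemma posdef_inverse_exists:
  fixes A :: "'a::{real_inner,banach} \<Rightarrow>\<^sub>L 'a"
  assumes alg: "closed_algebra \<A>" and "A \<in> \<A>" and pd: "posdef A"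
  shows "\<exists>B\<in>\<A>. posdef B \<and> A o\<^sub>L B = id_blinfun \<and> B o\<^sub>L A = id_blinfun"
proof -
  \<comment> \<open>Working inside the commutant of \<open>A\<close> turns the right inverse found
    by the fixed point argument into a two-sided one.\<close>
  let ?\<B> = "\<A> \<inter> commutant {A}"
  have alg': "closed_algebra ?\<B>" by (intro closed_algebra_Int alg closed_algebra_commutant)
  have "A \<in> ?\<B>" using assms by (simp add: commutant_def)
  then obtain M r X where M: "M > 0" and r: "0 \<le> r" "r < 1"
    and X: "X \<in> ?\<B>" "norm X \<le> r" and A: "A = M *\<^sub>R (id_blinfun - X)"
    using posdef_eq_id_minus_contraction[OF alg' _ pd] by metis
  have "\<exists>!Y\<in>?\<B>. id_blinfun + (X o\<^sub>L Y) = Y"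
  proof (rule Banach_fix)
    show "complete ?\<B>" using alg' by (simp add: complete_eq_closed closed_algebra_def)
    show "?\<B> \<noteq> {}" using X by blast
    show "0 \<le> r" "r < 1" by (fact r)+
    show "(\<lambda>Y. id_blinfun + (X o\<^sub>L Y)) ` ?\<B> \<subseteq> ?\<B>"
      using alg' X unfolding closed_algebra_def by blast
    fix Y Z :: "'a \<Rightarrow>\<^sub>L 'a"
    have "dist (id_blinfun + (X o\<^sub>L Y)) (id_blinfun + (X o\<^sub>L Z)) = norm (X o\<^sub>L (Y - Z))"
      by (simp add: dist_norm blinfun_compose_simps)
    also have "\<dots> \<le> norm X * norm (Y - Z)" by (rule norm_blinfun_compose)
    also have "\<dots> \<le> r * dist Y Z" using X by (simp add: dist_norm mult_right_mono)
    finally show "dist (id_blinfun + (X o\<^sub>L Y)) (id_blinfun + (X o\<^sub>L Z)) \<le> r * dist Y Z" .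
  qed
  then obtain Y where Y: "Y \<in> \<A>" "Y o\<^sub>L A = A o\<^sub>L Y" "id_blinfun + (X o\<^sub>L Y) = Y"
    by (auto simp: commutant_def)
  define B where "B = (1 / M) *\<^sub>R Y"
  have BA: "B \<in> \<A>" using Y alg by (simp add: B_def closed_algebra_def)
  have AB: "A o\<^sub>L B = id_blinfun"
  proof -
    have "A o\<^sub>L B = Y - (X o\<^sub>L Y)" using M by (simp add: A B_def blinfun_compose_simps)
    also have "\<dots> = id_blinfun" using Y(3) by (metis add_diff_cancel_right')
    finally show ?thesis .
  qed
  have BA': "B o\<^sub>L A = id_blinfun"
    using AB Y(2) by (simp add: B_def blinfun_compose_simps)
  have ABv: "A (B v) = v" for v using AB by (metis blinfun_apply_blinfun_compose blinfun_apply_id_blinfun)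
  obtain \<gamma> where \<gamma>: "\<gamma> > 0" "\<And>v. \<gamma> * (norm v)\<^sup>2 \<le> v \<bullet> A v" using posdefE[OF pd] by metis
  \<comment> \<open>|v| = |A (B v)| \<le> N |B v| turns the lower bound for \<open>A\<close> at
    \<open>B v\<close> into one for \<open>B\<close> at \<open>v\<close>; adding 1 keeps
    \<open>N\<close> positive.\<close>
  define N where "N = norm A + 1"
  have N: "N > 0" by (simp add: N_def add_nonneg_pos)
  have "posdef B"
  proof (rule posdefI)
    show "symmetric_op B"
      using posdef_symmetric[OF pd] unfolding symmetric_op_def by (metis ABv)
    show "\<gamma> / N\<^sup>2 > 0" using \<gamma> N by simp
    fix v
    have "norm v \<le> norm A * norm (B v)" using norm_blinfun[of A "B v"] by (simp add: ABv)
    also have "\<dots> \<le> N * norm (B v)" by (simp add: N_def mult_right_mono)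
    finally have "(norm v)\<^sup>2 \<le> (N * norm (B v))\<^sup>2" by (rule power_mono) simp
    then have "\<gamma> / N\<^sup>2 * (norm v)\<^sup>2 \<le> \<gamma> * (norm (B v))\<^sup>2"
      using \<gamma> N by (simp add: field_simps power_mult_distrib)
    also have "\<dots> \<le> B v \<bullet> A (B v)" by (rule \<gamma>)
    finally show "\<gamma> / N\<^sup>2 * (norm v)\<^sup>2 \<le> v \<bullet> B v" by (simp add: ABv inner_commute)
  qed
  then show ?thesis using BA AB BA' by blast
qed


section \<open>Complex-linear operators on the sequence space\<close>

instance ell2 :: banach ..

lemma ell2_inner_scaleC_left: "ell2_inner (ell2_scaleC c x) y = cnj c * ell2_inner x y"
proof -
  have "ell2_inner (ell2_scaleC c x) y = (\<Sum>n. cnj c * (cnj (ell2_nth x n) * ell2_nth y n))"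
    by (simp add: ell2_inner_def ell2_scaleC.rep_eq mult.assoc)
  also have "\<dots> = cnj c * ell2_inner x y"
    unfolding ell2_inner_def by (rule suminf_mult[OF summable_ell2_inner])
  finally show ?thesis .
qed

lemma norm_ell2_scaleC: "norm (ell2_scaleC c x) = cmod c * norm x"
proof -
  have "(\<lambda>n. (cmod (ell2_nth (ell2_scaleC c x) n))\<^sup>2) sums ((cmod c)\<^sup>2 * (norm x)\<^sup>2)"
    using sums_mult[OF norm_ell2_sums[of x], of "(cmod c)\<^sup>2"]
    by (simp add: ell2_scaleC.rep_eq norm_mult power_mult_distrib)
  then have "(norm (ell2_scaleC c x))\<^sup>2 = (cmod c * norm x)\<^sup>2"
    using sums_unique2[OF norm_ell2_sums[of "ell2_scaleC c x"]] by (simp add: power_mult_distrib)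
  then show ?thesis by simp
qed

lemma bounded_linear_ell2_scaleC: "bounded_linear (ell2_scaleC c)"
proof (rule bounded_linear_intro)
  show "norm (ell2_scaleC c x) \<le> norm x * cmod c" for x by (simp add: norm_ell2_scaleC)
qed (rule ell2_eqI; simp add: ell2_scaleC.rep_eq plus_ell2.rep_eq scaleR_ell2.rep_eq algebra_simps)+

text \<open>Complex-linear means commuting with all multiplications by complex scalars, so this is a
  commutant.\<close>

lemma closed_algebra_bounded_ops: "closed_algebra bounded_ops"
proof -
  have "bounded_ops = commutant (range (\<lambda>c. Blinfun (ell2_scaleC c)))"
    by (auto simp: bounded_ops_def commutant_def bounded_linear_Blinfun_apply
        bounded_linear_ell2_scaleC intro!: blinfun_eqI dest: arg_cong[where f = blinfun_apply] fun_cong)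
      (metis blinfun_apply_blinfun_compose bounded_linear_Blinfun_apply bounded_linear_ell2_scaleC)
  then show ?thesis by (metis closed_algebra_commutant)
qed

text \<open>The imaginary part of the inner product of x and y is the real part of that of ix and y,
  and complex homogeneity lets i pass through \<open>A\<close>; so the real inner product loses
  nothing.\<close>

lemma self_adjoint_iff:
  assumes "A \<in> bounded_ops"
  shows "self_adjoint A \<longleftrightarrow> symmetric_op A"
proof
  assume "self_adjoint A"
  then show "symmetric_op A" by (simp add: self_adjoint_def symmetric_op_def inner_ell2_def)
next
  assume A: "symmetric_op A"
  then have re: "Re (ell2_inner (A x) y) = Re (ell2_inner x (A y))" for x y
    by (simp add: symmetric_op_def inner_ell2_def)
  have im: "Im (ell2_inner x y) = Re (ell2_inner (ell2_scaleC \<i> x) y)" for x y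
    by (simp add: ell2_inner_scaleC_left)
  have "Im (ell2_inner (A x) y) = Im (ell2_inner x (A y))" for x y
    using re[of "ell2_scaleC \<i> x" y] assms unfolding im by (simp add: bounded_ops_def)
  with re show "self_adjoint A" by (simp add: self_adjoint_def complex_eq_iff)
qed

lemma positive_definite_iff: "positive_definite A \<longleftrightarrow> A \<in> bounded_ops \<and> posdef A"
  unfolding positive_definite_def posdef_def
  by (auto simp: self_adjoint_iff op_le_def blinfun.bilinear_simps power2_norm_eq_inner)
    (auto simp: inner_ell2_def)

lemma positive_semidefinite_iff:
  "positive_semidefinite A \<longleftrightarrow> A \<in> bounded_ops \<and> symmetric_op A \<and> 0 \<preceq> A"
  unfolding positive_semidefinite_def
  by (auto simp: self_adjoint_iff op_le_def blinfun.bilinear_simps) (auto simp: inner_ell2_def)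

lemma positive_definite_posdef: "positive_definite A \<Longrightarrow> posdef A"
  by (simp add: positive_definite_iff)

lemma positive_definite_symmetric: "positive_definite A \<Longrightarrow> symmetric_op A"
  by (simp add: positive_definite_iff posdef_symmetric)

lemma positive_definite_scaleR: "positive_definite A \<Longrightarrow> c > 0 \<Longrightarrow> positive_definite (c *\<^sub>R A)"
  using closed_algebra_bounded_ops
  by (simp add: positive_definite_iff posdef_scaleR closed_algebra_def)

section \<open>Identifying the constructed roots and inverses with \<open>op_sqrt\<close> and
  \<open>op_inverse\<close>\<close>

lemma op_sqrt_eqI:
  assumes "positive_definite S" "S o\<^sub>L S = A" "positive_definite A"
  shows "op_sqrt A = S"
  unfolding op_sqrt_def
proof (rule the_equality)
  show S: "positive_semidefinite S \<and> S o\<^sub>L S = A"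
    using assms by (simp add: positive_definite_iff positive_semidefinite_iff posdef_symmetric posdef_nonneg)
  fix T assume T: "positive_semidefinite T \<and> T o\<^sub>L T = A"
  show "T = S"
  proof (rule sqrt_op_unique)
    show "T o\<^sub>L T = S o\<^sub>L S" using T assms(2) by metis
    show "posdef (T o\<^sub>L T)" using T assms(3) positive_definite_posdef by metis
  qed (use S T positive_semidefinite_iff in blast)+
qed

text \<open>A root is built inside \<open>\<A>\<close> intersected with \<open>bounded_ops\<close>;
  uniqueness identifies it with \<open>op_sqrt A\<close>. The root thus lies in every closed algebra
  that contains \<open>A\<close>, in particular in \<open>QT\<close>.\<close>

lemma positive_definite_sqrt:
  assumes "closed_algebra \<A>" "A \<in> \<A>" "positive_definite A"
  shows "op_sqrt A \<in> \<A>" "positive_definite (op_sqrt A)" "op_sqrt A o\<^sub>L op_sqrt A = A"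
proof -
  have "A \<in> \<A> \<inter> bounded_ops" "posdef A" using assms by (auto simp: positive_definite_iff)
  from posdef_sqrt_exists[OF closed_algebra_Int[OF assms(1) closed_algebra_bounded_ops] this]
  obtain R where R: "R \<in> \<A>" "positive_definite R" "R o\<^sub>L R = A"
    by (auto simp: positive_definite_iff)
  moreover from R have "op_sqrt A = R" using assms by (intro op_sqrt_eqI)
  ultimately show "op_sqrt A \<in> \<A>" "positive_definite (op_sqrt A)" "op_sqrt A o\<^sub>L op_sqrt A = A"
    by auto
qed

lemma op_inverse_eqI:
  assumes "A o\<^sub>L B = id_blinfun" "B o\<^sub>L A = id_blinfun"
  shows "op_inverse A = B"
  unfolding op_inverse_def
proof (rule the_equality)
  show "C = B" if "A o\<^sub>L C = id_blinfun \<and> C o\<^sub>L A = id_blinfun" for C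
  proof -
    have "C = (B o\<^sub>L A) o\<^sub>L C" using assms by simp
    also have "\<dots> = B" using that by (simp add: blinfun_compose_assoc)
    finally show ?thesis .
  qed
qed (use assms in simp)

lemma positive_definite_inverse:
  assumes "closed_algebra \<A>" "A \<in> \<A>" "positive_definite A"
  shows "op_inverse A \<in> \<A>" "positive_definite (op_inverse A)"
    "A o\<^sub>L op_inverse A = id_blinfun" "op_inverse A o\<^sub>L A = id_blinfun"
proof -
  have "A \<in> \<A> \<inter> bounded_ops" "posdef A" using assms by (auto simp: positive_definite_iff)
  from posdef_inverse_exists[OF closed_algebra_Int[OF assms(1) closed_algebra_bounded_ops] this]
  obtain B where B: "B \<in> \<A>" "positive_definite B" "A o\<^sub>L B = id_blinfun" "B o\<^sub>L A = id_blinfun"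
    by (auto simp: positive_definite_iff)
  moreover from B have "op_inverse A = B" by (intro op_inverse_eqI)
  ultimately show "op_inverse A \<in> \<A>" "positive_definite (op_inverse A)"
    "A o\<^sub>L op_inverse A = id_blinfun" "op_inverse A o\<^sub>L A = id_blinfun" by auto
qed

lemma closed_algebra_UNIV: "closed_algebra UNIV"
  by (simp add: closed_algebra_def)

lemmas op_sqrt_pd = positive_definite_sqrt(2,3)[OF closed_algebra_UNIV UNIV_I]
lemmas op_inverse_pd = positive_definite_inverse(2-4)[OF closed_algebra_UNIV UNIV_I]

lemma closed_algebra_compose: "closed_algebra \<A> \<Longrightarrow> A \<in> \<A> \<Longrightarrow> B \<in> \<A> \<Longrightarrow> A o\<^sub>L B \<in> \<A>"
  by (simp add: closed_algebra_def)

lemma cancel_inverse: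
  assumes "A o\<^sub>L B = id_blinfun"
  shows "A o\<^sub>L (B o\<^sub>L C) = C" "A (B x) = x"
  using assms
  by (metis blinfun_compose_assoc blinfun_compose_id(1),
      metis blinfun_apply_blinfun_compose blinfun_apply_id_blinfun)

text \<open>Invertibility of \<open>S\<close> preserves the uniform lower bound: |v| is at most a
  constant times |S v|.\<close>

lemma positive_definite_congruence:
  assumes A: "positive_definite A" and S: "positive_definite S"
  shows "positive_definite (S o\<^sub>L A o\<^sub>L S)"
proof -
  let ?R = "op_inverse S"
  have sS: "symmetric_op S" using S by (rule positive_definite_symmetric)
  have sA: "symmetric_op A" using A by (rule positive_definite_symmetric)
  obtain \<gamma> where \<gamma>: "\<gamma> > 0" "\<And>v. \<gamma> * (norm v)\<^sup>2 \<le> v \<bullet> A v"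
    using posdefE[OF positive_definite_posdef[OF A]] by metis
  define N where "N = norm ?R + 1"
  have N: "N > 0" by (simp add: N_def add_nonneg_pos)
  have "posdef (S o\<^sub>L A o\<^sub>L S)"
  proof (rule posdefI)
    show "symmetric_op (S o\<^sub>L A o\<^sub>L S)" by (intro symmetric_op_congruence sS sA)
    show "\<gamma> / N\<^sup>2 > 0" using \<gamma> N by simp
    fix v
    have "norm v = norm (?R (S v))" using cancel_inverse(2)[OF op_inverse_pd(3)[OF S]] by simp
    also have "\<dots> \<le> norm ?R * norm (S v)" by (rule norm_blinfun)
    also have "\<dots> \<le> N * norm (S v)" by (simp add: N_def mult_right_mono)
    finally have "(norm v)\<^sup>2 \<le> (N * norm (S v))\<^sup>2" by (rule power_mono) simp
    then have "\<gamma> / N\<^sup>2 * (norm v)\<^sup>2 \<le> \<gamma> * (norm (S v))\<^sup>2"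
      using \<gamma> N by (simp add: field_simps power_mult_distrib)
    also have "\<dots> \<le> S v \<bullet> A (S v)" by (rule \<gamma>)
    finally show "\<gamma> / N\<^sup>2 * (norm v)\<^sup>2 \<le> v \<bullet> (S o\<^sub>L A o\<^sub>L S) v"
      using sS by (simp add: symmetric_op_def)
  qed
  moreover have "S o\<^sub>L A o\<^sub>L S \<in> bounded_ops"
    using A S by (intro closed_algebra_compose[OF closed_algebra_bounded_ops])
      (auto simp: positive_definite_iff)
  ultimately show ?thesis by (simp add: positive_definite_iff)
qed


section \<open>The geometric mean of two operators\<close>

text \<open>With R = A^(-1/2) and T the inner root, the inverse of \<open>A\<close> is R R, so the
  outer factors cancel in the Riccati expression and T T = R B R remains between two factors
  \<open>S\<close>.\<close>

lemma geo_mean_props: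
  assumes alg: "closed_algebra \<A>" "A \<in> \<A>" "B \<in> \<A>"
    and pd: "positive_definite A" "positive_definite B"
  shows "A #\<^sub>g B \<in> \<A>" "positive_definite (A #\<^sub>g B)"
    "(A #\<^sub>g B) o\<^sub>L op_inverse A o\<^sub>L (A #\<^sub>g B) = B"
proof -
  define S where "S = op_sqrt A"
  define R where "R = op_inverse S"
  define T where "T = op_sqrt (R o\<^sub>L B o\<^sub>L R)"
  have S: "S \<in> \<A>" "positive_definite S" "S o\<^sub>L S = A"
    unfolding S_def by (rule positive_definite_sqrt[OF alg(1,2) pd(1)])+
  have R: "R \<in> \<A>" "positive_definite R" "S o\<^sub>L R = id_blinfun" "R o\<^sub>L S = id_blinfun"
    unfolding R_def by (rule positive_definite_inverse[OF alg(1) S(1,2)])+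
  have M: "R o\<^sub>L B o\<^sub>L R \<in> \<A>" "positive_definite (R o\<^sub>L B o\<^sub>L R)"
    using alg R pd by (auto intro!: closed_algebra_compose positive_definite_congruence)
  have T: "T \<in> \<A>" "positive_definite T" "T o\<^sub>L T = R o\<^sub>L B o\<^sub>L R"
    unfolding T_def by (rule positive_definite_sqrt[OF alg(1) M])+
  have G: "A #\<^sub>g B = S o\<^sub>L T o\<^sub>L S" by (simp add: geo_mean_def S_def R_def T_def Let_def)
  show "A #\<^sub>g B \<in> \<A>" unfolding G using alg S T by (intro closed_algebra_compose)
  show "positive_definite (A #\<^sub>g B)"
    unfolding G by (rule positive_definite_congruence[OF T(2) S(2)])
  note cancel = R(3,4) cancel_inverse[OF R(3)] cancel_inverse[OF R(4)]
  have inv: "op_inverse A = R o\<^sub>L R"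
    by (rule op_inverse_eqI) (simp_all add: S(3)[symmetric] blinfun_compose_assoc cancel)
  have "(A #\<^sub>g B) o\<^sub>L op_inverse A o\<^sub>L (A #\<^sub>g B) = S o\<^sub>L ((T o\<^sub>L T) o\<^sub>L S)"
    by (simp add: G inv blinfun_compose_assoc cancel)
  also have "\<dots> = B" by (simp add: T(3) blinfun_compose_assoc cancel)
  finally show "(A #\<^sub>g B) o\<^sub>L op_inverse A o\<^sub>L (A #\<^sub>g B) = B" .
qed

lemmas geo_mean_pd = geo_mean_props(2)[OF closed_algebra_UNIV UNIV_I UNIV_I]
lemmas geo_mean_riccati = geo_mean_props(3)[OF closed_algebra_UNIV UNIV_I UNIV_I]

text \<open>If X solves the Riccati equation, then R X R is positive definite with square R B R, so
  it is the root occurring in the definition of the mean.\<close>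

lemma geo_mean_eqI:
  assumes A: "positive_definite A" and X: "positive_definite X"
    and eq: "X o\<^sub>L op_inverse A o\<^sub>L X = B"
  shows "A #\<^sub>g B = X"
proof -
  define S where "S = op_sqrt A"
  define R where "R = op_inverse S"
  have S: "positive_definite S" "S o\<^sub>L S = A"
    unfolding S_def by (rule op_sqrt_pd[OF A])+
  have R: "positive_definite R" "S o\<^sub>L R = id_blinfun" "R o\<^sub>L S = id_blinfun"
    unfolding R_def by (rule op_inverse_pd[OF S(1)])+
  note cancel = R(2,3) cancel_inverse[OF R(2)] cancel_inverse[OF R(3)]
  have inv: "op_inverse A = R o\<^sub>L R"
    by (rule op_inverse_eqI) (simp_all add: S(2)[symmetric] blinfun_compose_assoc cancel)
  have B: "positive_definite B"
    unfolding eq[symmetric] by (intro positive_definite_congruence X op_inverse_pd A)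
  have "op_sqrt (R o\<^sub>L B o\<^sub>L R) = R o\<^sub>L X o\<^sub>L R"
    by (intro op_sqrt_eqI positive_definite_congruence X R B)
      (simp add: eq[symmetric] inv blinfun_compose_assoc)
  then have "A #\<^sub>g B = S o\<^sub>L (R o\<^sub>L X o\<^sub>L R) o\<^sub>L S"
    by (simp add: geo_mean_def S_def R_def Let_def)
  then show ?thesis by (simp add: blinfun_compose_assoc cancel)
qed

text \<open>Inverting X A^(-1) X = B and multiplying by X on both sides gives X B^(-1) X = A: the
  same X solves the equation with the arguments exchanged.\<close>

lemma geo_mean_commute:
  assumes A: "positive_definite A" and B: "positive_definite B"
  shows "A #\<^sub>g B = B #\<^sub>g A"
proof -
  let ?X = "A #\<^sub>g B"
  have X: "positive_definite ?X" by (rule geo_mean_pd[OF A B])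
  let ?Y = "op_inverse ?X"
  note Ai = op_inverse_pd[OF A] and Y = op_inverse_pd[OF X]
  note cancel = Y(2,3) cancel_inverse[OF Y(2)] cancel_inverse[OF Y(3)]
    Ai(2,3) cancel_inverse[OF Ai(2)] cancel_inverse[OF Ai(3)]
  have B': "B = ?X o\<^sub>L (op_inverse A o\<^sub>L ?X)"
    using geo_mean_riccati[OF A B] by (simp add: blinfun_compose_assoc)
  have "op_inverse B = ?Y o\<^sub>L (A o\<^sub>L ?Y)"
    by (rule op_inverse_eqI; subst B'; simp add: blinfun_compose_assoc cancel)
  then have "?X o\<^sub>L op_inverse B o\<^sub>L ?X = A" by (simp add: blinfun_compose_assoc cancel)
  then show ?thesis using geo_mean_eqI[OF B X] by simp
qed

lemma geo_mean_self:
  assumes A: "positive_definite A"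
  shows "A #\<^sub>g A = A"
  by (rule geo_mean_eqI[OF A A]) (simp add: op_inverse_pd[OF A])

text \<open>The second argument occurs only under the root and between congruences, so operator
  monotonicity of the root applies; the first argument is handled through commutativity.\<close>

lemma geo_mean_mono_right:
  assumes A: "positive_definite A" and B: "positive_definite B" and D: "positive_definite D"
    and le: "B \<preceq> D"
  shows "A #\<^sub>g B \<preceq> A #\<^sub>g D"
proof -
  define S where "S = op_sqrt A"
  define R where "R = op_inverse S"
  have S: "positive_definite S" unfolding S_def by (rule op_sqrt_pd[OF A])
  have R: "positive_definite R" unfolding R_def by (rule op_inverse_pd[OF S])
  have C: "positive_definite (R o\<^sub>L B o\<^sub>L R)" "positive_definite (R o\<^sub>L D o\<^sub>L R)"
    by (intro positive_definite_congruence B D R)+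
  have "op_sqrt (R o\<^sub>L B o\<^sub>L R) \<preceq> op_sqrt (R o\<^sub>L D o\<^sub>L R)"
    by (rule sqrt_op_mono)
      (simp_all add: positive_definite_posdef op_sqrt_pd C
        op_le_congruence[OF le positive_definite_symmetric[OF R]])
  then show ?thesis
    unfolding geo_mean_def Let_def S_def[symmetric] R_def[symmetric]
    by (rule op_le_congruence) (rule positive_definite_symmetric[OF S])
qed

lemma geo_mean_mono:
  assumes "positive_definite A" "positive_definite B" "positive_definite C" "positive_definite D"
    and "A \<preceq> C" "B \<preceq> D"
  shows "A #\<^sub>g B \<preceq> C #\<^sub>g D"
proof -
  have "D #\<^sub>g A \<preceq> D #\<^sub>g C" by (intro geo_mean_mono_right assms)
  then have "A #\<^sub>g D \<preceq> C #\<^sub>g D" by (simp add: geo_mean_commute assms)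
  then show ?thesis by (intro op_le_trans[OF geo_mean_mono_right[OF assms(1,2,4,6)]])
qed

lemma geo_mean_scaleR:
  assumes A: "positive_definite A" and B: "positive_definite B" and "s > 0" "t > 0"
  shows "(s *\<^sub>R A) #\<^sub>g (t *\<^sub>R B) = sqrt (s * t) *\<^sub>R (A #\<^sub>g B)"
proof (rule geo_mean_eqI)
  show "positive_definite (s *\<^sub>R A)" by (intro positive_definite_scaleR assms)
  show "positive_definite (sqrt (s * t) *\<^sub>R (A #\<^sub>g B))"
    using assms by (intro positive_definite_scaleR geo_mean_pd) auto
  have "op_inverse (s *\<^sub>R A) = (1 / s) *\<^sub>R op_inverse A"
    using \<open>s > 0\<close> by (intro op_inverse_eqI) (simp_all add: blinfun_compose_simps op_inverse_pd[OF A])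
  then have "sqrt (s * t) *\<^sub>R (A #\<^sub>g B) o\<^sub>L op_inverse (s *\<^sub>R A) o\<^sub>L sqrt (s * t) *\<^sub>R (A #\<^sub>g B)
    = (sqrt (s * t) * sqrt (s * t) / s) *\<^sub>R ((A #\<^sub>g B) o\<^sub>L op_inverse A o\<^sub>L (A #\<^sub>g B))"
    by (simp only: blinfun_compose_simps scaleR_scaleR) (simp add: mult_ac)
  also have "\<dots> = t *\<^sub>R B" using assms by (simp add: geo_mean_riccati)
  finally show "sqrt (s * t) *\<^sub>R (A #\<^sub>g B) o\<^sub>L op_inverse (s *\<^sub>R A) o\<^sub>L sqrt (s * t) *\<^sub>R (A #\<^sub>g B)
    = t *\<^sub>R B" .
qed

text \<open>The averaged Thompson bound for two operators, on which the induction over the number of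
  arguments starts.\<close>

lemma geo_mean_le_exp:
  assumes pd: "positive_definite A" "positive_definite B" "positive_definite C" "positive_definite D"
    and le: "A \<preceq> exp a *\<^sub>R C" "B \<preceq> exp b *\<^sub>R D"
  shows "A #\<^sub>g B \<preceq> exp ((a + b) / 2) *\<^sub>R (C #\<^sub>g D)"
proof -
  have "sqrt (exp a * exp b) = exp ((a + b) / 2)"
    by (rule real_sqrt_unique) (simp_all add: power2_eq_square flip: exp_add)
  then show ?thesis
    using geo_mean_mono[OF pd(1,2) _ _ le] geo_mean_scaleR[OF pd(3,4), of "exp a" "exp b"] pd
    by (simp add: positive_definite_scaleR)
qed


section \<open>Convergence of the ALM iteration\<close>

text \<open>
  The hypotheses say that the Thompson distance between \<open>Y k\<close> and \<open>Y (k + 1)\<close> is at most \<open>e k\<close>.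
\<close>

lemma thompson_summable_convergent:
  fixes Y :: "nat \<Rightarrow> 'a::{real_inner,banach} \<Rightarrow>\<^sub>L 'a"
  assumes pd: "\<And>k. posdef (Y k)"
    and up: "\<And>k. Y (Suc k) \<preceq> exp (e k) *\<^sub>R Y k"
    and down: "\<And>k. Y k \<preceq> exp (e k) *\<^sub>R Y (Suc k)"
    and e: "\<And>k. 0 \<le> e k" "summable e"
  shows "\<exists>L. Y \<longlonglongrightarrow> L \<and> posdef L"
proof -
  define E where "E = suminf e"
  have sumE: "(\<Sum>j<k. e j) \<le> E" for k unfolding E_def by (rule sum_le_suminf) (use e in auto)
  have eE: "e k \<le> E" for k
    using sumE[of "Suc k"] e(1) sum_nonneg[of "{..<k}" e] by (simp add: e(1))
  have nonneg: "0 \<le> v \<bullet> Y k v" for k v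
    using posdef_nonneg[OF pd[of k]] by (simp add: op_le_def)
  \<comment> \<open>All iterates stay within a factor exp E of \<open>Y 0\<close>. The upper bound
    controls their norms, so that Thompson steps become norm steps; the lower bound makes the limit
    positive definite.\<close>
  have both: "Y k \<preceq> exp (\<Sum>j<k. e j) *\<^sub>R Y 0 \<and> Y 0 \<preceq> exp (\<Sum>j<k. e j) *\<^sub>R Y k" for k
  proof (induction k)
    case (Suc k)
    have "v \<bullet> Y (Suc k) v \<le> exp (\<Sum>j<Suc k. e j) * (v \<bullet> Y 0 v)" for v
    proof -
      have "v \<bullet> Y (Suc k) v \<le> exp (e k) * (v \<bullet> Y k v)"
        using up[of k] by (simp add: op_le_def blinfun.bilinear_simps)
      also have "\<dots> \<le> exp (e k) * (exp (\<Sum>j<k. e j) * (v \<bullet> Y 0 v))"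
        using Suc by (intro mult_left_mono) (auto simp: op_le_def blinfun.bilinear_simps)
      finally show ?thesis by (simp add: exp_add mult_ac)
    qed
    moreover have "v \<bullet> Y 0 v \<le> exp (\<Sum>j<Suc k. e j) * (v \<bullet> Y (Suc k) v)" for v
    proof -
      have "v \<bullet> Y 0 v \<le> exp (\<Sum>j<k. e j) * (v \<bullet> Y k v)"
        using Suc by (simp add: op_le_def blinfun.bilinear_simps)
      also have "\<dots> \<le> exp (\<Sum>j<k. e j) * (exp (e k) * (v \<bullet> Y (Suc k) v))"
        using down[of k] by (intro mult_left_mono) (auto simp: op_le_def blinfun.bilinear_simps)
      finally show ?thesis by (simp add: exp_add mult_ac)
    qed
    ultimately show ?case by (simp add: op_le_def blinfun.bilinear_simps)
  qed (simp add: op_le_refl)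
  define C where "C = exp E * norm (Y 0)"
  have C0: "0 \<le> C" by (simp add: C_def)
  have C: "v \<bullet> Y k v \<le> C * (norm v)\<^sup>2" for k v
  proof -
    have "v \<bullet> Y k v \<le> exp (\<Sum>j<k. e j) * (v \<bullet> Y 0 v)"
      using both[of k] by (simp add: op_le_def blinfun.bilinear_simps)
    also have "\<dots> \<le> exp E * (v \<bullet> Y 0 v)" using sumE nonneg by (intro mult_right_mono) auto
    also have "\<dots> \<le> exp E * (norm (Y 0) * (norm v)\<^sup>2)"
      using op_le_norm_id[of "Y 0"]
      by (intro mult_left_mono) (auto simp: op_le_def blinfun.bilinear_simps power2_norm_eq_inner)
    finally show ?thesis by (simp add: C_def mult_ac)
  qed
  have step: "norm (Y (Suc k) - Y k) \<le> exp E * C * e k" for k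
  proof -
    \<comment> \<open>The aim is exp(e) - 1 \<le> e exp(e), a bound linear in \<open>e k\<close> and
      therefore summable.\<close>
    have "1 - e k \<le> exp (- e k)" using exp_ge_add_one_self[of "- e k"] by simp
    then have "exp (e k) * (1 - e k) \<le> exp (e k) * exp (- e k)" by (intro mult_left_mono) auto
    then have "exp (e k) - 1 \<le> exp (e k) * e k" by (simp add: algebra_simps flip: exp_add)
    also have "\<dots> \<le> exp E * e k" using eE e by (intro mult_right_mono) auto
    finally have ee: "exp (e k) - 1 \<le> exp E * e k" .
    have "norm (Y (Suc k) - Y k) \<le> (exp (e k) - 1) * C"
    proof (rule norm_symmetric_le)
      show "symmetric_op (Y (Suc k) - Y k)" by (intro symmetric_op_diff posdef_symmetric pd)
      show "0 \<le> (exp (e k) - 1) * C" using C0 e by simp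
      fix v
      have "v \<bullet> Y (Suc k) v - v \<bullet> Y k v \<le> (exp (e k) - 1) * (v \<bullet> Y k v)"
        using up[of k] by (simp add: op_le_def blinfun.bilinear_simps algebra_simps)
      also have "\<dots> \<le> (exp (e k) - 1) * (C * (norm v)\<^sup>2)" using C e by (intro mult_left_mono) auto
      finally have 1: "v \<bullet> Y (Suc k) v - v \<bullet> Y k v \<le> (exp (e k) - 1) * (C * (norm v)\<^sup>2)" .
      have "v \<bullet> Y k v - v \<bullet> Y (Suc k) v \<le> (exp (e k) - 1) * (v \<bullet> Y (Suc k) v)"
        using down[of k] by (simp add: op_le_def blinfun.bilinear_simps algebra_simps)
      also have "\<dots> \<le> (exp (e k) - 1) * (C * (norm v)\<^sup>2)" using C e by (intro mult_left_mono) auto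
      finally show "\<bar>v \<bullet> (Y (Suc k) - Y k) v\<bar> \<le> (exp (e k) - 1) * C * (norm v)\<^sup>2"
        using 1 by (simp add: blinfun.bilinear_simps inner_simps mult.assoc abs_le_iff)
    qed
    also have "\<dots> \<le> exp E * e k * C" using ee C0 by (rule mult_right_mono)
    finally show ?thesis by (simp add: mult_ac)
  qed
  have "summable (\<lambda>k. exp E * C * e k)" by (intro summable_mult e)
  then have "summable (\<lambda>k. Y (Suc k) - Y k)"
    by (rule summable_comparison_test'[where N = 0]) (rule step)
  then have "(\<lambda>n. \<Sum>k<n. Y (Suc k) - Y k) \<longlonglongrightarrow> (\<Sum>k. Y (Suc k) - Y k)"
    by (rule summable_LIMSEQ)
  then have "(\<lambda>n. (Y n - Y 0) + Y 0) \<longlonglongrightarrow> (\<Sum>k. Y (Suc k) - Y k) + Y 0"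
    unfolding sum_lessThan_telescope by (intro tendsto_add tendsto_const)
  then obtain L where L: "Y \<longlonglongrightarrow> L" by auto
  have Ls: "symmetric_op L"
    using closed_sequentially[OF closed_symmetric_op _ L] posdef_symmetric[OF pd] by simp
  have "Y 0 \<preceq> exp E *\<^sub>R Y k" for k
    by (rule op_le_trans[OF conjunct2[OF both] op_le_scaleR_left_mono[OF posdef_nonneg[OF pd]]])
      (use sumE in simp)
  then have "Y 0 \<preceq> exp E *\<^sub>R L"
    by (rule op_le_lim[OF tendsto_const tendsto_scaleR[OF tendsto_const L]])
  then have "posdef (exp E *\<^sub>R L)" by (rule posdef_mono[OF pd]) (intro symmetric_op_scaleR Ls)
  then have "posdef (exp (- E) *\<^sub>R exp E *\<^sub>R L)" by (rule posdef_scaleR) simp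
  then have "posdef L" by (simp flip: exp_add)
  with L show ?thesis by blast
qed

text \<open>Here \<open>p\<close> is the number of arguments of the inner mean, so the step acts on
  tuples of length \<open>p + 1\<close>.\<close>

definition alm_step :: "nat \<Rightarrow> (nat \<Rightarrow> operator) \<Rightarrow> nat \<Rightarrow> operator" where
  "alm_step p B i = alm_mean p (omit i B)"

definition pd_tuple :: "nat \<Rightarrow> (nat \<Rightarrow> operator) \<Rightarrow> bool" where
  "pd_tuple p A \<longleftrightarrow> (\<forall>i<p. positive_definite (A i))"

text \<open>
  The last clause bounds the Thompson distance of two ALM means by the average of the distances
  of the arguments.  Together the clauses are the induction hypothesis for the convergence proof.
\<close>

definition alm_regular :: "nat \<Rightarrow> bool" where
  "alm_regular p \<longleftrightarrow> (\<forall>A. pd_tuple p A \<longrightarrow> positive_definite (alm_mean p A)) \<and>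
     (\<forall>A. positive_definite A \<longrightarrow> alm_mean p (\<lambda>_. A) = A) \<and>
     (\<forall>A B \<alpha>. pd_tuple p A \<longrightarrow> pd_tuple p B \<longrightarrow> (\<forall>i<p. A i \<preceq> exp (\<alpha> i) *\<^sub>R B i) \<longrightarrow>
        alm_mean p A \<preceq> exp ((\<Sum>i<p. \<alpha> i) / real p) *\<^sub>R alm_mean p B)"

lemma alm_regularD:
  assumes "alm_regular p"
  shows "pd_tuple p A \<Longrightarrow> positive_definite (alm_mean p A)"
    "positive_definite C \<Longrightarrow> alm_mean p (\<lambda>_. C) = C"
    "pd_tuple p A \<Longrightarrow> pd_tuple p B \<Longrightarrow> (\<And>i. i < p \<Longrightarrow> A i \<preceq> exp (\<alpha> i) *\<^sub>R B i) \<Longrightarrow>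
        alm_mean p A \<preceq> exp ((\<Sum>i<p. \<alpha> i) / real p) *\<^sub>R alm_mean p B"
  using assms by (auto simp: alm_regular_def)

section \<open>Leaving out one entry of a tuple\<close>

lemma omit_const [simp]: "omit i (\<lambda>_. c) = (\<lambda>_. c)"
  by (simp add: omit_def fun_eq_iff)

lemma ball_omit: "(\<And>i. i < Suc p \<Longrightarrow> P (x i)) \<Longrightarrow> j < p \<Longrightarrow> P (omit i x j)"
  by (simp add: omit_def)

lemma sum_omit: "i < Suc p \<Longrightarrow> (\<Sum>j<p. omit i x j) + x i = (\<Sum>j<Suc p. x j :: 'b::comm_monoid_add)"
proof (induction p)
  case (Suc p)
  show ?case
  proof (cases "i = Suc p")
    case True
    then have "(\<Sum>j<Suc p. omit i x j) = (\<Sum>j<Suc p. x j)" by (intro sum.cong) (auto simp: omit_def)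
    then show ?thesis using True by simp
  next
    case False
    then have i: "i < Suc p" using Suc.prems by simp
    then have "omit i x p = x (Suc p)" by (simp add: omit_def)
    then have "(\<Sum>j<Suc p. omit i x j) + x i = ((\<Sum>j<p. omit i x j) + x i) + x (Suc p)"
      by (simp add: ac_simps)
    then show ?thesis by (simp only: Suc.IH[OF i] sum.lessThan_Suc[of x "Suc p"])
  qed
qed simp

lemma prod_omit: "i < Suc p \<Longrightarrow> (\<Prod>j<p. omit i x j) * x i = (\<Prod>j<Suc p. x j :: 'b::comm_monoid_mult)"
proof (induction p)
  case (Suc p)
  show ?case
  proof (cases "i = Suc p")
    case True
    then have "(\<Prod>j<Suc p. omit i x j) = (\<Prod>j<Suc p. x j)" by (intro prod.cong) (auto simp: omit_def)
    then show ?thesis using True by simp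
  next
    case False
    then have i: "i < Suc p" using Suc.prems by simp
    then have "omit i x p = x (Suc p)" by (simp add: omit_def)
    then have "(\<Prod>j<Suc p. omit i x j) * x i = ((\<Prod>j<p. omit i x j) * x i) * x (Suc p)"
      by (simp add: ac_simps)
    then show ?thesis by (simp only: Suc.IH[OF i] prod.lessThan_Suc[of x "Suc p"])
  qed
qed simp

lemma omit_apply_fun: "f (omit i x j) = omit i (\<lambda>j. f (x j)) j"
  by (simp add: omit_def)

lemma pd_tuple_omit: "pd_tuple (Suc p) A \<Longrightarrow> pd_tuple p (omit i A)"
  by (simp add: pd_tuple_def omit_def)

lemma pd_tuple_alm_iterate:
  assumes "alm_regular p" "pd_tuple (Suc p) A"
  shows "pd_tuple (Suc p) ((alm_step p ^^ k) A)"
proof (induction k)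
  case (Suc k)
  then show ?case
    using alm_regularD(1)[OF assms(1) pd_tuple_omit[OF Suc]] by (simp add: pd_tuple_def alm_step_def)
qed (use assms in simp)

lemma op_le_exp_trans:
  assumes "A \<preceq> exp a *\<^sub>R B" "B \<preceq> exp b *\<^sub>R C"
  shows "A \<preceq> exp (a + b) *\<^sub>R C"
  using op_le_trans[OF assms(1) op_le_scaleR[OF assms(2), of "exp a"]] by (simp add: exp_add)

lemma op_le_exp_mono:
  assumes "A \<preceq> exp a *\<^sub>R B" "posdef B" "a \<le> b"
  shows "A \<preceq> exp b *\<^sub>R B"
  using op_le_trans[OF assms(1) op_le_scaleR_left_mono[OF posdef_nonneg[OF assms(2)]]] assms(3) by simp

lemma pd_tuple_diameter:
  assumes "pd_tuple p A"
  shows "\<exists>d\<ge>0. \<forall>i<p. \<forall>j<p. A i \<preceq> exp d *\<^sub>R A j"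
proof -
  have pd: "posdef (A i)" if "i < p" for i
    using assms that by (simp add: pd_tuple_def positive_definite_iff)
  have "\<exists>c>0. A i \<preceq> c *\<^sub>R A j" if "i < p" "j < p" for i j
    by (rule posdef_comparable) (use pd that in auto)
  then obtain c where c: "\<And>i j. i < p \<Longrightarrow> j < p \<Longrightarrow> c i j > 0 \<and> A i \<preceq> c i j *\<^sub>R A j" by metis
  \<comment> \<open>A sum of absolute values serves as a nonnegative common upper bound for the
    finitely many logarithms.\<close>
  define d where "d = (\<Sum>i<p. \<Sum>j<p. \<bar>ln (c i j)\<bar>)"
  have "A i \<preceq> exp d *\<^sub>R A j" if ij: "i < p" "j < p" for i j
  proof (rule op_le_exp_mono)
    show "A i \<preceq> exp (ln (c i j)) *\<^sub>R A j" using c[OF ij] by simp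
    have "ln (c i j) \<le> \<bar>ln (c i j)\<bar>" by simp
    also have "\<dots> \<le> (\<Sum>j<p. \<bar>ln (c i j)\<bar>)" using ij by (intro member_le_sum) auto
    also have "\<dots> \<le> d" unfolding d_def
      using ij by (intro member_le_sum[of i _ "\<lambda>i. \<Sum>j<p. \<bar>ln (c i j)\<bar>"] sum_nonneg) auto
    finally show "ln (c i j) \<le> d" .
  qed (rule pd[OF ij(2)])
  moreover have "d \<ge> 0" unfolding d_def by (intro sum_nonneg) auto
  ultimately show ?thesis by blast
qed

text \<open>
  The tuples omitting \<open>i\<close> and \<open>i + 1\<close> differ only in one position, so the Thompson distance of
  neighbouring entries is divided by \<open>p\<close> in each step.
\<close>

lemma alm_iterate_neighbours:
  assumes good: "alm_regular p" "p \<ge> 2" and A: "pd_tuple (Suc p) A"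
    and d: "d \<ge> 0" "\<forall>i<Suc p. \<forall>j<Suc p. A i \<preceq> exp d *\<^sub>R A j"
  shows "\<forall>i<p. (alm_step p ^^ k) A i \<preceq> exp (d / 2 ^ k) *\<^sub>R (alm_step p ^^ k) A (Suc i) \<and>
    (alm_step p ^^ k) A (Suc i) \<preceq> exp (d / 2 ^ k) *\<^sub>R (alm_step p ^^ k) A i"
proof (induction k)
  case (Suc k)
  let ?X = "(alm_step p ^^ k) A"
  have X: "pd_tuple (Suc p) ?X" by (rule pd_tuple_alm_iterate[OF good(1) A])
  \<comment> \<open>The actual gain is division by \<open>p\<close>; division by 2 is kept as a
    bound independent of \<open>p\<close>.\<close>
  have "d / 2 ^ k / real p \<le> d / 2 ^ Suc k"
    using d(1) good(2) by (simp add: field_simps mult_left_mono)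
  moreover have "alm_mean p (omit i ?X) \<preceq> exp (d / 2 ^ k / real p) *\<^sub>R alm_mean p (omit i' ?X)"
    if ii: "i < p \<and> i' = Suc i \<or> i' < p \<and> i = Suc i'" for i i'
  proof -
    \<comment> \<open>At this position each of the two shortened tuples holds the entry that the
      other omits; at all other positions they agree, so a single exponent is nonzero in the
      average.\<close>
    let ?m = "min i i'"
    have "alm_mean p (omit i ?X)
        \<preceq> exp ((\<Sum>j<p. if j = ?m then d / 2 ^ k else 0) / real p) *\<^sub>R alm_mean p (omit i' ?X)"
    proof (rule alm_regularD(3)[OF good(1)])
      fix j assume "j < p"
      show "omit i ?X j \<preceq> exp (if j = ?m then d / 2 ^ k else 0) *\<^sub>R omit i' ?X j"
      proof (cases "j = ?m")
        case True
        then show ?thesis using Suc.IH ii by (auto simp: omit_def)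
      next
        case False
        then have "omit i ?X j = omit i' ?X j" using ii by (auto simp: omit_def)
        then show ?thesis using False by (simp add: op_le_refl)
      qed
    qed (intro pd_tuple_omit X)+
    moreover have "?m < p" using ii by auto
    ultimately show ?thesis by simp
  qed
  moreover have "posdef (alm_mean p (omit i ?X))" for i
    by (intro positive_definite_posdef alm_regularD(1)[OF good(1)] pd_tuple_omit X)
  ultimately have "alm_mean p (omit i ?X) \<preceq> exp (d / 2 ^ Suc k) *\<^sub>R alm_mean p (omit i' ?X)"
    if "i < p \<and> i' = Suc i \<or> i' < p \<and> i = Suc i'" for i i'
    using that by (blast intro: op_le_exp_mono)
  then show ?case unfolding funpow.simps(2) o_apply alm_step_def by blast
qed (use d in auto)

lemma alm_iterate_diameter:
  assumes good: "alm_regular p" "p \<ge> 2" and A: "pd_tuple (Suc p) A"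
  shows "\<exists>d\<ge>0. \<forall>k. \<forall>i<Suc p. \<forall>j<Suc p.
    (alm_step p ^^ k) A i \<preceq> exp (d / 2 ^ k) *\<^sub>R (alm_step p ^^ k) A j"
proof -
  obtain d where d: "d \<ge> 0" "\<forall>i<Suc p. \<forall>j<Suc p. A i \<preceq> exp d *\<^sub>R A j"
    using pd_tuple_diameter[OF A] by blast
  have "(alm_step p ^^ k) A i \<preceq> exp (2 * real p * d / 2 ^ k) *\<^sub>R (alm_step p ^^ k) A j"
    if ij: "i < Suc p" "j < Suc p" for i j k
  proof -
    let ?X = "(alm_step p ^^ k) A"
    let ?d = "d / 2 ^ k"
    note nb = alm_iterate_neighbours[OF good A d, of k]
    \<comment> \<open>Entries are compared along the chain of neighbours down to entry 0. Going down
      and up again takes at most \<open>p\<close> links each way, hence the factor 2 p.\<close>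
    have 0: "?X i \<preceq> exp (real i * ?d) *\<^sub>R ?X 0 \<and> ?X 0 \<preceq> exp (real i * ?d) *\<^sub>R ?X i" if "i < Suc p" for i
      using that
    proof (induction i)
      case (Suc i)
      then have IH: "?X i \<preceq> exp (real i * ?d) *\<^sub>R ?X 0" "?X 0 \<preceq> exp (real i * ?d) *\<^sub>R ?X i"
        and n: "?X i \<preceq> exp ?d *\<^sub>R ?X (Suc i)" "?X (Suc i) \<preceq> exp ?d *\<^sub>R ?X i"
        using nb by auto
      show ?case
        using op_le_exp_trans[OF n(2) IH(1)] op_le_exp_trans[OF IH(2) n(1)]
        by (simp add: algebra_simps add_divide_distrib)
    qed (simp add: op_le_refl)
    have "?X i \<preceq> exp (real i * ?d + real j * ?d) *\<^sub>R ?X j"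
      by (rule op_le_exp_trans[of _ _ "?X 0"]) (use 0 ij in auto)
    then show ?thesis
    proof (rule op_le_exp_mono)
      show "posdef (?X j)"
        using pd_tuple_alm_iterate[OF good(1) A] ij by (simp add: pd_tuple_def positive_definite_iff)
      have "(real i + real j) * ?d \<le> (real p + real p) * ?d"
        using ij d(1) by (intro mult_right_mono add_mono) auto
      then show "real i * ?d + real j * ?d \<le> 2 * real p * d / 2 ^ k"
        by (simp add: distrib_right mult.assoc add_divide_distrib)
    qed
  qed
  then show ?thesis using d(1) by (intro exI[of _ "2 * real p * d"]) auto
qed

text \<open>By idempotence an entry is the mean of a constant tuple, so the averaged bound makes its
  next step no larger than the current diameter. The diameters are summable, which gives convergence
  of each entry, and tend to 0, which makes the limits equal.\<close>

lemma alm_iterate_convergent: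
  assumes good: "alm_regular p" "p \<ge> 2" and A: "pd_tuple (Suc p) A"
  shows "\<exists>L. positive_definite L \<and> (\<forall>i<Suc p. (\<lambda>k. (alm_step p ^^ k) A i) \<longlonglongrightarrow> L)"
proof -
  let ?X = "\<lambda>k. (alm_step p ^^ k) A"
  obtain d where d: "d \<ge> 0" and diam: "\<And>k i j. i < Suc p \<Longrightarrow> j < Suc p \<Longrightarrow>
      ?X k i \<preceq> exp (d / 2 ^ k) *\<^sub>R ?X k j"
    using alm_iterate_diameter[OF good A] by blast
  have pdt: "pd_tuple (Suc p) (?X k)" for k by (rule pd_tuple_alm_iterate[OF good(1) A])
  have pd: "positive_definite (?X k i)" if "i < Suc p" for k i
    using pdt[of k] that by (simp add: pd_tuple_def)
  have lim: "\<exists>L. (\<lambda>k. ?X k i) \<longlonglongrightarrow> L \<and> posdef L" if i: "i < Suc p" for i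
  proof (rule thompson_summable_convergent)
    fix k
    let ?e = "d / 2 ^ k"
    show "posdef (?X k i)" by (rule positive_definite_posdef[OF pd[OF i]])
    show "0 \<le> ?e" using d by simp
    have c: "pd_tuple p (\<lambda>_. ?X k i)" using pd[OF i] by (simp add: pd_tuple_def)
    have idem: "alm_mean p (\<lambda>_. ?X k i) = ?X k i" by (rule alm_regularD(2)[OF good(1) pd[OF i]])
    have avg: "(\<Sum>j<p. ?e) / real p = ?e" using good(2) by simp
    have X: "?X (Suc k) i = alm_mean p (omit i (?X k))" by (simp add: alm_step_def)
    have "alm_mean p (omit i (?X k)) \<preceq> exp ((\<Sum>j<p. ?e) / real p) *\<^sub>R alm_mean p (\<lambda>_. ?X k i)"
      by (rule alm_regularD(3)[OF good(1) pd_tuple_omit[OF pdt] c])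
        (rule ball_omit[where P = "\<lambda>Z. Z \<preceq> exp ?e *\<^sub>R ?X k i"], use diam i in auto)
    then show "?X (Suc k) i \<preceq> exp ?e *\<^sub>R ?X k i" unfolding avg idem X .
    have "alm_mean p (\<lambda>_. ?X k i) \<preceq> exp ((\<Sum>j<p. ?e) / real p) *\<^sub>R alm_mean p (omit i (?X k))"
      by (rule alm_regularD(3)[OF good(1) c pd_tuple_omit[OF pdt]])
        (rule ball_omit[where P = "\<lambda>Z. ?X k i \<preceq> exp ?e *\<^sub>R Z"], use diam i in auto)
    then show "?X k i \<preceq> exp ?e *\<^sub>R ?X (Suc k) i" unfolding avg idem X .
  next
    have "summable (\<lambda>k. d * (1 / 2) ^ k)" by (intro summable_mult summable_geometric) simp
    then show "summable (\<lambda>k. d / 2 ^ k)" by (simp add: power_one_over field_simps)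
  qed
  then obtain L where L: "\<And>i. i < Suc p \<Longrightarrow> (\<lambda>k. ?X k i) \<longlonglongrightarrow> L i \<and> posdef (L i)" by metis
  have "(\<lambda>k. d * (1 / 2) ^ k) \<longlonglongrightarrow> d * 0" by (intro tendsto_intros LIMSEQ_power_zero) simp
  then have "(\<lambda>k. d / 2 ^ k) \<longlonglongrightarrow> 0" by (simp add: power_one_over field_simps)
  then have e1: "(\<lambda>k. exp (d / 2 ^ k)) \<longlonglongrightarrow> exp 0" by (rule tendsto_exp)
  have le: "L i \<preceq> L j" if "i < Suc p" "j < Suc p" for i j
  proof -
    have "L i \<preceq> exp 0 *\<^sub>R L j"
      by (rule op_le_lim[of "\<lambda>k. ?X k i" _ "\<lambda>k. exp (d / 2 ^ k) *\<^sub>R ?X k j"])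
        (use L diam that in \<open>auto intro!: tendsto_scaleR e1 simp del: exp_zero\<close>)
    then show ?thesis by simp
  qed
  have eq: "L i = L 0" if "i < Suc p" for i
    using le that L by (intro op_le_antisym posdef_symmetric) auto
  have "closed bounded_ops" using closed_algebra_bounded_ops by (simp add: closed_algebra_def)
  moreover have "?X k 0 \<in> bounded_ops" for k using pd[of 0 k] by (simp add: positive_definite_iff)
  ultimately have "L 0 \<in> bounded_ops"
    using L[of 0] closed_sequentially[of bounded_ops "\<lambda>k. ?X k 0"] by simp
  then have "positive_definite (L 0)" using L by (simp add: positive_definite_iff)
  moreover have "(\<lambda>k. ?X k i) \<longlonglongrightarrow> L 0" if "i < Suc p" for i
    using L[OF that] eq[OF that] by metis
  ultimately show ?thesis by blast
qed

lemma alm_mean_limit: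
  assumes good: "alm_regular p" "p \<ge> 2" and A: "pd_tuple (Suc p) A"
  shows "positive_definite (alm_mean (Suc p) A)"
    "i < Suc p \<Longrightarrow> (\<lambda>k. (alm_step p ^^ k) A i) \<longlonglongrightarrow> alm_mean (Suc p) A"
proof -
  obtain L where L: "positive_definite L" "\<forall>i<Suc p. (\<lambda>k. (alm_step p ^^ k) A i) \<longlonglongrightarrow> L"
    using alm_iterate_convergent[OF assms] by blast
  \<comment> \<open>The recursive equation of \<open>alm_mean\<close> concerns three or more
    arguments; \<open>Suc p\<close> has that form because \<open>p\<close> is at least 2.\<close>
  obtain n where n: "p = Suc (Suc n)" using good(2) by (metis add_2_eq_Suc le_Suc_ex)
  have "alm_mean (Suc p) A = (THE L. \<forall>i<Suc p. (\<lambda>k. (alm_step p ^^ k) A i) \<longlonglongrightarrow> L)"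
    unfolding n alm_mean.simps by (simp add: alm_step_def[abs_def])
  also have "\<dots> = L"
  proof (rule the_equality)
    fix M assume "\<forall>i<Suc p. (\<lambda>k. (alm_step p ^^ k) A i) \<longlonglongrightarrow> M"
    then show "M = L" using L(2) LIMSEQ_unique by blast
  qed (rule L(2))
  finally show "positive_definite (alm_mean (Suc p) A)"
    "i < Suc p \<Longrightarrow> (\<lambda>k. (alm_step p ^^ k) A i) \<longlonglongrightarrow> alm_mean (Suc p) A"
    using L by auto
qed

lemma alm_regular_2: "alm_regular (Suc (Suc 0))"
proof -
  have "alm_mean (Suc (Suc 0)) A \<preceq> exp ((\<Sum>i<Suc (Suc 0). \<alpha> i) / real (Suc (Suc 0))) *\<^sub>R alm_mean (Suc (Suc 0)) B"
    if "pd_tuple (Suc (Suc 0)) A" "pd_tuple (Suc (Suc 0)) B" "\<forall>i<Suc (Suc 0). A i \<preceq> exp (\<alpha> i) *\<^sub>R B i"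
    for A B \<alpha>
    using geo_mean_le_exp[of "A 0" "A 1" "B 0" "B 1" "\<alpha> 0" "\<alpha> 1"] that
    by (simp add: pd_tuple_def)
  then show ?thesis
    by (simp add: alm_regular_def pd_tuple_def geo_mean_pd geo_mean_self del: sum.lessThan_Suc)
qed

text \<open>The averaged bound is followed through the iteration. A step replaces each exponent by
  the average of the others, and all exponents tend to the overall average, which survives in the
  limit.\<close>

lemma alm_regular_Suc:
  assumes good: "alm_regular p" "p \<ge> 2"
  shows "alm_regular (Suc p)"
  unfolding alm_regular_def
proof (intro conjI allI impI)
  show "positive_definite (alm_mean (Suc p) A)" if "pd_tuple (Suc p) A" for A
    by (rule alm_mean_limit(1)[OF good that])
  show "alm_mean (Suc p) (\<lambda>_. A) = A" if A: "positive_definite A" for A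
  proof -
    have "alm_step p (\<lambda>_. A) = (\<lambda>_. A)"
      by (simp add: alm_step_def[abs_def] alm_regularD(2)[OF good(1) A])
    then have "(alm_step p ^^ k) (\<lambda>_. A) = (\<lambda>_. A)" for k
      by (induction k) simp_all
    moreover have "pd_tuple (Suc p) (\<lambda>_. A)" using A by (simp add: pd_tuple_def)
    ultimately have "(\<lambda>k. A) \<longlonglongrightarrow> alm_mean (Suc p) (\<lambda>_. A)"
      using alm_mean_limit(2)[OF good, of "\<lambda>_. A" 0] by simp
    then show ?thesis by (simp add: LIMSEQ_const_iff)
  qed
  fix A B \<alpha>
  assume A: "pd_tuple (Suc p) A" and B: "pd_tuple (Suc p) B"
    and le: "\<forall>i<Suc p. A i \<preceq> exp (\<alpha> i) *\<^sub>R B i"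
  define s where "s = (\<Sum>i<Suc p. \<alpha> i)"
  define m where "m = s / real (Suc p)"
  \<comment> \<open>The closed form of the exponents: averaging the other entries fixes constant
    vectors and multiplies vectors of mean zero by -1 / p.\<close>
  define \<beta> where "\<beta> k i = m + (- 1 / real p) ^ k * (\<alpha> i - m)" for k i
  have p: "real p > 0" using good(2) by simp
  have sum_\<beta>: "(\<Sum>i<Suc p. \<beta> k i) = s" for k
  proof -
    have "(\<Sum>i<Suc p. \<beta> k i) = real (Suc p) * m + (- 1 / real p) ^ k * ((\<Sum>i<Suc p. \<alpha> i) - real (Suc p) * m)"
      unfolding \<beta>_def sum.distrib sum_distrib_left[symmetric] sum_subtractf by simp
    moreover have "real (Suc p) * m = s" by (simp add: m_def)
    ultimately show ?thesis by (simp only: s_def[symmetric]) simp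
  qed
  have \<beta>_Suc: "(\<Sum>j<p. omit i (\<beta> k) j) / real p = \<beta> (Suc k) i" if "i < Suc p" for i k
  proof -
    have "(\<Sum>j<p. omit i (\<beta> k) j) = s - \<beta> k i"
      using sum_omit[OF that, of "\<beta> k"] sum_\<beta>[of k] by linarith
    moreover have "s = m * (real p + 1)" by (simp add: m_def add.commute)
    moreover have "(m * (real p + 1) - (m + z)) / real p = m + (- 1 / real p) * z" for z
      using p by (simp add: field_simps)
    ultimately show ?thesis by (simp add: \<beta>_def)
  qed
  have iter: "\<forall>i<Suc p. (alm_step p ^^ k) A i \<preceq> exp (\<beta> k i) *\<^sub>R (alm_step p ^^ k) B i" for k
  proof (induction k)
    case 0
    then show ?case using le by (simp add: \<beta>_def)
  next
    case (Suc k)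
    let ?X = "(alm_step p ^^ k) A" and ?Y = "(alm_step p ^^ k) B"
    have "alm_mean p (omit i ?X) \<preceq> exp (\<beta> (Suc k) i) *\<^sub>R alm_mean p (omit i ?Y)" if "i < Suc p" for i
      unfolding \<beta>_Suc[OF that, symmetric]
    proof (rule alm_regularD(3)[OF good(1)])
      show "omit i ?X j \<preceq> exp (omit i (\<beta> k) j) *\<^sub>R omit i ?Y j" if "j < p" for j
        using Suc that by (auto simp: omit_def)
    qed (intro pd_tuple_omit pd_tuple_alm_iterate good A B)+
    then show ?case unfolding funpow.simps(2) o_apply alm_step_def by blast
  qed
  have "(\<lambda>k. \<beta> k 0) \<longlonglongrightarrow> m + 0 * (\<alpha> 0 - m)"
    unfolding \<beta>_def using good(2) by (intro tendsto_intros LIMSEQ_power_zero) simp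
  then have b: "(\<lambda>k. exp (\<beta> k 0)) \<longlonglongrightarrow> exp m" by (intro tendsto_intros) simp
  show "alm_mean (Suc p) A \<preceq> exp ((\<Sum>i<Suc p. \<alpha> i) / real (Suc p)) *\<^sub>R alm_mean (Suc p) B"
    unfolding s_def[symmetric] m_def[symmetric]
    by (rule op_le_lim[of "\<lambda>k. (alm_step p ^^ k) A 0" _ "\<lambda>k. exp (\<beta> k 0) *\<^sub>R (alm_step p ^^ k) B 0"])
      (use iter alm_mean_limit(2)[OF good A] alm_mean_limit(2)[OF good B] b in \<open>auto intro!: tendsto_scaleR\<close>)
qed

lemma alm_regular: "p \<ge> 2 \<Longrightarrow> alm_regular p"
  by (induction p rule: nat_induct_at_least)
    (simp_all add: alm_regular_Suc alm_regular_2[simplified numeral_2_eq_2[symmetric]])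

text \<open>\<open>\<Q>\<close> stands for the positive definite elements of \<open>QT\<close> and
  \<open>f\<close> for the symbol at one point. Positive real values matter: each step only
  determines p-th powers of values of \<open>f\<close>, and roots are unique among nonnegative
  reals.\<close>

lemma alm_mean_multiplicative:
  fixes f :: "operator \<Rightarrow> real"
  assumes pd: "\<And>A. A \<in> \<Q> \<Longrightarrow> positive_definite A"
    and geo: "\<And>A B. A \<in> \<Q> \<Longrightarrow> B \<in> \<Q> \<Longrightarrow> A #\<^sub>g B \<in> \<Q>"
    and lim: "\<And>X L. (\<And>k. X k \<in> \<Q>) \<Longrightarrow> X \<longlonglongrightarrow> L \<Longrightarrow> positive_definite L \<Longrightarrow> L \<in> \<Q>"
    and pos: "\<And>A. A \<in> \<Q> \<Longrightarrow> f A > 0"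
    and mult: "\<And>A B. A \<in> \<Q> \<Longrightarrow> B \<in> \<Q> \<Longrightarrow> (f (A #\<^sub>g B))\<^sup>2 = f A * f B"
    and cont: "\<And>X L. (\<And>k. X k \<in> \<Q>) \<Longrightarrow> X \<longlonglongrightarrow> L \<Longrightarrow> L \<in> \<Q> \<Longrightarrow> (\<lambda>k. f (X k)) \<longlonglongrightarrow> f L"
    and p: "p \<ge> 2" and A: "\<And>i. i < p \<Longrightarrow> A i \<in> \<Q>"
  shows "alm_mean p A \<in> \<Q> \<and> f (alm_mean p A) ^ p = (\<Prod>i<p. f (A i))"
  using p A
proof (induction p arbitrary: A rule: nat_induct_at_least)
  case base
  then show ?case using geo[of "A 0" "A 1"] mult[of "A 0" "A 1"] by (simp add: numeral_2_eq_2)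
next
  case (Suc p)
  note good = alm_regular[OF Suc.hyps] Suc.hyps
  let ?X = "\<lambda>k. (alm_step p ^^ k) A"
  have A: "pd_tuple (Suc p) A" using Suc.prems pd by (simp add: pd_tuple_def)
  have step: "alm_step p B i \<in> \<Q> \<and> f (alm_step p B i) ^ p = (\<Prod>j<p. f (omit i B j))"
    if "\<And>j. j < Suc p \<Longrightarrow> B j \<in> \<Q>" for B i
    unfolding alm_step_def by (rule Suc.IH) (use that in \<open>auto simp: omit_def\<close>)
  have X: "?X k i \<in> \<Q>" if "i < Suc p" for k i
    using that by (induction k arbitrary: i) (use Suc.prems step in auto)
  have L: "alm_mean (Suc p) A \<in> \<Q>"
    by (rule lim[of "\<lambda>k. ?X k 0"]) (use X alm_mean_limit[OF good A] in auto)
  have prod: "(\<Prod>i<Suc p. f (?X k i)) = (\<Prod>i<Suc p. f (A i))" for k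
  proof (induction k)
    case (Suc k)
    let ?P = "\<Prod>j<Suc p. f (?X k j)"
    \<comment> \<open>Omitting entry \<open>i\<close> removes one factor of \<open>?P\<close>.
      Multiplying over all p + 1 indices gives N^p P = P^(p + 1) for the new product N; P > 0 is
      cancelled before the p-th root is taken.\<close>
    have "f (?X (Suc k) i) ^ p * f (?X k i) = ?P" if "i < Suc p" for i
      using step[of "?X k" i] X prod_omit[OF that, of "\<lambda>j. f (?X k j)"]
      by (simp add: omit_apply_fun[of f])
    then have "(\<Prod>i<Suc p. f (?X (Suc k) i) ^ p * f (?X k i)) = (\<Prod>i<Suc p. ?P)"
      by (intro prod.cong) auto
    then have "(\<Prod>i<Suc p. f (?X (Suc k) i)) ^ p * ?P = ?P ^ Suc p"
      by (simp only: prod.distrib prod_power_distrib prod_constant card_lessThan)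
    moreover have P: "?P > 0" by (intro prod_pos) (use X pos in auto)
    ultimately have "(\<Prod>i<Suc p. f (?X (Suc k) i)) ^ p = ?P ^ p"
      by (simp only: power_Suc2 mult_right_cancel[OF less_imp_neq[OF P, symmetric]])
    moreover have "0 \<le> (\<Prod>i<Suc p. f (?X (Suc k) i))"
      by (intro prod_nonneg ballI less_imp_le pos X) auto
    ultimately have "(\<Prod>i<Suc p. f (?X (Suc k) i)) = ?P"
      by (rule power_eq_imp_eq_base) (use P good(2) in linarith)+
    then show ?case using Suc.IH by (simp only:)
  qed simp
  have "(\<lambda>k. \<Prod>i<Suc p. f (?X k i)) \<longlonglongrightarrow> (\<Prod>i<Suc p. f (alm_mean (Suc p) A))"
    by (intro tendsto_prod cont[OF _ _ L] X alm_mean_limit(2)[OF good A]) auto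
  then have "(\<Prod>i<Suc p. f (A i)) = f (alm_mean (Suc p) A) ^ Suc p"
    unfolding prod by (simp add: LIMSEQ_const_iff)
  with L show ?case by (simp only:)
qed


section \<open>Compact operators\<close>

text \<open>Finite nets can be added, mapped and transferred to norm limits, so the closure
  properties of compact operators are proved in this form.\<close>

lemma compact_op_iff:
  "compact_op K \<longleftrightarrow> (\<forall>e>0. \<exists>F. finite F \<and> blinfun_apply K ` cball 0 1 \<subseteq> (\<Union>y\<in>F. ball y e))"
proof
  assume "compact_op K"
  then have "\<forall>e>0. \<exists>F. finite F \<and> closure (blinfun_apply K ` cball 0 1) \<subseteq> (\<Union>y\<in>F. ball y e)"
    unfolding compact_op_def compact_eq_totally_bounded by blast
  then show "\<forall>e>0. \<exists>F. finite F \<and> blinfun_apply K ` cball 0 1 \<subseteq> (\<Union>y\<in>F. ball y e)"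
    by (meson closure_subset order_trans)
next
  assume *: "\<forall>e>0. \<exists>F. finite F \<and> blinfun_apply K ` cball 0 1 \<subseteq> (\<Union>y\<in>F. ball y e)"
  have "\<exists>F. finite F \<and> closure (blinfun_apply K ` cball 0 1) \<subseteq> (\<Union>y\<in>F. ball y e)" if "e > 0" for e
  proof -
    obtain F where F: "finite F" "blinfun_apply K ` cball 0 1 \<subseteq> (\<Union>y\<in>F. ball y (e / 2))"
      using *[rule_format, of "e / 2"] \<open>e > 0\<close> by auto
    \<comment> \<open>Closed balls of half the radius: their finite union is closed and so contains
      the closure of the image.\<close>
    have "(\<Union>y\<in>F. ball y (e / 2)) \<subseteq> (\<Union>y\<in>F. cball y (e / 2))" by (intro UN_mono ball_subset_cball) auto
    then have "closure (blinfun_apply K ` cball 0 1) \<subseteq> (\<Union>y\<in>F. cball y (e / 2))"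
      using F by (intro closure_minimal closed_UN) auto
    also have "\<dots> \<subseteq> (\<Union>y\<in>F. ball y e)" using that by (intro UN_mono) auto
    finally show ?thesis using F(1) by blast
  qed
  then show "compact_op K"
    unfolding compact_op_def compact_eq_totally_bounded by (simp add: complete_eq_closed)
qed

lemma compact_opE:
  assumes "compact_op K" "e > 0"
  obtains F where "finite F" "\<And>x. norm x \<le> 1 \<Longrightarrow> \<exists>y\<in>F. norm (K x - y) < e"
proof -
  obtain F where F: "finite F" "blinfun_apply K ` cball 0 1 \<subseteq> (\<Union>y\<in>F. ball y e)"
    using assms unfolding compact_op_iff by blast
  show ?thesis
  proof (rule that[OF F(1)])
    fix x :: ell2 assume "norm x \<le> 1"
    then have "x \<in> cball 0 1" by simp
    then have "K x \<in> (\<Union>y\<in>F. ball y e)" using F(2) by blast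
    then obtain y where "y \<in> F" "dist y (K x) < e" by auto
    then show "\<exists>y\<in>F. norm (K x - y) < e" by (metis dist_commute dist_norm)
  qed
qed

lemma compact_opI:
  fixes K :: operator
  assumes "\<And>e. e > 0 \<Longrightarrow> \<exists>F. finite F \<and> (\<forall>x. norm x \<le> 1 \<longrightarrow> (\<exists>y\<in>F. norm (K x - y) < e))"
  shows "compact_op K"
  unfolding compact_op_iff
proof (intro allI impI)
  fix e :: real assume "e > 0"
  then obtain F where F: "finite F" "\<forall>x. norm x \<le> 1 \<longrightarrow> (\<exists>y\<in>F. norm (K x - y) < e)"
    using assms by blast
  then have "blinfun_apply K ` cball 0 1 \<subseteq> (\<Union>y\<in>F. ball y e)"
    by (auto simp: dist_norm norm_minus_commute)
  with F(1) show "\<exists>F. finite F \<and> blinfun_apply K ` cball 0 1 \<subseteq> (\<Union>y\<in>F. ball y e)" by blast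
qed

lemma compact_op_zero: "compact_op 0"
  by (rule compact_opI) (auto intro!: exI[of _ "{0}"])

lemma compact_op_add:
  assumes "compact_op K" "compact_op L"
  shows "compact_op (K + L)"
proof (rule compact_opI)
  fix e :: real assume "e > 0"
  then have e: "e / 2 > 0" by simp
  obtain F where F: "finite F" "\<And>x. norm x \<le> 1 \<Longrightarrow> \<exists>y\<in>F. norm (K x - y) < e / 2"
    using compact_opE[OF assms(1) e] by metis
  obtain G where G: "finite G" "\<And>x. norm x \<le> 1 \<Longrightarrow> \<exists>y\<in>G. norm (L x - y) < e / 2"
    using compact_opE[OF assms(2) e] by metis
  let ?H = "(\<lambda>(y, z). y + z) ` (F \<times> G)"
  have "\<exists>w\<in>?H. norm ((K + L) x - w) < e" if "norm x \<le> 1" for x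
  proof -
    obtain y where y: "y \<in> F" "norm (K x - y) < e / 2" using F(2)[OF \<open>norm x \<le> 1\<close>] by blast
    obtain z where z: "z \<in> G" "norm (L x - z) < e / 2" using G(2)[OF \<open>norm x \<le> 1\<close>] by blast
    have "(K + L) x - (y + z) = (K x - y) + (L x - z)" by (simp add: blinfun.bilinear_simps)
    then have "norm ((K + L) x - (y + z)) \<le> norm (K x - y) + norm (L x - z)"
      by (metis norm_triangle_ineq)
    then have "norm ((K + L) x - (y + z)) < e" using y z by simp
    moreover have "y + z \<in> ?H" using y z by force
    ultimately show ?thesis by blast
  qed
  then show "\<exists>H. finite H \<and> (\<forall>x. norm x \<le> 1 \<longrightarrow> (\<exists>y\<in>H. norm ((K + L) x - y) < e))"
    using F(1) G(1) by (intro exI[of _ ?H]) auto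
qed

lemma compact_op_compose_left:
  assumes "compact_op K"
  shows "compact_op (B o\<^sub>L K)"
proof (rule compact_opI)
  fix e :: real assume "e > 0"
  define N where "N = norm B + 1"
  have N: "N > 0" by (simp add: N_def add_nonneg_pos)
  have e: "e / N > 0" using \<open>e > 0\<close> N by simp
  obtain F where F: "finite F" "\<And>x. norm x \<le> 1 \<Longrightarrow> \<exists>y\<in>F. norm (K x - y) < e / N"
    using compact_opE[OF assms(1) e] by metis
  have "\<exists>w\<in>blinfun_apply B ` F. norm ((B o\<^sub>L K) x - w) < e" if "norm x \<le> 1" for x
  proof -
    obtain y where y: "y \<in> F" "norm (K x - y) < e / N" using F(2)[OF \<open>norm x \<le> 1\<close>] by blast
    have "norm (B (K x) - B y) = norm (B (K x - y))" by (simp add: blinfun.bilinear_simps)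
    also have "\<dots> \<le> norm B * norm (K x - y)" by (rule norm_blinfun)
    also have "\<dots> \<le> N * norm (K x - y)" by (simp add: N_def mult_right_mono)
    also have "\<dots> < e" using y N by (simp add: field_simps)
    finally show ?thesis using y(1) by auto
  qed
  then show "\<exists>H. finite H \<and> (\<forall>x. norm x \<le> 1 \<longrightarrow> (\<exists>y\<in>H. norm ((B o\<^sub>L K) x - y) < e))"
    using F(1) by (intro exI[of _ "blinfun_apply B ` F"]) auto
qed

lemma compact_op_compose_right:
  assumes "compact_op K"
  shows "compact_op (K o\<^sub>L B)"
proof (rule compact_opI)
  fix e :: real assume "e > 0"
  define N where "N = norm B + 1"
  have N: "N > 0" by (simp add: N_def add_nonneg_pos)
  have e: "e / N > 0" using \<open>e > 0\<close> N by simp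
  obtain F where F: "finite F" "\<And>x. norm x \<le> 1 \<Longrightarrow> \<exists>y\<in>F. norm (K x - y) < e / N"
    using compact_opE[OF assms(1) e] by metis
  have "\<exists>w\<in>(*\<^sub>R) N ` F. norm ((K o\<^sub>L B) x - w) < e" if x: "norm x \<le> 1" for x
  proof -
    let ?x = "(1 / N) *\<^sub>R B x"
    have "norm (B x) \<le> norm B * norm x" by (rule norm_blinfun)
    also have "\<dots> \<le> norm B * 1" using x by (intro mult_left_mono) auto
    also have "\<dots> \<le> N" by (simp add: N_def)
    finally have "norm ?x \<le> 1" using N by simp
    then obtain y where y: "y \<in> F" "norm (K ?x - y) < e / N" using F(2) by blast
    have "K (B x) - N *\<^sub>R y = N *\<^sub>R (K ?x - y)"
      using N by (simp add: blinfun.bilinear_simps algebra_simps)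
    then have "norm (K (B x) - N *\<^sub>R y) = N * norm (K ?x - y)" using N by simp
    also have "\<dots> < e" using y N by (simp add: field_simps)
    finally have "norm (K (B x) - N *\<^sub>R y) < e" .
    then show ?thesis using y(1) by auto
  qed
  then show "\<exists>H. finite H \<and> (\<forall>x. norm x \<le> 1 \<longrightarrow> (\<exists>y\<in>H. norm ((K o\<^sub>L B) x - y) < e))"
    using F(1) by (intro exI[of _ "(*\<^sub>R) N ` F"]) auto
qed

lemma compact_op_scaleR: "compact_op K \<Longrightarrow> compact_op (r *\<^sub>R K)"
  using compact_op_compose_left[of K "r *\<^sub>R id_blinfun"] by (simp add: blinfun_compose_simps)

lemma compact_op_sum: "(\<And>i. i \<in> I \<Longrightarrow> compact_op (f i)) \<Longrightarrow> compact_op (\<Sum>i\<in>I. f i)"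
  by (induction I rule: infinite_finite_induct) (auto intro: compact_op_add compact_op_zero)

lemma compact_op_approx:
  assumes "\<And>e. e > 0 \<Longrightarrow> \<exists>L. compact_op L \<and> norm (K - L) < e"
  shows "compact_op K"
proof (rule compact_opI)
  fix e :: real assume "e > 0"
  then have e: "e / 2 > 0" by simp
  obtain L where L: "compact_op L" "norm (K - L) < e / 2" using assms[OF e] by blast
  obtain F where F: "finite F" "\<And>x. norm x \<le> 1 \<Longrightarrow> \<exists>y\<in>F. norm (L x - y) < e / 2"
    using compact_opE[OF L(1) e] by metis
  have "\<exists>y\<in>F. norm (K x - y) < e" if x: "norm x \<le> 1" for x
  proof -
    obtain y where y: "y \<in> F" "norm (L x - y) < e / 2" using F(2)[OF x] by blast
    have "norm ((K - L) x) \<le> norm (K - L) * norm x" by (rule norm_blinfun)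
    also have "\<dots> \<le> norm (K - L) * 1" using x by (intro mult_left_mono) auto
    finally have "norm ((K - L) x) < e / 2" using L by simp
    moreover have "K x - y = (K - L) x + (L x - y)" by (simp add: blinfun.bilinear_simps)
    ultimately have "norm (K x - y) < e / 2 + e / 2"
      using norm_add_less y(2) by metis
    then have "norm (K x - y) < e" by simp
    then show ?thesis using y(1) by blast
  qed
  then show "\<exists>F. finite F \<and> (\<forall>x. norm x \<le> 1 \<longrightarrow> (\<exists>y\<in>F. norm (K x - y) < e))"
    using F(1) by blast
qed

text \<open>
  If infinitely many \<open>K (v n)\<close> were close to some \<open>y \<noteq> 0\<close>, then the sum of \<open>N\<close> such vectors
  \<open>v n\<close>, whose norm is \<open>sqrt N\<close>, would be mapped to a vector of norm about \<open>N * norm y\<close>.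
\<close>

lemma compact_op_orthonormal_tendsto_0:
  assumes K: "compact_op K" and nv: "\<And>n. norm (v n) = 1"
    and orth: "\<And>m n. m \<noteq> n \<Longrightarrow> v m \<bullet> v n = 0"
  shows "(\<lambda>n :: nat. K (v n)) \<longlonglongrightarrow> 0"
proof (rule ccontr)
  assume "\<not> (\<lambda>n. K (v n)) \<longlonglongrightarrow> 0"
  then obtain e where e: "e > 0" "\<And>N. \<exists>n\<ge>N. e \<le> norm (K (v n))"
    unfolding LIMSEQ_iff by (auto simp: not_less)
  define I where "I = {n. e \<le> norm (K (v n))}"
  have I: "infinite I" unfolding I_def infinite_nat_iff_unbounded_le using e(2) by auto
  have e4: "e / 4 > 0" using e by simp
  obtain F where F: "finite F" "\<And>x. norm x \<le> 1 \<Longrightarrow> \<exists>y\<in>F. norm (K x - y) < e / 4"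
    using compact_opE[OF K e4] by metis
  have "I \<subseteq> (\<Union>y\<in>F. {n \<in> I. norm (K (v n) - y) < e / 4})"
    using F(2)[of "v _"] nv by fastforce
  \<comment> \<open>Pigeonhole: a finite net leaves infinitely many images near a single
    point.\<close>
  then have "\<exists>y\<in>F. infinite {n \<in> I. norm (K (v n) - y) < e / 4}"
    using I F(1) by (meson finite_UN finite_subset)
  then obtain y where y: "infinite {n \<in> I. norm (K (v n) - y) < e / 4}" (is "infinite ?J") by blast
  obtain n where "n \<in> ?J" using infinite_imp_nonempty[OF y] by blast
  then have "e \<le> norm (K (v n))" "norm (K (v n) - y) < e / 4" by (auto simp: I_def)
  then have ny: "norm y \<ge> 3 / 4 * e" using norm_triangle_ineq2[of "K (v n)" y] by linarith
  \<comment> \<open>The estimates below give N (3 e / 4) \<le> |K| sqrt N + N e / 4, that is sqrt N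
    \<le> 2 |K| / e, which this choice excludes.\<close>
  obtain N :: nat where N: "N > 0" "real N > (2 * norm K / e)\<^sup>2"
    using reals_Archimedean2[of "max 0 ((2 * norm K / e)\<^sup>2)"] by (metis max_less_iff_conj of_nat_0_less_iff)
  obtain T where T: "finite T" "card T = N" "T \<subseteq> ?J"
    using infinite_arbitrarily_large[OF y] by blast
  have "(norm (\<Sum>n\<in>T. v n))\<^sup>2 = (\<Sum>n\<in>T. (norm (v n))\<^sup>2)"
    by (rule norm_sum_Pythagorean[OF T(1)]) (auto simp: pairwise_def orthogonal_def orth)
  also have "\<dots> = real N" using T nv by simp
  finally have nsum: "norm (\<Sum>n\<in>T. v n) = sqrt (real N)" by (simp add: real_sqrt_unique)
  have "real N * norm y = norm (\<Sum>n\<in>T. y)" using T by (simp add: sum_constant_scaleR)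
  also have "(\<Sum>n\<in>T. y) = K (\<Sum>n\<in>T. v n) - (\<Sum>n\<in>T. K (v n) - y)"
    by (simp add: blinfun.bilinear_simps sum_subtractf)
  also have "norm \<dots> \<le> norm (K (\<Sum>n\<in>T. v n)) + (\<Sum>n\<in>T. norm (K (v n) - y))"
    by (intro order_trans[OF norm_triangle_ineq4] add_left_mono norm_sum)
  also have "\<dots> \<le> norm K * sqrt (real N) + real N * (e / 4)"
  proof (rule add_mono)
    show "norm (K (\<Sum>n\<in>T. v n)) \<le> norm K * sqrt (real N)" using norm_blinfun[of K] nsum by metis
    have "(\<Sum>n\<in>T. norm (K (v n) - y)) \<le> (\<Sum>n\<in>T. e / 4)" using T(3) by (intro sum_mono) auto
    then show "(\<Sum>n\<in>T. norm (K (v n) - y)) \<le> real N * (e / 4)" using T by simp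
  qed
  finally have "real N * norm y \<le> norm K * sqrt (real N) + real N * (e / 4)" .
  moreover have "real N * (3 / 4 * e) \<le> real N * norm y" using ny by (intro mult_left_mono) auto
  ultimately have "real N * e / 2 \<le> norm K * sqrt (real N)" by linarith
  then have "(sqrt (real N) * e / 2) * sqrt (real N) \<le> norm K * sqrt (real N)"
    by (simp add: mult_ac flip: real_sqrt_mult)
  then have "sqrt (real N) * e / 2 \<le> norm K" using N by (simp add: mult.commute)
  then have "sqrt (real N) \<le> 2 * norm K / e" using e by (simp add: field_simps)
  then have "real N \<le> (2 * norm K / e)\<^sup>2" by (rule sqrt_le_D)
  then show False using N by simp
qed


section \<open>Finite sections and shifts\<close>

lemmas ell2_rep_eq = plus_ell2.rep_eq minus_ell2.rep_eq uminus_ell2.rep_eq zero_ell2.rep_eq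
  scaleR_ell2.rep_eq ell2_scaleC.rep_eq ell2_unit.rep_eq

lemma ell2_nth_sum: "ell2_nth (\<Sum>i\<in>I. f i) n = (\<Sum>i\<in>I. ell2_nth (f i) n)"
  by (induction I rule: infinite_finite_induct) (auto simp: ell2_rep_eq)

lemma norm_ell2_finite_support:
  assumes "finite F" "\<And>i. i \<notin> F \<Longrightarrow> ell2_nth x i = 0"
  shows "(norm x)\<^sup>2 = (\<Sum>i\<in>F. (cmod (ell2_nth x i))\<^sup>2)"
  by (rule sums_unique2[OF norm_ell2_sums]) (rule sums_finite, use assms in auto)

text \<open>The type itself offers only real scalars; this makes complex multiples available as
  compositions.\<close>

definition cscale :: "complex \<Rightarrow> operator" where
  "cscale c = Blinfun (ell2_scaleC c)"

lemma cscale_apply [simp]: "cscale c x = ell2_scaleC c x"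
  by (simp add: cscale_def bounded_linear_Blinfun_apply bounded_linear_ell2_scaleC)

lemma cscale_bounded_ops: "cscale c \<in> bounded_ops"
  by (auto simp: bounded_ops_def intro!: ell2_eqI simp: ell2_rep_eq)

lemma bounded_opsD: "A \<in> bounded_ops \<Longrightarrow> A (ell2_scaleC c x) = ell2_scaleC c (A x)"
  by (simp add: bounded_ops_def)

definition coord_op :: "nat \<Rightarrow> operator" where
  "coord_op j = Blinfun (\<lambda>x. ell2_scaleC (ell2_nth x j) (ell2_unit j))"

lemma norm_ell2_unit: "norm (ell2_unit j) = 1"
proof -
  have "(norm (ell2_unit j))\<^sup>2 = (\<Sum>i\<in>{j}. (cmod (ell2_nth (ell2_unit j) i))\<^sup>2)"
    by (rule norm_ell2_finite_support) (auto simp: ell2_rep_eq)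
  then show ?thesis by (simp add: ell2_rep_eq power2_eq_1_iff) (use norm_ge_zero[of "ell2_unit j"] in linarith)
qed

lemma coord_op_apply: "coord_op j x = ell2_scaleC (ell2_nth x j) (ell2_unit j)"
proof -
  have "bounded_linear (\<lambda>x. ell2_scaleC (ell2_nth x j) (ell2_unit j))"
  proof (rule bounded_linear_intro[of _ 1])
    show "norm (ell2_scaleC (ell2_nth x j) (ell2_unit j)) \<le> norm x * 1" for x
      by (simp add: norm_ell2_scaleC norm_ell2_unit norm_ell2_nth_le)
  qed (rule ell2_eqI; simp add: ell2_rep_eq algebra_simps)+
  then show ?thesis by (simp add: coord_op_def bounded_linear_Blinfun_apply)
qed

text \<open>The image of the unit ball lies in the set of multiples of one unit vector by scalars
  from the closed complex disc, a continuous image of a compact set.\<close>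

lemma compact_op_coord: "compact_op (coord_op j)"
proof -
  have "bounded_linear (\<lambda>c. ell2_scaleC c (ell2_unit j))"
    by (rule bounded_linear_intro[of _ 1])
      (auto intro!: ell2_eqI simp: ell2_rep_eq algebra_simps norm_ell2_scaleC norm_ell2_unit)
  then have "compact ((\<lambda>c. ell2_scaleC c (ell2_unit j)) ` cball 0 1)" (is "compact ?S")
    by (intro compact_continuous_image linear_continuous_on compact_cball)
  moreover have "blinfun_apply (coord_op j) ` cball 0 1 \<subseteq> ?S"
    using order_trans[OF norm_ell2_nth_le] by (auto simp: coord_op_apply)
  then have "closure (blinfun_apply (coord_op j) ` cball 0 1) \<subseteq> ?S"
    by (intro closure_minimal compact_imp_closed calculation)
  ultimately show ?thesis unfolding compact_op_def
    by (metis closed_closure inf.absorb1 closed_Int_compact)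
qed

definition trunc :: "nat \<Rightarrow> operator" where
  "trunc M = (\<Sum>j<M. coord_op j)"

lemma trunc_apply: "trunc M x = (\<Sum>j<M. ell2_scaleC (ell2_nth x j) (ell2_unit j))"
  by (simp add: trunc_def blinfun.bilinear_simps coord_op_apply)

lemma ell2_nth_trunc: "ell2_nth (trunc M x) i = (if i < M then ell2_nth x i else 0)"
  by (simp add: trunc_apply ell2_nth_sum ell2_rep_eq if_distrib cong: if_cong)

lemma compact_op_trunc: "compact_op (trunc M)"
  unfolding trunc_def by (intro compact_op_sum compact_op_coord)

lemma compact_op_finite_range:
  fixes D :: operator
  assumes "\<And>x i. i \<ge> M \<Longrightarrow> ell2_nth (D x) i = 0"
  shows "compact_op D"
proof -
  have "D = trunc M o\<^sub>L D"
    by (intro blinfun_eqI ell2_eqI) (auto simp: ell2_nth_trunc assms)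
  then show ?thesis using compact_op_compose_right[OF compact_op_trunc] by metis
qed

lemma trunc_tendsto: "(\<lambda>M. trunc M x) \<longlonglongrightarrow> x"
proof -
  have eq: "(norm (x - trunc M x))\<^sup>2 = (norm x)\<^sup>2 - (\<Sum>n<M. (cmod (ell2_nth x n))\<^sup>2)" for M
  proof -
    have "(\<lambda>n. if n \<in> {..<M} then (cmod (ell2_nth x n))\<^sup>2 else 0) sums (\<Sum>n<M. (cmod (ell2_nth x n))\<^sup>2)"
      by (rule sums_If_finite_set) simp
    from sums_diff[OF norm_ell2_sums[of x] this]
    have "(\<lambda>n. (cmod (ell2_nth (x - trunc M x) n))\<^sup>2) sums
        ((norm x)\<^sup>2 - (\<Sum>n<M. (cmod (ell2_nth x n))\<^sup>2))"
      by (rule sums_cong[THEN iffD1, rotated]) (simp add: ell2_rep_eq ell2_nth_trunc)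
    then show ?thesis by (rule sums_unique2[OF norm_ell2_sums])
  qed
  have "(\<lambda>M. (norm x)\<^sup>2 - (\<Sum>n<M. (cmod (ell2_nth x n))\<^sup>2)) \<longlonglongrightarrow> (norm x)\<^sup>2 - (norm x)\<^sup>2"
    using norm_ell2_sums[of x] unfolding sums_def by (intro tendsto_intros)
  then have "(\<lambda>M. (norm (x - trunc M x))\<^sup>2) \<longlonglongrightarrow> 0" by (simp add: eq)
  then have "(\<lambda>M. sqrt ((norm (x - trunc M x))\<^sup>2)) \<longlonglongrightarrow> sqrt 0" by (rule tendsto_real_sqrt)
  then have "(\<lambda>M. x - trunc M x) \<longlonglongrightarrow> 0" by (simp add: tendsto_norm_zero_iff)
  then have "(\<lambda>M. x - (x - trunc M x)) \<longlonglongrightarrow> x - 0" by (intro tendsto_intros)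
  then show ?thesis by simp
qed

section \<open>Shifts by an integer and their products\<close>

lemma shift_sum_le:
  "(\<Sum>i<N. (cmod (if 0 \<le> int i + k then ell2_nth x (nat (int i + k)) else 0))\<^sup>2) \<le> (norm x)\<^sup>2"
proof -
  let ?f = "\<lambda>i. nat (int i + k)"
  let ?I = "{i \<in> {..<N}. 0 \<le> int i + k}"
  let ?g = "\<lambda>j. (cmod (ell2_nth x j))\<^sup>2"
  have "(\<Sum>i<N. (cmod (if 0 \<le> int i + k then ell2_nth x (?f i) else 0))\<^sup>2) = (\<Sum>i\<in>?I. ?g (?f i))"
    by (subst sum.inter_filter) (auto intro!: sum.cong)
  also have "\<dots> = (\<Sum>j\<in>?f ` ?I. ?g j)"
    by (subst sum.reindex) (auto simp: inj_on_def nat_eq_iff)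
  also have "\<dots> \<le> (\<Sum>j<N + nat \<bar>k\<bar>. ?g j)" by (rule sum_mono2) auto
  also have "\<dots> \<le> (norm x)\<^sup>2" by (rule sum_ell2_le)
  finally show ?thesis .
qed

lift_definition ell2_shift :: "int \<Rightarrow> ell2 \<Rightarrow> ell2" is
  "\<lambda>k x i. if 0 \<le> int i + k then x (nat (int i + k)) else 0"
proof -
  fix k and x :: "nat \<Rightarrow> complex"
  assume "summable (\<lambda>n. (cmod (x n))\<^sup>2)"
  then have "ell2_nth (Abs_ell2 x) = x" by (simp add: Abs_ell2_inverse)
  then show "summable (\<lambda>i. (cmod (if 0 \<le> int i + k then x (nat (int i + k)) else 0))\<^sup>2)"
    using shift_sum_le[where x = "Abs_ell2 x" and k = k]
    by (intro summableI_nonneg_bounded[of _ "(norm (Abs_ell2 x))\<^sup>2"]) (simp_all only: zero_le_power2)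
qed

text \<open>The backward shift for positive \<open>k\<close> and the forward shift for negative
  \<open>k\<close>: the Toeplitz operator of exp(ikt).\<close>

definition shift :: "int \<Rightarrow> operator" where
  "shift k = Blinfun (ell2_shift k)"

lemma shift_apply: "shift k x = ell2_shift k x"
proof -
  have "bounded_linear (ell2_shift k)"
  proof (rule bounded_linear_intro[of _ 1])
    fix x
    have "(norm (ell2_shift k x))\<^sup>2 \<le> (norm x)\<^sup>2"
      using norm_ell2_sums[of "ell2_shift k x"] unfolding sums_def
      by (rule LIMSEQ_le_const2)
        (use shift_sum_le[of k x] in \<open>simp add: ell2_shift.rep_eq\<close>)
    then show "norm (ell2_shift k x) \<le> norm x * 1" by simp
  qed (rule ell2_eqI; simp add: ell2_rep_eq ell2_shift.rep_eq)+
  then show ?thesis by (simp add: shift_def bounded_linear_Blinfun_apply)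
qed

lemma ell2_nth_shift:
  "ell2_nth (shift k x) i = (if 0 \<le> int i + k then ell2_nth x (nat (int i + k)) else 0)"
  by (simp add: shift_apply ell2_shift.rep_eq)

lemma shift_bounded_ops: "shift k \<in> bounded_ops"
  by (auto simp: bounded_ops_def intro!: ell2_eqI simp: ell2_rep_eq ell2_nth_shift)

lemma shift_0: "shift 0 = id_blinfun"
  by (intro blinfun_eqI ell2_eqI) (simp add: ell2_nth_shift)

text \<open>The operators can differ only in rows i < |k|, where the intermediate index i + k may be
  negative and the product cuts off.\<close>

lemma compact_op_shift_compose: "compact_op ((shift k o\<^sub>L shift l) - shift (k + l))"
proof (rule compact_op_finite_range)
  fix x :: ell2 and i assume "nat \<bar>k\<bar> \<le> i"
  then have "0 \<le> int i + k" by linarith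
  then show "ell2_nth (((shift k o\<^sub>L shift l) - shift (k + l)) x) i = 0"
    by (simp add: blinfun.bilinear_simps ell2_rep_eq ell2_nth_shift add.assoc)
qed

lemma matrix_entry_shift: "matrix_entry (shift k) i j = (if int j - int i = k then 1 else 0)"
  by (auto simp: matrix_entry_def ell2_nth_shift ell2_rep_eq)


section \<open>Fourier coefficients\<close>

lemma has_integral_cis:
  "((\<lambda>t. cis (of_int m * t)) has_integral (if m = 0 then 2 * of_real pi else 0)) {0..2*pi}"
proof (cases "m = 0")
  case True
  have "((\<lambda>t. 1 :: complex) has_integral (2 * pi - 0) *\<^sub>R 1) {0..2*pi}"
    using has_integral_const_real[of "1 :: complex" 0 "2*pi"] by simp
  then show ?thesis using True by (simp add: scaleR_conv_of_real)
next
  case False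
  define F :: "complex \<Rightarrow> complex" where "F z = exp (\<i> * of_int m * z) / (\<i> * of_int m)" for z
  have D: "((\<lambda>t. F (of_real t)) has_vector_derivative cis (of_int m * t)) (at t within {0..2*pi})" for t :: real
  proof -
    have "(F has_field_derivative exp (\<i> * of_int m * of_real t)) (at (of_real t))"
      unfolding F_def by (rule derivative_eq_intros refl | use False in simp)+
    from has_vector_derivative_real_field[OF this]
    show ?thesis by (simp add: cis_conv_exp mult.assoc)
  qed
  have "((\<lambda>t. cis (of_int m * t)) has_integral (F (of_real (2 * pi)) - F (of_real 0))) {0..2*pi}"
    by (rule fundamental_theorem_of_calculus[OF _ D]) simp
  moreover have "exp (\<i> * of_int m * of_real (2 * pi)) = 1"
  proof -
    have "exp (\<i> * of_int m * of_real (2 * pi)) = cis (2 * pi * of_int m)"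
      by (simp add: cis_conv_exp mult_ac)
    then show ?thesis by (simp add: cis_multiple_2pi)
  qed
  then have "F (of_real (2 * pi)) - F (of_real 0) = 0" by (simp add: F_def)
  ultimately show ?thesis using False by simp
qed

lemma cis_mult_exp: "cis (of_int k * t) * exp (- \<i> * of_int l * of_real t) = cis (of_int (k - l) * t)"
proof -
  have "exp (- \<i> * of_int l * of_real t) = cis (- (of_int l * t))"
    by (simp add: cis_conv_exp mult.assoc)
  then show ?thesis by (simp add: cis_mult left_diff_distrib)
qed

lemma fourier_coeff_cis: "fourier_coeff (\<lambda>t. cis (of_int k * t)) l = (if k = l then 1 else 0)"
  unfolding fourier_coeff_def cis_mult_exp
  using integral_unique[OF has_integral_cis[of "k - l"]] by simp

lemma fourier_coeff_has_integral:
  assumes "continuous_on {0..2*pi} a"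
  shows "((\<lambda>t. a t * exp (- \<i> * of_int k * of_real t)) has_integral
    (2 * of_real pi * fourier_coeff a k)) {0..2*pi}"
proof -
  have "(\<lambda>t. a t * exp (- \<i> * of_int k * of_real t)) integrable_on {0..2*pi}"
    by (intro integrable_continuous_real continuous_intros assms)
  from integrable_integral[OF this] show ?thesis using pi_neq_zero by (simp add: fourier_coeff_def)
qed

lemma fourier_coeff_eqI:
  assumes "((\<lambda>t. a t * exp (- \<i> * of_int k * of_real t)) has_integral (2 * of_real pi * c)) {0..2*pi}"
  shows "fourier_coeff a k = c"
  using integral_unique[OF assms] by (simp add: fourier_coeff_def)

lemma fourier_coeff_add:
  assumes "continuous_on {0..2*pi} a" "continuous_on {0..2*pi} b"
  shows "fourier_coeff (\<lambda>t. a t + b t) k = fourier_coeff a k + fourier_coeff b k"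
  using has_integral_add[OF fourier_coeff_has_integral[OF assms(1)] fourier_coeff_has_integral[OF assms(2)], of k k]
  by (intro fourier_coeff_eqI) (simp only: ring_distribs)

lemma fourier_coeff_mult:
  assumes "continuous_on {0..2*pi} a"
  shows "fourier_coeff (\<lambda>t. c * a t) k = c * fourier_coeff a k"
  using has_integral_mult_right[OF fourier_coeff_has_integral[OF assms], of c k]
  by (intro fourier_coeff_eqI) (simp only: mult_ac)

lemma fourier_coeff_diff:
  assumes "continuous_on {0..2*pi} a" "continuous_on {0..2*pi} b"
  shows "fourier_coeff (\<lambda>t. a t - b t) k = fourier_coeff a k - fourier_coeff b k"
  using has_integral_diff[OF fourier_coeff_has_integral[OF assms(1)] fourier_coeff_has_integral[OF assms(2)], of k k]
  by (intro fourier_coeff_eqI) (simp only: ring_distribs)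

lemma fourier_coeff_cong:
  "(\<And>t. t \<in> {0..2*pi} \<Longrightarrow> a t = b t) \<Longrightarrow> fourier_coeff a k = fourier_coeff b k"
  unfolding fourier_coeff_def by (intro arg_cong2[where f = "(*)"] refl integral_cong) simp

text \<open>The sign matches the matrix convention: a conjugated term of index i times one of index
  j has frequency i - j, the weight in the Fourier coefficient of order j - i.\<close>

definition trig_sum :: "nat \<Rightarrow> (nat \<Rightarrow> complex) \<Rightarrow> real \<Rightarrow> complex" where
  "trig_sum M x t = (\<Sum>j<M. x j * cis (- (real j * t)))"

text \<open>The double sum is the sesquilinear form of a finite Toeplitz section, so bounds on the
  symbol become bounds on the form. The symbol 1 gives Parseval's identity.\<close>

lemma fourier_form:
  assumes a: "continuous_on {0..2*pi} a"
  shows "((\<lambda>t. a t * (cnj (trig_sum M y t) * trig_sum M x t)) has_integral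
    2 * of_real pi * (\<Sum>i<M. \<Sum>j<M. cnj (y i) * (x j * fourier_coeff a (int j - int i)))) {0..2*pi}"
proof -
  have eq: "a t * (cnj (trig_sum M y t) * trig_sum M x t) =
    (\<Sum>i<M. \<Sum>j<M. (cnj (y i) * x j) * (a t * exp (- \<i> * of_int (int j - int i) * of_real t)))" for t
  proof -
    have "cnj (cis (- (real i * t))) * cis (- (real j * t)) = exp (- \<i> * of_int (int j - int i) * of_real t)" for i j
      by (simp add: cis_cnj cis_mult) (simp add: cis_conv_exp algebra_simps)
    then show ?thesis
      by (simp add: trig_sum_def sum_product sum_distrib_left mult_ac cong: sum.cong)
  qed
  have "((\<lambda>t. \<Sum>i<M. \<Sum>j<M. (cnj (y i) * x j) * (a t * exp (- \<i> * of_int (int j - int i) * of_real t)))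
    has_integral (\<Sum>i<M. \<Sum>j<M. (cnj (y i) * x j) * (2 * of_real pi * fourier_coeff a (int j - int i)))) {0..2*pi}"
    by (intro has_integral_sum has_integral_mult_right fourier_coeff_has_integral a) auto
  then show ?thesis unfolding eq by (simp add: sum_distrib_left mult_ac)
qed

lemma trig_sum_parseval:
  "((\<lambda>t. (cmod (trig_sum M x t))\<^sup>2) has_integral 2 * pi * (\<Sum>j<M. (cmod (x j))\<^sup>2)) {0..2*pi}"
proof -
  have "((\<lambda>t. (\<lambda>t. 1) t * (cnj (trig_sum M x t) * trig_sum M x t)) has_integral
    2 * of_real pi * (\<Sum>i<M. \<Sum>j<M. cnj (x i) * (x j * fourier_coeff (\<lambda>t. 1) (int j - int i)))) {0..2*pi}"
    by (rule fourier_form) (intro continuous_intros)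
  moreover have "fourier_coeff (\<lambda>t. 1) (int j - int i) = (if i = j then 1 else 0)" for i j
    using fourier_coeff_cis[of 0 "int j - int i"] by auto
  ultimately have "((\<lambda>t. cnj (trig_sum M x t) * trig_sum M x t) has_integral
    2 * of_real pi * (\<Sum>i<M. cnj (x i) * x i)) {0..2*pi}"
    by (simp add: if_distrib cong: if_cong)
  from has_integral_Re[OF this] show ?thesis
    by (simp add: cmod_power2) (simp add: power2_eq_square)
qed


section \<open>Bounds for Toeplitz operators\<close>

text \<open>The condition inside the description \<open>toeplitz\<close>, usable before existence
  and uniqueness are known.\<close>

definition is_toeplitz :: "operator \<Rightarrow> (real \<Rightarrow> complex) \<Rightarrow> bool" where
  "is_toeplitz T a \<longleftrightarrow> T \<in> bounded_ops \<and> (\<forall>i j. matrix_entry T i j = fourier_coeff a (int j - int i))"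

lemma ell2_inner_trunc: "ell2_inner (trunc M y) z = (\<Sum>i<M. cnj (ell2_nth y i) * ell2_nth z i)"
proof -
  have "ell2_inner (trunc M y) z = (\<Sum>i<M. cnj (ell2_nth (trunc M y) i) * ell2_nth z i)"
    unfolding ell2_inner_def by (rule suminf_finite) (auto simp: ell2_nth_trunc)
  then show ?thesis by (simp add: ell2_nth_trunc)
qed

lemma ell2_nth_apply_trunc:
  assumes "T \<in> bounded_ops"
  shows "ell2_nth (T (trunc M x)) i = (\<Sum>j<M. ell2_nth x j * matrix_entry T i j)"
  by (simp add: trunc_apply blinfun.bilinear_simps bounded_opsD[OF assms] ell2_nth_sum ell2_rep_eq
      matrix_entry_def)

text \<open>On finite sections the form is an integral against the symbol, bounded through 2 |X| |Y|
  \<le> |X|^2 + |Y|^2 and Parseval; truncation then tends to the identity pointwise.\<close>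

lemma is_toeplitz_norm_le:
  assumes T: "is_toeplitz T a" and a: "continuous_on {0..2*pi} a"
    and C: "\<And>t. t \<in> {0..2*pi} \<Longrightarrow> cmod (a t) \<le> C"
  shows "norm T \<le> C"
proof -
  have C0: "0 \<le> C" using order_trans[OF norm_ge_zero C[of 0]] by simp
  have sect: "trunc M y \<bullet> T (trunc M x) \<le> C / 2 * ((norm x)\<^sup>2 + (norm y)\<^sup>2)" for x y M
  proof -
    let ?X = "trig_sum M (ell2_nth x)" and ?Y = "trig_sum M (ell2_nth y)"
    let ?form = "\<Sum>i<M. \<Sum>j<M. cnj (ell2_nth y i) * (ell2_nth x j * fourier_coeff a (int j - int i))"
    have "ell2_inner (trunc M y) (T (trunc M x)) = ?form"
      using T by (simp add: ell2_inner_trunc ell2_nth_apply_trunc is_toeplitz_def sum_distrib_left)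
    then have le: "trunc M y \<bullet> T (trunc M x) \<le> cmod ?form"
      using complex_Re_le_cmod[of ?form] by (simp only: inner_ell2_def)
    have "2 * pi * cmod ?form \<le> C / 2 * (2 * pi * (\<Sum>j<M. (cmod (ell2_nth x j))\<^sup>2)
        + 2 * pi * (\<Sum>j<M. (cmod (ell2_nth y j))\<^sup>2))"
    proof -
      have f: "((\<lambda>t. a t * (cnj (?Y t) * ?X t)) has_integral 2 * of_real pi * ?form) {0..2*pi}"
        by (rule fourier_form[OF a])
      have g: "((\<lambda>t. C / 2 * ((cmod (?X t))\<^sup>2 + (cmod (?Y t))\<^sup>2)) has_integral
          C / 2 * (2 * pi * (\<Sum>j<M. (cmod (ell2_nth x j))\<^sup>2) + 2 * pi * (\<Sum>j<M. (cmod (ell2_nth y j))\<^sup>2)))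
          {0..2*pi}"
        by (intro has_integral_mult_right has_integral_add trig_sum_parseval)
      have "cmod (a t * (cnj (?Y t) * ?X t)) \<le> C / 2 * ((cmod (?X t))\<^sup>2 + (cmod (?Y t))\<^sup>2)"
        if "t \<in> {0..2*pi}" for t
      proof -
        have "cmod (a t * (cnj (?Y t) * ?X t)) \<le> C * (cmod (?Y t) * cmod (?X t))"
          using C[OF that] by (simp add: norm_mult mult_right_mono)
        also have "cmod (?Y t) * cmod (?X t) \<le> ((cmod (?X t))\<^sup>2 + (cmod (?Y t))\<^sup>2) / 2"
          using sum_squares_bound[of "cmod (?X t)" "cmod (?Y t)"] by (simp add: mult_ac)
        finally show ?thesis using C0 by (simp add: mult_left_mono)
      qed
      from integral_norm_bound_integral[OF has_integral_integrable[OF f] has_integral_integrable[OF g] this]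
      show ?thesis unfolding integral_unique[OF f] integral_unique[OF g] by (simp add: norm_mult)
    qed
    also have "\<dots> = 2 * pi * (C / 2 * ((\<Sum>j<M. (cmod (ell2_nth x j))\<^sup>2) + (\<Sum>j<M. (cmod (ell2_nth y j))\<^sup>2)))"
      by (simp only: distrib_left mult_ac)
    finally have form_le: "cmod ?form \<le> C / 2 * ((\<Sum>j<M. (cmod (ell2_nth x j))\<^sup>2) + (\<Sum>j<M. (cmod (ell2_nth y j))\<^sup>2))"
      by (rule mult_left_le_imp_le) simp
    note order_trans[OF le form_le]
    also have "C / 2 * ((\<Sum>j<M. (cmod (ell2_nth x j))\<^sup>2) + (\<Sum>j<M. (cmod (ell2_nth y j))\<^sup>2)) \<le> C / 2 * ((norm x)\<^sup>2 + (norm y)\<^sup>2)"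
      using C0 by (intro mult_left_mono add_mono sum_ell2_le) auto
    finally show ?thesis .
  qed
  have form: "y \<bullet> T x \<le> C / 2 * ((norm x)\<^sup>2 + (norm y)\<^sup>2)" for x y
  proof (rule LIMSEQ_le_const2)
    show "(\<lambda>M. trunc M y \<bullet> T (trunc M x)) \<longlonglongrightarrow> y \<bullet> T x"
      by (intro tendsto_intros trunc_tendsto)
  qed (use sect in blast)
  show ?thesis
  proof (rule norm_blinfun_bound[OF C0])
    fix x
    show "norm (T x) \<le> C * norm x"
    proof (cases "T x = 0 \<or> x = 0")
      case True
      then show ?thesis using C0 by (auto simp: blinfun.bilinear_simps)
    next
      case False
      \<comment> \<open>Parallel to \<open>T x\<close> with the norm of \<open>x\<close>, so that
        the two squares in the bound are equal and it becomes C |x|^2.\<close>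
      define y where "y = (norm x / norm (T x)) *\<^sub>R T x"
      have "norm y = norm x" using False by (simp add: y_def)
      moreover have "y \<bullet> T x = norm x * norm (T x)"
        using False by (simp add: y_def power2_eq_square flip: power2_norm_eq_inner)
      ultimately have "norm x * norm (T x) \<le> norm x * (C * norm x)"
        using form[of y x] by (simp add: power2_eq_square mult_ac)
      then show ?thesis using False by simp
    qed
  qed
qed

lemma is_toeplitz_add:
  assumes "is_toeplitz T a" "is_toeplitz S b" "continuous_on {0..2*pi} a" "continuous_on {0..2*pi} b"
  shows "is_toeplitz (T + S) (\<lambda>t. a t + b t)"
  using assms closed_algebra_bounded_ops
  by (simp add: is_toeplitz_def closed_algebra_def fourier_coeff_add matrix_entry_def
      blinfun.bilinear_simps ell2_rep_eq)

lemma is_toeplitz_diff: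
  assumes "is_toeplitz T a" "is_toeplitz S b" "continuous_on {0..2*pi} a" "continuous_on {0..2*pi} b"
  shows "is_toeplitz (T - S) (\<lambda>t. a t - b t)"
  using assms closed_algebra_diff[OF closed_algebra_bounded_ops]
  by (simp add: is_toeplitz_def fourier_coeff_diff matrix_entry_def
      blinfun.bilinear_simps ell2_rep_eq)

lemma is_toeplitz_cscale:
  assumes "is_toeplitz T a" "continuous_on {0..2*pi} a"
  shows "is_toeplitz (cscale c o\<^sub>L T) (\<lambda>t. c * a t)"
  using assms closed_algebra_compose[OF closed_algebra_bounded_ops cscale_bounded_ops]
  by (simp add: is_toeplitz_def fourier_coeff_mult matrix_entry_def ell2_rep_eq)

lemma is_toeplitz_shift: "is_toeplitz (shift k) (\<lambda>t. cis (of_int k * t))"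
  by (simp add: is_toeplitz_def shift_bounded_ops matrix_entry_shift fourier_coeff_cis)

text \<open>The difference is a Toeplitz operator with symbol 0, so its norm is at most 0.\<close>

lemma is_toeplitz_unique:
  assumes "is_toeplitz T a" "is_toeplitz S a" "continuous_on {0..2*pi} a"
  shows "T = S"
proof -
  have "norm (T - S) \<le> 0"
    by (rule is_toeplitz_norm_le[OF is_toeplitz_diff[OF assms(1,2,3,3)]]) (auto intro: continuous_intros)
  then show ?thesis by simp
qed


section \<open>Trigonometric polynomials and existence of Toeplitz operators\<close>

inductive_set trig :: "(real \<Rightarrow> complex) set" where
  cis: "(\<lambda>t. cis (of_int k * t)) \<in> trig"
| cmult: "f \<in> trig \<Longrightarrow> (\<lambda>t. c * f t) \<in> trig"
| add: "f \<in> trig \<Longrightarrow> g \<in> trig \<Longrightarrow> (\<lambda>t. f t + g t) \<in> trig"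

lemma trig_const: "(\<lambda>t. c) \<in> trig"
  using trig.cmult[OF trig.cis[of 0], of c] by simp

lemma trig_mult: "f \<in> trig \<Longrightarrow> g \<in> trig \<Longrightarrow> (\<lambda>t. f t * g t) \<in> trig"
proof (induction f rule: trig.induct)
  case (cis k)
  from cis show ?case
  proof (induction g rule: trig.induct)
    case (cis l)
    then show ?case using trig.cis[of "k + l"] by (simp add: cis_mult distrib_right)
  next
    case (cmult g c)
    then show ?case using trig.cmult[of _ c] by (simp add: mult_ac)
  next
    case (add g h)
    then show ?case using trig.add by (simp add: distrib_left)
  qed
next
  case (cmult f c)
  then show ?case using trig.cmult[of "\<lambda>t. f t * g t" c] by (simp add: mult_ac)
next
  case (add f h)
  then show ?case using trig.add by (simp add: distrib_right)
qed

text \<open>\<open>C2pi\<close> without extensionality, so that exponentials and pointwise sums and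
  products qualify as they stand.\<close>

definition circle_function :: "(real \<Rightarrow> complex) \<Rightarrow> bool" where
  "circle_function a \<longleftrightarrow> continuous_on {0..2*pi} a \<and> a 0 = a (2*pi)"

lemma circle_function_continuous: "circle_function a \<Longrightarrow> continuous_on {0..2*pi} a"
  by (simp add: circle_function_def)

lemma circle_function_mult: "circle_function a \<Longrightarrow> circle_function b \<Longrightarrow> circle_function (\<lambda>t. a t * b t)"
  by (auto simp: circle_function_def intro!: continuous_intros)

lemma circle_function_add: "circle_function a \<Longrightarrow> circle_function b \<Longrightarrow> circle_function (\<lambda>t. a t + b t)"
  by (auto simp: circle_function_def intro!: continuous_intros)

lemma circle_function_const: "circle_function (\<lambda>t. c)"
  by (auto simp: circle_function_def)

lemma circle_function_cis: "circle_function (\<lambda>t. cis (of_int k * t))"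
proof -
  have "cis (of_int k * (2 * pi)) = 1"
    using cis_multiple_2pi[of "of_int k"] by (simp add: mult_ac)
  then show ?thesis by (auto simp: circle_function_def intro!: continuous_intros)
qed

lemma circle_function_trig: "f \<in> trig \<Longrightarrow> circle_function f"
  by (induction rule: trig.induct)
    (auto intro: circle_function_cis circle_function_add circle_function_mult[OF circle_function_const])

lemma trig_real_polynomial_function:
  "real_polynomial_function g \<Longrightarrow> (\<lambda>t. of_real (g (cis t))) \<in> trig"
proof (induction rule: real_polynomial_function.induct)
  case (linear f)
  have f: "f z = Re z * f 1 + Im z * f \<i>" for z
  proof -
    have "f z = f (Re z *\<^sub>R 1 + Im z *\<^sub>R \<i>)"
      by (rule arg_cong[where f = f]) (simp add: complex_eq_iff)
    then show ?thesis
      using linear_add[OF bounded_linear.linear[OF linear]] linear_cmul[OF bounded_linear.linear[OF linear]]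
      by simp
  qed
  \<comment> \<open>Euler's formulas for cosine and sine, the coordinates of
    \<open>cis t\<close>.\<close>
  have "(\<lambda>t. of_real (f (cis t))) = (\<lambda>t. (of_real (f 1) - \<i> * of_real (f \<i>)) / 2 * cis (of_int 1 * t)
      + (of_real (f 1) + \<i> * of_real (f \<i>)) / 2 * cis (of_int (- 1) * t))"
  proof
    fix t
    show "of_real (f (cis t)) = (of_real (f 1) - \<i> * of_real (f \<i>)) / 2 * cis (of_int 1 * t)
      + (of_real (f 1) + \<i> * of_real (f \<i>)) / 2 * cis (of_int (- 1) * t)"
      unfolding f[of "cis t"] by (simp add: complex_eq_iff field_simps)
  qed
  moreover have "\<dots> \<in> trig" by (rule trig.add[OF trig.cmult[OF trig.cis] trig.cmult[OF trig.cis]])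
  ultimately show ?case by simp
next
  case (const c)
  then show ?case by (rule trig_const)
next
  case (add f g)
  then show ?case using trig.add by simp
next
  case (mult f g)
  then show ?case using trig_mult by simp
qed

text \<open>
  A loop descends to a continuous function on the unit circle, where polynomials in real and
  imaginary part are dense by the Stone--Weierstrass theorem.
\<close>

lemma trig_dense:
  assumes a: "circle_function a" and e: "e > 0"
  shows "\<exists>f\<in>trig. \<forall>t\<in>{0..2*pi}. cmod (a t - f t) < e"
proof -
  define p where "p s = a (2 * pi * s)" for s
  define g where "g z = a (Arg2pi z)" for z
  have "continuous_on {0..1} p"
    unfolding p_def using circle_function_continuous[OF a]
    by (rule continuous_on_compose2) (auto intro!: continuous_intros mult_left_le)
  then have "path p" by (simp add: path_def)
  moreover have "pathstart p = pathfinish p"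
    using a by (simp add: p_def pathstart_def pathfinish_def circle_function_def)
  \<comment> \<open>The trivial homotopy of \<open>p\<close> to itself serves only to obtain
    continuity of the induced map on the circle.\<close>
  ultimately have "homotopic_loops UNIV p p" by (simp add: homotopic_loops_refl)
  from homotopic_with_imp_continuous[OF homotopic_loops_imp_homotopic_circlemaps[OF this]]
  have cont: "continuous_on (sphere 0 1) g"
    by (simp add: g_def[abs_def] p_def o_def)
  \<comment> \<open>The right endpoint is separate because \<open>Arg2pi\<close> returns 0 there;
    the periodicity of \<open>a\<close> settles it.\<close>
  have g: "g (cis t) = a t" if "t \<in> {0..2*pi}" for t
  proof (cases "t = 2 * pi")
    case True
    have "Arg2pi 1 = 0" using Arg2pi_of_real[of 1] by simp
    then show ?thesis using True a by (simp add: g_def circle_function_def)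
  next
    case False
    then have "Arg2pi (cis t) = t" using that Arg2pi_exp[of "\<i> * of_real t"] by (simp add: cis_conv_exp)
    then show ?thesis by (simp add: g_def)
  qed
  have e2: "e / 2 > 0" using e by simp
  obtain u where u: "real_polynomial_function u" "\<And>z. z \<in> sphere 0 1 \<Longrightarrow> \<bar>Re (g z) - u z\<bar> < e / 2"
    by (rule Stone_Weierstrass_real_polynomial_function[of "sphere 0 1" "\<lambda>z. Re (g z)" "e / 2"])
      (use cont e2 in \<open>auto intro: continuous_intros\<close>)
  obtain v where v: "real_polynomial_function v" "\<And>z. z \<in> sphere 0 1 \<Longrightarrow> \<bar>Im (g z) - v z\<bar> < e / 2"
    by (rule Stone_Weierstrass_real_polynomial_function[of "sphere 0 1" "\<lambda>z. Im (g z)" "e / 2"])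
      (use cont e2 in \<open>auto intro: continuous_intros\<close>)
  let ?f = "\<lambda>t. of_real (u (cis t)) + \<i> * of_real (v (cis t))"
  have "cmod (a t - ?f t) < e" if "t \<in> {0..2*pi}" for t
  proof -
    have "cmod (a t - ?f t) \<le> \<bar>Re (a t - ?f t)\<bar> + \<bar>Im (a t - ?f t)\<bar>" by (rule cmod_le)
    also have "\<dots> < e / 2 + e / 2"
      using u(2)[of "cis t"] v(2)[of "cis t"] g[OF that] by (intro add_strict_mono) auto
    finally show ?thesis by simp
  qed
  moreover have "?f \<in> trig" 
    by (rule trig.add[OF trig_real_polynomial_function[OF u(1)]
          trig.cmult[OF trig_real_polynomial_function[OF v(1)]]])
  ultimately show ?thesis by (intro bexI[of _ ?f] ballI)
qed

lemma trig_approximation: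
  assumes "circle_function a"
  obtains f where "\<And>n. f n \<in> trig" "\<And>n t. t \<in> {0..2*pi} \<Longrightarrow> cmod (a t - f n t) \<le> inverse (real (Suc n))"
proof -
  have "\<exists>f\<in>trig. \<forall>t\<in>{0..2*pi}. cmod (a t - f t) < inverse (real (Suc n))" for n
    by (rule trig_dense[OF assms]) simp
  then obtain f where "\<And>n. f n \<in> trig \<and> (\<forall>t\<in>{0..2*pi}. cmod (a t - f n t) < inverse (real (Suc n)))"
    by metis
  then show ?thesis by (intro that[of f]) (auto intro: less_imp_le)
qed

lemma is_toeplitz_trig: "f \<in> trig \<Longrightarrow> \<exists>T. is_toeplitz T f"
proof (induction rule: trig.induct)
  case (cis k)
  then show ?case using is_toeplitz_shift by blast
next
  case (cmult f c)
  then show ?case using is_toeplitz_cscale circle_function_continuous[OF circle_function_trig] by blast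
next
  case (add f g)
  then show ?case using is_toeplitz_add circle_function_continuous[OF circle_function_trig] by blast
qed

lemma fourier_coeff_norm_le:
  assumes a: "continuous_on {0..2*pi} a" and C: "\<And>t. t \<in> {0..2*pi} \<Longrightarrow> cmod (a t) \<le> C"
  shows "cmod (fourier_coeff a k) \<le> C"
proof -
  have "0 \<le> C" using order_trans[OF norm_ge_zero C[of 0]] by simp
  moreover have "cmod (a t * exp (- \<i> * of_int k * of_real t)) \<le> C" if "t \<in> {0..2*pi}" for t
    using C[OF that] by (simp add: norm_mult)
  ultimately have "cmod (2 * of_real pi * fourier_coeff a k) \<le> C * (2 * pi - 0)"
    using has_integral_bound_real[OF _ finite.emptyI fourier_coeff_has_integral[OF a, of k]] by simp
  then show ?thesis by (simp add: norm_mult field_simps)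
qed

text \<open>The norm bound turns uniform approximation of symbols into a Cauchy sequence of
  operators; matrix entries and Fourier coefficients are continuous, so the limit has the required
  matrix.\<close>

lemma is_toeplitz_exists:
  assumes a: "circle_function a"
  shows "\<exists>T. is_toeplitz T a"
proof -
  obtain f where f: "\<And>n. f n \<in> trig"
    "\<And>n t. t \<in> {0..2*pi} \<Longrightarrow> cmod (a t - f n t) \<le> inverse (real (Suc n))"
    using trig_approximation[OF a] by metis
  note ca = circle_function_continuous[OF a]
  note cf = circle_function_continuous[OF circle_function_trig[OF f(1)]]
  obtain T where T: "\<And>n. is_toeplitz (T n) (f n)" using is_toeplitz_trig[OF f(1)] by metis
  have diff: "norm (T m - T n) \<le> inverse (real (Suc m)) + inverse (real (Suc n))" for m n
  proof (rule is_toeplitz_norm_le[OF is_toeplitz_diff[OF T T cf cf]])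
    show "continuous_on {0..2*pi} (\<lambda>t. f m t - f n t)" by (intro continuous_intros cf)
    fix t assume t: "t \<in> {0..2*pi}"
    have "f m t - f n t = (a t - f n t) - (a t - f m t)" by simp
    also have "cmod \<dots> \<le> cmod (a t - f n t) + cmod (a t - f m t)" by (rule norm_triangle_ineq4)
    finally show "cmod (f m t - f n t) \<le> inverse (real (Suc m)) + inverse (real (Suc n))"
      using f(2)[OF t, of n] f(2)[OF t, of m] by linarith
  qed
  have "Cauchy T"
  proof (rule CauchyI)
    fix e :: real assume "e > 0"
    then obtain N where N: "inverse (real (Suc N)) < e / 2" using reals_Archimedean[of "e / 2"] by auto
    have "norm (T m - T n) < e" if "m \<ge> N" "n \<ge> N" for m n
    proof -
      have "inverse (real (Suc m)) \<le> inverse (real (Suc N))" "inverse (real (Suc n)) \<le> inverse (real (Suc N))"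
        using that by (auto intro!: le_imp_inverse_le)
      then show ?thesis using diff[of m n] N by linarith
    qed
    then show "\<exists>M. \<forall>m\<ge>M. \<forall>n\<ge>M. norm (T m - T n) < e" by blast
  qed
  then obtain S where S: "T \<longlonglongrightarrow> S" using Cauchy_convergent convergent_def by blast
  have "S \<in> bounded_ops"
    using closed_sequentially[of bounded_ops T S] closed_algebra_bounded_ops S T
    by (simp add: closed_algebra_def is_toeplitz_def)
  moreover have "matrix_entry S i j = fourier_coeff a (int j - int i)" for i j
  proof (rule LIMSEQ_unique)
    have "(\<lambda>n. norm (T n (ell2_unit j) - S (ell2_unit j))) \<longlonglongrightarrow> 0"
      by (intro tendsto_norm_zero Lim_null[THEN iffD1] tendsto_intros S)
    then have "(\<lambda>n. matrix_entry (T n) i j - matrix_entry S i j) \<longlonglongrightarrow> 0"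
      by (rule Lim_null_comparison[rotated])
        (use norm_ell2_nth_le[of "T _ (ell2_unit j) - S (ell2_unit j)" i] in
          \<open>auto simp: matrix_entry_def ell2_rep_eq intro!: always_eventually\<close>)
    then show "(\<lambda>n. matrix_entry (T n) i j) \<longlonglongrightarrow> matrix_entry S i j" by (rule Lim_null[THEN iffD2])
    have "cmod (fourier_coeff (f n) k - fourier_coeff a k) \<le> inverse (real (Suc n))" for n k
      unfolding fourier_coeff_diff[OF cf ca, symmetric]
      by (rule fourier_coeff_norm_le) (use f(2) in \<open>auto intro!: continuous_intros cf ca simp: norm_minus_commute\<close>)
    then have "(\<lambda>n. fourier_coeff (f n) (int j - int i) - fourier_coeff a (int j - int i)) \<longlonglongrightarrow> 0"
      by (intro Lim_null_comparison[OF _ LIMSEQ_inverse_real_of_nat]) (auto intro!: always_eventually)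
    then have "(\<lambda>n. fourier_coeff (f n) (int j - int i)) \<longlonglongrightarrow> fourier_coeff a (int j - int i)"
      by (rule Lim_null[THEN iffD2])
    then show "(\<lambda>n. matrix_entry (T n) i j) \<longlonglongrightarrow> fourier_coeff a (int j - int i)"
      using T by (simp add: is_toeplitz_def)
  qed
  ultimately show ?thesis by (auto simp: is_toeplitz_def)
qed

lemma toeplitz_eqI:
  assumes "is_toeplitz T a" "continuous_on {0..2*pi} a"
  shows "toeplitz a = T"
  unfolding toeplitz_def is_toeplitz_def[symmetric]
  by (rule the_equality) (use assms is_toeplitz_unique in blast)+

lemma is_toeplitz_toeplitz: "circle_function a \<Longrightarrow> is_toeplitz (toeplitz a) a"
  using is_toeplitz_exists toeplitz_eqI circle_function_continuous by metis

lemma toeplitz_bounded_ops: "circle_function a \<Longrightarrow> toeplitz a \<in> bounded_ops"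
  using is_toeplitz_toeplitz by (auto simp: is_toeplitz_def)

section \<open>Linear and continuous dependence of Toeplitz operators on the symbol\<close>

lemma toeplitz_add:
  assumes "circle_function a" "circle_function b"
  shows "toeplitz (\<lambda>t. a t + b t) = toeplitz a + toeplitz b"
  using assms by (intro toeplitz_eqI is_toeplitz_add is_toeplitz_toeplitz circle_function_continuous
      circle_function_add)

lemma toeplitz_cmult:
  assumes "circle_function a"
  shows "toeplitz (\<lambda>t. c * a t) = cscale c o\<^sub>L toeplitz a"
  using assms by (intro toeplitz_eqI is_toeplitz_cscale is_toeplitz_toeplitz circle_function_continuous
      circle_function_mult circle_function_const)

lemma toeplitz_cis: "toeplitz (\<lambda>t. cis (of_int k * t)) = shift k"
  by (intro toeplitz_eqI is_toeplitz_shift circle_function_continuous circle_function_cis)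

lemma toeplitz_norm_diff_le:
  assumes "circle_function a" "circle_function b" "\<And>t. t \<in> {0..2*pi} \<Longrightarrow> cmod (a t - b t) \<le> C"
  shows "norm (toeplitz a - toeplitz b) \<le> C"
  by (rule is_toeplitz_norm_le[OF is_toeplitz_diff])
    (use assms in \<open>auto intro: is_toeplitz_toeplitz circle_function_continuous
      intro!: continuous_on_diff\<close>)

lemma toeplitz_tendsto:
  assumes "circle_function a" "\<And>n. circle_function (f n)"
    and "\<And>n t. t \<in> {0..2*pi} \<Longrightarrow> cmod (a t - f n t) \<le> e n" and "e \<longlonglongrightarrow> 0"
  shows "(\<lambda>n. toeplitz (f n)) \<longlonglongrightarrow> toeplitz a"
proof -
  have "norm (toeplitz (f n) - toeplitz a) \<le> e n" for n
    by (rule toeplitz_norm_diff_le) (use assms in \<open>auto simp: norm_minus_commute\<close>)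
  then have "(\<lambda>n. toeplitz (f n) - toeplitz a) \<longlonglongrightarrow> 0"
    by (intro Lim_null_comparison[OF _ assms(4)]) (auto intro!: always_eventually)
  then show ?thesis by (rule Lim_null[THEN iffD2])
qed


section \<open>Semicommutators are compact\<close>

lemma compact_op_lim:
  assumes "\<And>n. compact_op (X n)" "X \<longlonglongrightarrow> K"
  shows "compact_op K"
proof (rule compact_op_approx)
  fix e :: real assume "e > 0"
  then obtain n where "norm (X n - K) < e" using assms(2) LIMSEQ_D by blast
  then have "norm (K - X n) < e" by (simp add: norm_minus_commute)
  then show "\<exists>L. compact_op L \<and> norm (K - L) < e" using assms(1) by blast
qed

definition semicommutator :: "(real \<Rightarrow> complex) \<Rightarrow> (real \<Rightarrow> complex) \<Rightarrow> operator" where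
  "semicommutator a b = (toeplitz a o\<^sub>L toeplitz b) - toeplitz (\<lambda>t. a t * b t)"

lemma cscale_commute: "A \<in> bounded_ops \<Longrightarrow> A o\<^sub>L cscale c = cscale c o\<^sub>L A"
  by (intro blinfun_eqI) (simp add: bounded_opsD)

text \<open>Semicommutators are bilinear, so two nested inductions reduce the claim to products of
  shifts.\<close>

lemma compact_op_semicommutator_trig:
  "f \<in> trig \<Longrightarrow> g \<in> trig \<Longrightarrow> compact_op (semicommutator f g)"
proof (induction f rule: trig.induct)
  case (cis k)
  from cis show ?case
  proof (induction g rule: trig.induct)
    case (cis l)
    have "(\<lambda>t. cis (of_int k * t) * cis (of_int l * t)) = (\<lambda>t. cis (of_int (k + l) * t))"
      by (simp add: cis_mult distrib_right)
    then show ?case by (simp only: semicommutator_def toeplitz_cis compact_op_shift_compose)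
  next
    case (cmult g c)
    let ?e = "\<lambda>t. cis (of_int k * t)"
    have g: "circle_function g" using cmult by (intro circle_function_trig)
    have "(\<lambda>t. ?e t * (c * g t)) = (\<lambda>t. c * (?e t * g t))" by (simp add: mult_ac)
    then have "semicommutator ?e (\<lambda>t. c * g t) = cscale c o\<^sub>L semicommutator ?e g"
      by (simp add: semicommutator_def toeplitz_cmult g circle_function_cis circle_function_mult
          blinfun_compose_simps cscale_commute toeplitz_bounded_ops flip: blinfun_compose_assoc)
    then show ?case using compact_op_compose_left[OF cmult.IH] by simp
  next
    case (add g h)
    let ?e = "\<lambda>t. cis (of_int k * t)"
    have gh: "circle_function g" "circle_function h" using add by (auto intro: circle_function_trig)
    have "(\<lambda>t. ?e t * (g t + h t)) = (\<lambda>t. ?e t * g t + ?e t * h t)" by (simp add: distrib_left)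
    then have "semicommutator ?e (\<lambda>t. g t + h t) = semicommutator ?e g + semicommutator ?e h"
      by (simp add: semicommutator_def toeplitz_add gh circle_function_cis circle_function_mult
          blinfun_compose_simps)
    then show ?case using compact_op_add[OF add.IH] by simp
  qed
next
  case (cmult f c)
  have fg: "circle_function f" "circle_function g" using cmult by (auto intro: circle_function_trig)
  have "(\<lambda>t. c * f t * g t) = (\<lambda>t. c * (f t * g t))" by (simp add: mult_ac)
  then have "semicommutator (\<lambda>t. c * f t) g = cscale c o\<^sub>L semicommutator f g"
    by (simp add: semicommutator_def toeplitz_cmult fg circle_function_mult
        blinfun_compose_simps blinfun_compose_assoc)
  then show ?case using compact_op_compose_left[OF cmult.IH[OF cmult.prems]] by simp
next
  case (add f h)
  have fgh: "circle_function f" "circle_function g" "circle_function h"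
    using add by (auto intro: circle_function_trig)
  have "(\<lambda>t. (f t + h t) * g t) = (\<lambda>t. f t * g t + h t * g t)" by (simp add: distrib_right)
  then have "semicommutator (\<lambda>t. f t + h t) g = semicommutator f g + semicommutator h g"
    by (simp add: semicommutator_def toeplitz_add fgh circle_function_mult blinfun_compose_simps)
  then show ?case using compact_op_add[OF add.IH(1) add.IH(2)] add.prems by simp
qed

lemma circle_function_bounded:
  assumes "circle_function a"
  shows "\<exists>B. \<forall>t\<in>{0..2*pi}. cmod (a t) \<le> B"
proof -
  have "bounded (a ` {0..2*pi})"
    by (intro compact_imp_bounded compact_continuous_image circle_function_continuous assms) simp
  then show ?thesis by (auto simp: bounded_iff)
qed

lemma compact_op_semicommutator:
  assumes a: "circle_function a" and b: "circle_function b"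
  shows "compact_op (semicommutator a b)"
proof -
  obtain f where f: "\<And>n. f n \<in> trig"
    "\<And>n t. t \<in> {0..2*pi} \<Longrightarrow> cmod (a t - f n t) \<le> inverse (real (Suc n))"
    using trig_approximation[OF a] by metis
  obtain g where g: "\<And>n. g n \<in> trig"
    "\<And>n t. t \<in> {0..2*pi} \<Longrightarrow> cmod (b t - g n t) \<le> inverse (real (Suc n))"
    using trig_approximation[OF b] by metis
  obtain A where A: "\<And>t. t \<in> {0..2*pi} \<Longrightarrow> cmod (a t) \<le> A" using circle_function_bounded[OF a] by blast
  obtain B where B: "\<And>t. t \<in> {0..2*pi} \<Longrightarrow> cmod (b t) \<le> B" using circle_function_bounded[OF b] by blast
  note cf = circle_function_trig[OF f(1)] and cg = circle_function_trig[OF g(1)]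
  \<comment> \<open>From ab - fg = (a - f) b + f (b - g), with the bound A + 1 for the approximants
    of \<open>a\<close>, whose error is at most 1.\<close>
  let ?e = "\<lambda>n. inverse (real (Suc n)) * B + (A + 1) * inverse (real (Suc n))"
  have prod: "cmod (a t * b t - f n t * g n t) \<le> ?e n" if t: "t \<in> {0..2*pi}" for n t
  proof -
    let ?i = "inverse (real (Suc n))"
    have i: "0 \<le> ?i" "?i \<le> 1" by (auto simp: field_simps)
    have "cmod (f n t) \<le> cmod (a t) + cmod (a t - f n t)"
      using norm_triangle_ineq4[of "a t" "a t - f n t"] by simp
    then have fA: "cmod (f n t) \<le> A + 1" using A[OF t] f(2)[OF t, of n] i by linarith
    have "a t * b t - f n t * g n t = (a t - f n t) * b t + f n t * (b t - g n t)"
      by (simp add: algebra_simps)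
    also have "cmod \<dots> \<le> cmod (a t - f n t) * cmod (b t) + cmod (f n t) * cmod (b t - g n t)"
      using norm_triangle_ineq[of "(a t - f n t) * b t" "f n t * (b t - g n t)"] by (simp add: norm_mult)
    also have "\<dots> \<le> ?i * B + (A + 1) * ?i"
      using f(2)[OF t, of n] g(2)[OF t, of n] B[OF t] fA i order_trans[OF norm_ge_zero fA]
      by (intro add_mono mult_mono) auto
    finally show ?thesis .
  qed
  have e0: "?e \<longlonglongrightarrow> 0"
    by (rule tendsto_eq_intros LIMSEQ_inverse_real_of_nat refl | simp)+
  have "(\<lambda>n. semicommutator (f n) (g n)) \<longlonglongrightarrow> semicommutator a b"
    unfolding semicommutator_def
    by (intro tendsto_intros toeplitz_tendsto[OF a cf f(2) LIMSEQ_inverse_real_of_nat]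
        toeplitz_tendsto[OF b cg g(2) LIMSEQ_inverse_real_of_nat]
        toeplitz_tendsto[OF circle_function_mult[OF a b] circle_function_mult[OF cf cg] prod e0])
  then show ?thesis by (rule compact_op_lim[OF compact_op_semicommutator_trig[OF f(1) g(1)]])
qed


section \<open>Approximate eigenvectors and the symbol\<close>

text \<open>
  The supports are disjoint and of growing length: for fixed \<open>t\<close> the vectors are orthonormal, so
  compact operators send them to null sequences, while the boundary terms in their
  translates become negligible.
\<close>

lift_definition wave :: "real \<Rightarrow> nat \<Rightarrow> ell2" is
  "\<lambda>t n j. if j \<in> {2 ^ n..<2 ^ Suc n} then cis (real j * t) / of_real (sqrt (2 ^ n)) else 0"
  subgoal for t n by (rule summable_finite[of "{2 ^ n..<2 ^ Suc n}"]) auto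
  done

lemma cmod_wave: "cmod (ell2_nth (wave t n) j) = (if j \<in> {2 ^ n..<2 ^ Suc n} then 1 / sqrt (2 ^ n) else 0)"
  by (simp add: wave.rep_eq norm_divide)

lemma norm_wave: "norm (wave t n) = 1"
proof -
  have "(norm (wave t n))\<^sup>2 = (\<Sum>j\<in>{2 ^ n..<2 ^ Suc n}. (cmod (ell2_nth (wave t n) j))\<^sup>2)"
    by (rule norm_ell2_finite_support) (auto simp: wave.rep_eq)
  also have "\<dots> = (\<Sum>j\<in>{2 ^ n..<(2 :: nat) ^ Suc n}. 1 / 2 ^ n)"
    by (intro sum.cong refl) (simp only: cmod_wave, simp add: power_divide)
  also have "\<dots> = 1\<^sup>2" by simp
  finally show ?thesis by (rule power2_eq_imp_eq) auto
qed

lemma wave_orthogonal: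
  assumes "m \<noteq> n"
  shows "wave t m \<bullet> wave t n = 0"
proof -
  have "cnj (ell2_nth (wave t m) j) * ell2_nth (wave t n) j = 0" for j
  proof (cases "j \<in> {2 ^ m..<2 ^ Suc m} \<and> j \<in> {2 ^ n..<2 ^ Suc n}")
    case True
    then have "(2 :: nat) ^ m < 2 ^ Suc n" "(2 :: nat) ^ n < 2 ^ Suc m" by auto
    then have "m < Suc n" "n < Suc m" by (meson power_less_imp_less_exp one_less_numeral_iff semiring_norm(76))+
    then show ?thesis using assms by simp
  qed (auto simp: wave.rep_eq)
  then show ?thesis by (simp only: inner_ell2_def ell2_inner_def suminf_zero zero_complex.sel)
qed

text \<open>A relation, since an arbitrary operator need not have an approximate eigenvalue along
  the waves.\<close>

definition symbol_at :: "real \<Rightarrow> operator \<Rightarrow> complex \<Rightarrow> bool" where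
  "symbol_at t A c \<longleftrightarrow> (\<lambda>n. A (wave t n) - ell2_scaleC c (wave t n)) \<longlonglongrightarrow> 0"

lemma blinfun_tendsto_0:
  fixes A :: operator
  assumes "X \<longlonglongrightarrow> 0" shows "(\<lambda>n. A (X n)) \<longlonglongrightarrow> 0"
  using blinfun.tendsto[OF tendsto_const assms, of A] by (simp add: blinfun.bilinear_simps)

lemma symbol_at_add:
  assumes "symbol_at t A c" "symbol_at t B d"
  shows "symbol_at t (A + B) (c + d)"
proof -
  have "(A + B) x - ell2_scaleC (c + d) x = (A x - ell2_scaleC c x) + (B x - ell2_scaleC d x)" for x
    by (rule ell2_eqI) (simp add: ell2_rep_eq blinfun.bilinear_simps algebra_simps)
  then show ?thesis using tendsto_add[OF assms[unfolded symbol_at_def]] by (simp add: symbol_at_def)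
qed

lemma symbol_at_diff:
  assumes "symbol_at t A c" "symbol_at t B d"
  shows "symbol_at t (A - B) (c - d)"
proof -
  have "(A - B) x - ell2_scaleC (c - d) x = (A x - ell2_scaleC c x) - (B x - ell2_scaleC d x)" for x
    by (rule ell2_eqI) (simp add: ell2_rep_eq blinfun.bilinear_simps algebra_simps)
  then show ?thesis using tendsto_diff[OF assms[unfolded symbol_at_def]] by (simp add: symbol_at_def)
qed

text \<open>(A B - c d) x = A (B x - d x) + d (A x - c x), where complex linearity moves d through
  \<open>A\<close>.\<close>

lemma symbol_at_compose:
  assumes A: "A \<in> bounded_ops" "symbol_at t A c" and B: "symbol_at t B d"
  shows "symbol_at t (A o\<^sub>L B) (c * d)"
proof -
  have "(A o\<^sub>L B) x - ell2_scaleC (c * d) x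
      = A (B x - ell2_scaleC d x) + cscale d (A x - ell2_scaleC c x)" for x
    by (rule ell2_eqI)
      (simp add: ell2_rep_eq blinfun.bilinear_simps bounded_opsD[OF A(1)] algebra_simps)
  moreover have "(\<lambda>n. A (B (wave t n) - ell2_scaleC d (wave t n))
      + cscale d (A (wave t n) - ell2_scaleC c (wave t n))) \<longlonglongrightarrow> 0 + 0"
    using A(2) B unfolding symbol_at_def by (intro tendsto_add blinfun_tendsto_0)
  ultimately show ?thesis by (simp add: symbol_at_def)
qed

lemma symbol_at_cscale: "symbol_at t (cscale c) c"
  by (simp add: symbol_at_def)

lemma symbol_at_id: "symbol_at t id_blinfun 1"
proof -
  have "ell2_scaleC 1 x = x" for x by (rule ell2_eqI) (simp add: ell2_rep_eq)
  then show ?thesis by (simp add: symbol_at_def)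
qed

lemma symbol_at_compact:
  assumes "compact_op K" shows "symbol_at t K 0"
proof -
  have "ell2_scaleC 0 x = 0" for x by (rule ell2_eqI) (simp add: ell2_rep_eq)
  then show ?thesis
    using compact_op_orthonormal_tendsto_0[OF assms norm_wave wave_orthogonal] by (simp add: symbol_at_def)
qed

text \<open>The waves are unit vectors. This contractivity yields uniqueness of the value and
  uniform convergence of symbols.\<close>

lemma symbol_at_norm_le:
  assumes "symbol_at t A c" shows "cmod c \<le> norm A"
proof -
  have le: "cmod c \<le> norm A + norm (A (wave t n) - ell2_scaleC c (wave t n))" for n
  proof -
    have "cmod c = norm (ell2_scaleC c (wave t n))" by (simp add: norm_ell2_scaleC norm_wave)
    also have "\<dots> \<le> norm (A (wave t n)) + norm (A (wave t n) - ell2_scaleC c (wave t n))"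
      using norm_triangle_ineq4[of "A (wave t n)" "A (wave t n) - ell2_scaleC c (wave t n)"] by simp
    also have "norm (A (wave t n)) \<le> norm A" using norm_blinfun[of A "wave t n"] by (simp add: norm_wave)
    finally show ?thesis by simp
  qed
  have "(\<lambda>n. norm A + norm (A (wave t n) - ell2_scaleC c (wave t n))) \<longlonglongrightarrow> norm A + 0"
    using assms unfolding symbol_at_def by (intro tendsto_intros tendsto_norm_zero)
  then show ?thesis using le by (intro LIMSEQ_le_const[of _ "norm A"]) auto
qed

lemma symbol_at_unique: "symbol_at t A c \<Longrightarrow> symbol_at t A d \<Longrightarrow> c = d"
  using symbol_at_norm_le[OF symbol_at_diff[of t A c A d]] by simp

lemma symbol_at_approx:
  assumes "\<And>e. e > 0 \<Longrightarrow> \<exists>B d. symbol_at t B d \<and> norm (A - B) \<le> e \<and> cmod (c - d) \<le> e"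
  shows "symbol_at t A c"
  unfolding symbol_at_def
proof (rule LIMSEQ_I)
  fix e :: real assume "e > 0"
  then have "e / 4 > 0" by simp
  then obtain B d where B: "symbol_at t B d" "norm (A - B) \<le> e / 4" "cmod (c - d) \<le> e / 4"
    using assms by blast
  obtain N where N: "\<And>n. n \<ge> N \<Longrightarrow> norm (B (wave t n) - ell2_scaleC d (wave t n)) < e / 4"
    using LIMSEQ_D[OF B(1)[unfolded symbol_at_def] \<open>e / 4 > 0\<close>] by auto
  have "norm (A (wave t n) - ell2_scaleC c (wave t n)) < e" if "n \<ge> N" for n
  proof -
    let ?v = "wave t n"
    have eq: "A ?v - ell2_scaleC c ?v = (A - B) ?v + (B ?v - ell2_scaleC d ?v) - ell2_scaleC (c - d) ?v"
      by (rule ell2_eqI) (simp add: ell2_rep_eq blinfun.bilinear_simps algebra_simps)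
    have "norm ((A - B) ?v) \<le> e / 4" "norm (ell2_scaleC (c - d) ?v) \<le> e / 4"
      using norm_blinfun[of "A - B" ?v] B by (simp_all add: norm_ell2_scaleC norm_wave)
    then show ?thesis
      unfolding eq using N[OF that] \<open>e > 0\<close>
        norm_triangle_ineq4[of "(A - B) ?v + (B ?v - ell2_scaleC d ?v)" "ell2_scaleC (c - d) ?v"]
        norm_triangle_ineq[of "(A - B) ?v" "B ?v - ell2_scaleC d ?v"]
      by linarith
  qed
  then show "\<exists>N. \<forall>n\<ge>N. norm (A (wave t n) - ell2_scaleC c (wave t n) - 0) < e" by auto
qed

lemma symbol_at_shift_1: "symbol_at t (shift 1) (cis t)"
proof -
  have bound: "norm (shift 1 (wave t n) - ell2_scaleC (cis t) (wave t n)) \<le> sqrt (8 * (1 / 2) ^ n)" for n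
  proof (rule real_le_rsqrt)
    let ?w = "shift 1 (wave t n) - ell2_scaleC (cis t) (wave t n)"
    \<comment> \<open>Inside the block the phases cancel. Only its two boundary rows remain, each
      with square at most 4 / 2^n.\<close>
    let ?F = "{2 ^ n - 1, 2 ^ Suc n - 1} :: nat set"
    have w: "ell2_nth ?w i = ell2_nth (wave t n) (Suc i) - cis t * ell2_nth (wave t n) i" for i
      by (simp add: ell2_rep_eq ell2_nth_shift nat_add_distrib)
    have "(norm ?w)\<^sup>2 = (\<Sum>i\<in>?F. (cmod (ell2_nth ?w i))\<^sup>2)"
    proof (rule norm_ell2_finite_support)
      fix i assume i: "i \<notin> ?F"
      show "ell2_nth ?w i = 0"
      proof (cases "i \<in> {2 ^ n..<2 ^ Suc n}")
        case True
        then have "Suc i \<in> {2 ^ n..<2 ^ Suc n}" using i by auto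
        with True show ?thesis unfolding w wave.rep_eq
          by (simp only: if_True) (simp add: cis_mult distrib_right)
      next
        case False
        then have "Suc i \<notin> {2 ^ n..<2 ^ Suc n}" using i by auto
        with False show ?thesis unfolding w wave.rep_eq by (simp only: if_False) simp
      qed
    qed simp
    also have "\<dots> \<le> (\<Sum>i\<in>?F. 4 * (1 / 2) ^ n)"
    proof (rule sum_mono)
      fix i
      have v: "cmod (ell2_nth (wave t n) j) \<le> 1 / sqrt (2 ^ n)" for j by (simp only: cmod_wave) simp
      have "cmod (ell2_nth ?w i) \<le> cmod (ell2_nth (wave t n) (Suc i)) + cmod (ell2_nth (wave t n) i)"
        unfolding w using norm_triangle_ineq4[of "ell2_nth (wave t n) (Suc i)" "cis t * ell2_nth (wave t n) i"]
        by (simp add: norm_mult)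
      also have "\<dots> \<le> 2 / sqrt (2 ^ n)" using v[of i] v[of "Suc i"] by simp
      finally have "(cmod (ell2_nth ?w i))\<^sup>2 \<le> (2 / sqrt (2 ^ n))\<^sup>2" by (rule power_mono) simp
      then show "(cmod (ell2_nth ?w i))\<^sup>2 \<le> 4 * (1 / 2) ^ n" by (simp add: power_divide)
    qed
    also have "\<dots> \<le> 2 * (4 * (1 / 2) ^ n)"
      unfolding sum_constant by (intro mult_right_mono) (auto simp: card_insert_if)
    finally show "(norm ?w)\<^sup>2 \<le> 8 * (1 / 2) ^ n" by simp
  qed
  have "(\<lambda>n. sqrt (8 * (1 / 2) ^ n)) \<longlonglongrightarrow> sqrt (8 * 0)"
    by (intro tendsto_intros LIMSEQ_power_zero) simp
  then have "(\<lambda>n. sqrt (8 * (1 / 2) ^ n)) \<longlonglongrightarrow> 0" by simp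
  then show ?thesis
    unfolding symbol_at_def by (rule Lim_null_comparison[OF always_eventually[OF allI[OF bound]]])
qed

lemma symbol_at_shift_add:
  assumes "symbol_at t (shift k) c" "symbol_at t (shift l) d"
  shows "symbol_at t (shift (k + l)) (c * d)"
  using symbol_at_diff[OF symbol_at_compose[OF shift_bounded_ops assms]
      symbol_at_compact[OF compact_op_shift_compose[of k l]]] by simp

text \<open>Write V for this shift. V times \<open>shift 1\<close> is the identity up to a compact
  operator, while V applied to \<open>shift 1\<close> of a wave is close to exp(it) times V of the
  wave; multiplying by exp(-it) isolates the latter.\<close>

lemma symbol_at_shift_minus_1: "symbol_at t (shift (- 1)) (cis (- t))"
proof -
  let ?v = "wave t" and ?V = "shift (- 1)"
  have "symbol_at t ((?V o\<^sub>L shift 1) - shift (- 1 + 1) + id_blinfun) (0 + 1)"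
    by (intro symbol_at_add symbol_at_compact compact_op_shift_compose symbol_at_id)
  then have "symbol_at t (?V o\<^sub>L shift 1) 1" by (simp add: shift_0)
  then have "(\<lambda>n. ((?V o\<^sub>L shift 1) (?v n) - ell2_scaleC 1 (?v n))
      - ?V (shift 1 (?v n) - ell2_scaleC (cis t) (?v n))) \<longlonglongrightarrow> 0 - 0"
    using symbol_at_shift_1[of t] unfolding symbol_at_def by (intro tendsto_diff blinfun_tendsto_0)
  then have "(\<lambda>n. cscale (cis (- t)) (((?V o\<^sub>L shift 1) (?v n) - ell2_scaleC 1 (?v n))
      - ?V (shift 1 (?v n) - ell2_scaleC (cis t) (?v n)))) \<longlonglongrightarrow> 0"
    by (intro blinfun_tendsto_0) simp
  moreover have "cscale (cis (- t)) (((?V o\<^sub>L shift 1) x - ell2_scaleC 1 x)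
      - ?V (shift 1 x - ell2_scaleC (cis t) x)) = ?V x - ell2_scaleC (cis (- t)) x" for x
    by (rule ell2_eqI) (simp add: blinfun.bilinear_simps ell2_rep_eq bounded_opsD[OF shift_bounded_ops]
        right_diff_distrib mult.assoc[symmetric] cis_mult)
  ultimately show ?thesis by (simp add: symbol_at_def)
qed

lemma symbol_at_shift: "symbol_at t (shift k) (cis (of_int k * t))"
proof (induction k rule: int_induct[of _ 0])
  case base
  then show ?case by (simp add: shift_0 symbol_at_id)
next
  case (step1 i)
  then show ?case using symbol_at_shift_add[OF step1(2) symbol_at_shift_1] by (simp add: cis_mult distrib_right)
next
  case (step2 i)
  then show ?case using symbol_at_shift_add[OF step2(2) symbol_at_shift_minus_1]
    by (simp add: cis_mult left_diff_distrib)
qed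

lemma symbol_at_toeplitz_trig: "f \<in> trig \<Longrightarrow> symbol_at t (toeplitz f) (f t)"
proof (induction rule: trig.induct)
  case (cis k)
  then show ?case by (simp add: toeplitz_cis symbol_at_shift)
next
  case (cmult f c)
  then show ?case
    by (simp add: toeplitz_cmult circle_function_trig symbol_at_compose cscale_bounded_ops symbol_at_cscale)
next
  case (add f g)
  then show ?case by (simp add: toeplitz_add circle_function_trig symbol_at_add)
qed

lemma symbol_at_toeplitz:
  assumes a: "circle_function a" and t: "t \<in> {0..2*pi}"
  shows "symbol_at t (toeplitz a) (a t)"
proof (rule symbol_at_approx)
  fix e :: real assume "e > 0"
  then obtain f where f: "f \<in> trig" "\<forall>t\<in>{0..2*pi}. cmod (a t - f t) < e" using trig_dense[OF a] by blast
  have "norm (toeplitz a - toeplitz f) \<le> e"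
    by (rule toeplitz_norm_diff_le[OF a circle_function_trig[OF f(1)]]) (use f in \<open>auto intro: less_imp_le\<close>)
  moreover have "cmod (a t - f t) \<le> e" using f(2) t by (auto intro: less_imp_le)
  ultimately show "\<exists>B d. symbol_at t B d \<and> norm (toeplitz a - B) \<le> e \<and> cmod (a t - d) \<le> e"
    using symbol_at_toeplitz_trig[OF f(1)] by blast
qed

lemma ell2_inner_commute: "ell2_inner y x = cnj (ell2_inner x y)"
proof -
  have "(\<lambda>n. cnj (ell2_nth x n) * ell2_nth y n) sums ell2_inner x y"
    unfolding ell2_inner_def by (intro summable_sums summable_ell2_inner)
  then have "(\<lambda>n. cnj (cnj (ell2_nth x n) * ell2_nth y n)) sums cnj (ell2_inner x y)"
    by (simp only: sums_cnj)
  then have "(\<lambda>n. cnj (ell2_nth y n) * ell2_nth x n) sums cnj (ell2_inner x y)"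
    by (simp add: mult.commute)
  then show ?thesis by (simp add: ell2_inner_def sums_iff)
qed

lemma ell2_inner_self: "ell2_inner x x = of_real ((norm x)\<^sup>2)"
  using ell2_inner_commute[of x x]
  by (simp add: complex_eq_iff power2_norm_eq_inner inner_ell2_def)

lemma symbol_at_positive:
  assumes A: "positive_definite A" and s: "symbol_at t A c"
  shows "Re c > 0" "Im c = 0"
proof -
  let ?v = "wave t"
  let ?z = "\<lambda>n. A (?v n) - ell2_scaleC c (?v n)"
  obtain \<gamma> where \<gamma>: "\<gamma> > 0" "\<And>v. \<gamma> * (norm v)\<^sup>2 \<le> v \<bullet> A v"
    using posdefE[OF positive_definite_posdef[OF A]] by metis
  have inner: "ell2_inner (?v n) (?z n) = ell2_inner (?v n) (A (?v n)) - c" for n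
  proof -
    have "ell2_inner (?v n) (?z n) = ell2_inner (?v n) (A (?v n)) - ell2_inner (?v n) (ell2_scaleC c (?v n))"
      unfolding ell2_inner_def
      by (subst suminf_diff[OF summable_ell2_inner summable_ell2_inner])
        (simp add: ell2_rep_eq right_diff_distrib)
    also have "ell2_inner (?v n) (ell2_scaleC c (?v n)) = c"
      using ell2_inner_commute[of "?v n" "ell2_scaleC c (?v n)"]
      by (simp add: ell2_inner_scaleC_left ell2_inner_self norm_wave)
    finally show ?thesis .
  qed
  have z0: "(\<lambda>n. norm (?z n)) \<longlonglongrightarrow> 0" using s unfolding symbol_at_def by (rule tendsto_norm_zero)
  have "Re (ell2_inner (?v n) (?z n)) \<le> norm (?z n)" for n
    using norm_cauchy_schwarz[of "?v n" "?z n"] by (simp add: inner_ell2_def norm_wave)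
  then have "\<gamma> - Re c \<le> norm (?z n)" for n
    using \<gamma>(2)[of "?v n"] by (simp add: inner inner_ell2_def norm_wave) (meson diff_right_mono order_trans)
  then have "\<gamma> - Re c \<le> 0" by (intro LIMSEQ_le_const[OF z0]) auto
  then show "Re c > 0" using \<gamma>(1) by simp
  have real: "Im (ell2_inner (?v n) (A (?v n))) = 0" for n
  proof -
    have "ell2_inner (A (?v n)) (?v n) = ell2_inner (?v n) (A (?v n))"
      using A by (simp add: positive_definite_def self_adjoint_def)
    then have "cnj (ell2_inner (?v n) (A (?v n))) = ell2_inner (?v n) (A (?v n))"
      using ell2_inner_commute by metis
    then show ?thesis by (simp add: complex_eq_iff)
  qed
  have "\<bar>Im c\<bar> \<le> norm (?z n)" for n
  proof -
    \<comment> \<open>Pairing with i times the wave extracts the imaginary part; the contribution of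
      \<open>A\<close> vanishes by self-adjointness.\<close>
    have "\<bar>ell2_scaleC \<i> (?v n) \<bullet> ?z n\<bar> \<le> norm (ell2_scaleC \<i> (?v n)) * norm (?z n)"
      by (rule Cauchy_Schwarz_ineq2)
    moreover have "ell2_scaleC \<i> (?v n) \<bullet> ?z n = - Im c"
      by (simp add: inner_ell2_def ell2_inner_scaleC_left inner real)
    ultimately show ?thesis by (simp add: norm_ell2_scaleC norm_wave)
  qed
  then have "\<bar>Im c\<bar> \<le> 0" by (intro LIMSEQ_le_const[OF z0]) auto
  then show "Im c = 0" by simp
qed


section \<open>The algebra of quasi-Toeplitz operators\<close>

definition has_symbol :: "operator \<Rightarrow> (real \<Rightarrow> complex) \<Rightarrow> bool" where
  "has_symbol A a \<longleftrightarrow> circle_function a \<and> A \<in> bounded_ops \<and> compact_op (A - toeplitz a)"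

lemma has_symbol_symbol_at:
  assumes "has_symbol A a" "t \<in> {0..2*pi}"
  shows "symbol_at t A (a t)"
  using symbol_at_add[OF symbol_at_toeplitz[of a t] symbol_at_compact[of "A - toeplitz a" t]] assms
  by (simp add: has_symbol_def)

lemma has_symbolI_C2pi:
  assumes "a \<in> C2pi" "K \<in> bounded_ops" "compact_op K"
  shows "has_symbol (toeplitz a + K) a"
  using assms toeplitz_bounded_ops[of a] closed_algebra_bounded_ops
  by (auto simp: has_symbol_def circle_function_def C2pi_def closed_algebra_def)

text \<open>Restriction to the interval restores extensionality and leaves the Fourier coefficients,
  hence the Toeplitz operator, unchanged.\<close>

lemma has_symbol_decomposition:
  assumes "has_symbol A a"
  defines "b \<equiv> restrict a {0..2*pi}"
  shows "b \<in> C2pi" "A - toeplitz b \<in> bounded_ops" "compact_op (A - toeplitz b)"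
proof -
  have a: "circle_function a" using assms by (simp add: has_symbol_def)
  have "fourier_coeff b = fourier_coeff a"
    by (intro ext fourier_coeff_cong) (simp add: b_def)
  then have b: "toeplitz b = toeplitz a" by (simp add: toeplitz_def)
  have "continuous_on {0..2*pi} b"
    using circle_function_continuous[OF a] by (rule continuous_on_eq) (simp add: b_def)
  then show "b \<in> C2pi" using a by (simp add: C2pi_def b_def circle_function_def)
  show "A - toeplitz b \<in> bounded_ops" "compact_op (A - toeplitz b)"
    unfolding b using assms(1) closed_algebra_diff[OF closed_algebra_bounded_ops] toeplitz_bounded_ops[OF a]
    by (auto simp: has_symbol_def)
qed

lemma QT_iff_has_symbol: "A \<in> QT \<longleftrightarrow> (\<exists>a. has_symbol A a)"
proof
  assume "A \<in> QT"
  then show "\<exists>a. has_symbol A a" unfolding QT_def using has_symbolI_C2pi by blast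
next
  assume "\<exists>a. has_symbol A a"
  then obtain a where a: "has_symbol A a" by blast
  have "A = toeplitz (restrict a {0..2*pi}) + (A - toeplitz (restrict a {0..2*pi}))" by simp
  then show "A \<in> QT" unfolding QT_def using has_symbol_decomposition[OF a] by blast
qed

text \<open>Approximate eigenvalues are unique, so two symbols of one operator agree at every point
  of the interval; extensionality fixes the values outside.\<close>

lemma qt_symbol_eq:
  assumes A: "has_symbol A a"
  shows "qt_symbol A = restrict a {0..2*pi}"
  unfolding qt_symbol_def
proof (rule the_equality)
  let ?b = "restrict a {0..2*pi}"
  have "A = toeplitz ?b + (A - toeplitz ?b)" by simp
  then show "?b \<in> C2pi \<and> (\<exists>K. K \<in> bounded_ops \<and> compact_op K \<and> A = toeplitz ?b + K)"
    using has_symbol_decomposition[OF A] by blast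
next
  fix c assume "c \<in> C2pi \<and> (\<exists>K. K \<in> bounded_ops \<and> compact_op K \<and> A = toeplitz c + K)"
  then have c: "c \<in> extensional {0..2*pi}" "has_symbol A c"
    using has_symbolI_C2pi by (auto simp: C2pi_def)
  show "c = restrict a {0..2*pi}"
  proof (rule extensionalityI[OF c(1)])
    show "c t = restrict a {0..2*pi} t" if "t \<in> {0..2*pi}" for t
      using symbol_at_unique[OF has_symbol_symbol_at[OF c(2) that] has_symbol_symbol_at[OF A that]] that
      by simp
  qed simp
qed

lemma qt_symbol_symbol_at:
  assumes "A \<in> QT" "t \<in> {0..2*pi}"
  shows "symbol_at t A (qt_symbol A t)"
proof -
  obtain a where "has_symbol A a" using assms QT_iff_has_symbol by blast
  then show ?thesis using has_symbol_symbol_at[of A a t] assms(2) by (simp add: qt_symbol_eq)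
qed

lemma QT_subset_bounded_ops: "QT \<subseteq> bounded_ops"
  by (auto simp: QT_iff_has_symbol has_symbol_def)

section \<open>Closure under algebraic operations and norm limits\<close>

lemma has_symbol_id: "has_symbol id_blinfun (\<lambda>_. 1)"
proof -
  have "toeplitz (\<lambda>_. 1) = id_blinfun" using toeplitz_cis[of 0] by (simp add: shift_0)
  then show ?thesis
    using closed_algebra_bounded_ops
    by (simp add: has_symbol_def circle_function_const compact_op_zero closed_algebra_def)
qed

lemma has_symbol_add:
  assumes "has_symbol A a" "has_symbol B b"
  shows "has_symbol (A + B) (\<lambda>t. a t + b t)"
proof -
  have "A + B - toeplitz (\<lambda>t. a t + b t) = (A - toeplitz a) + (B - toeplitz b)"
    using assms by (simp add: toeplitz_add has_symbol_def)
  then have "compact_op (A + B - toeplitz (\<lambda>t. a t + b t))"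
    using assms by (simp only: has_symbol_def compact_op_add)
  then show ?thesis using assms closed_algebra_bounded_ops
    by (simp add: has_symbol_def circle_function_add closed_algebra_def)
qed

lemma has_symbol_scaleR:
  assumes "has_symbol A a"
  shows "has_symbol (r *\<^sub>R A) (\<lambda>t. of_real r * a t)"
proof -
  have "cscale (of_real r) = r *\<^sub>R id_blinfun"
    by (intro blinfun_eqI ell2_eqI) (simp add: ell2_rep_eq blinfun.bilinear_simps scaleR_conv_of_real)
  then have "r *\<^sub>R A - toeplitz (\<lambda>t. of_real r * a t) = r *\<^sub>R (A - toeplitz a)"
    using assms by (simp add: toeplitz_cmult has_symbol_def blinfun_compose_simps scaleR_diff_right)
  then show ?thesis using assms closed_algebra_bounded_ops
    by (simp add: has_symbol_def circle_function_mult circle_function_const compact_op_scaleR closed_algebra_def)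
qed

lemma has_symbol_compose:
  assumes "has_symbol A a" "has_symbol B b"
  shows "has_symbol (A o\<^sub>L B) (\<lambda>t. a t * b t)"
proof -
  have "(A o\<^sub>L B) - toeplitz (\<lambda>t. a t * b t)
    = ((A - toeplitz a) o\<^sub>L B) + (toeplitz a o\<^sub>L (B - toeplitz b)) + semicommutator a b"
    by (simp add: semicommutator_def blinfun_compose_simps)
  moreover have "compact_op (((A - toeplitz a) o\<^sub>L B) + (toeplitz a o\<^sub>L (B - toeplitz b)) + semicommutator a b)"
    using assms by (intro compact_op_add compact_op_compose_left compact_op_compose_right
        compact_op_semicommutator) (auto simp: has_symbol_def)
  ultimately show ?thesis using assms closed_algebra_compose[OF closed_algebra_bounded_ops]
    by (simp add: has_symbol_def circle_function_mult)
qed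

text \<open>Contractivity makes the symbols uniformly Cauchy. Their Toeplitz operators then converge
  as well, so the compact parts converge, and a norm limit of compact operators is compact.\<close>

lemma closed_QT: "closed QT"
  unfolding closed_sequential_limits
proof (intro allI impI)
  fix X L assume X: "(\<forall>n. X n \<in> QT) \<and> X \<longlonglongrightarrow> L"
  then have "\<forall>n. \<exists>a. has_symbol (X n) a" by (simp add: QT_iff_has_symbol)
  then obtain a where a: "\<And>n. has_symbol (X n) (a n)" by metis
  have ca: "circle_function (a n)" for n using a by (simp add: has_symbol_def)
  have diff: "cmod (a m t - a n t) \<le> norm (X m - X n)" if "t \<in> {0..2*pi}" for m n t
    by (rule symbol_at_norm_le[of t], rule symbol_at_diff) (intro has_symbol_symbol_at a that)+
  have "uniformly_Cauchy_on {0..2*pi} a"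
    unfolding uniformly_Cauchy_on_def
  proof (intro allI impI)
    fix e :: real assume "e > 0"
    have "Cauchy X" using X convergent_Cauchy convergentI by blast
    then obtain M where M: "\<And>m n. m \<ge> M \<Longrightarrow> n \<ge> M \<Longrightarrow> norm (X m - X n) < e"
      using CauchyD[OF _ \<open>e > 0\<close>] by blast
    then show "\<exists>M. \<forall>x\<in>{0..2*pi}. \<forall>m\<ge>M. \<forall>n\<ge>M. dist (a m x) (a n x) < e"
      unfolding dist_norm using diff le_less_trans by blast
  qed
  then have "uniformly_convergent_on {0..2*pi} a" by (rule Cauchy_uniformly_convergent)
  then obtain b where b: "uniform_limit {0..2*pi} a b sequentially"
    by (auto simp: uniformly_convergent_on_def)
  have "continuous_on {0..2*pi} b"
    by (rule uniform_limit_theorem[OF _ b])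
      (intro always_eventually allI circle_function_continuous ca, simp)
  moreover have "b 0 = b (2*pi)"
  proof (rule LIMSEQ_unique)
    show "(\<lambda>n. a n 0) \<longlonglongrightarrow> b 0" by (rule tendsto_uniform_limitI[OF b]) simp
    have "(\<lambda>n. a n (2*pi)) \<longlonglongrightarrow> b (2*pi)" by (rule tendsto_uniform_limitI[OF b]) simp
    then show "(\<lambda>n. a n 0) \<longlonglongrightarrow> b (2*pi)" using ca by (simp add: circle_function_def)
  qed
  ultimately have cb: "circle_function b" by (simp add: circle_function_def)
  \<comment> \<open>Letting m tend to infinity in the Cauchy estimate gives a rate that does not
    depend on t, as \<open>toeplitz_tendsto\<close> requires.\<close>
  have le: "cmod (b t - a n t) \<le> norm (X n - L)" if t: "t \<in> {0..2*pi}" for n t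
  proof (rule LIMSEQ_le)
    show "(\<lambda>m. cmod (a m t - a n t)) \<longlonglongrightarrow> cmod (b t - a n t)"
      by (intro tendsto_intros tendsto_uniform_limitI[OF b t])
    show "(\<lambda>m. norm (X m - X n)) \<longlonglongrightarrow> norm (X n - L)"
      using X by (subst norm_minus_commute) (auto intro!: tendsto_intros)
  qed (use diff[OF t] in blast)
  have "(\<lambda>n. norm (X n - L)) \<longlonglongrightarrow> 0"
    using X by (intro tendsto_norm_zero) (simp add: LIM_zero)
  from toeplitz_tendsto[OF cb ca le this]
  have "(\<lambda>n. X n - toeplitz (a n)) \<longlonglongrightarrow> L - toeplitz b" using X by (intro tendsto_diff) auto
  then have "compact_op (L - toeplitz b)"
    by (rule compact_op_lim[rotated]) (use a in \<open>simp add: has_symbol_def\<close>)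
  moreover have "L \<in> bounded_ops"
    using closed_sequentially[of bounded_ops X L] closed_algebra_bounded_ops X QT_subset_bounded_ops
    by (auto simp: closed_algebra_def)
  ultimately show "L \<in> QT" using cb by (auto simp: QT_iff_has_symbol has_symbol_def)
qed

lemma closed_algebra_QT: "closed_algebra QT"
  unfolding closed_algebra_def
proof (intro conjI ballI allI)
  show "id_blinfun \<in> QT" using has_symbol_id QT_iff_has_symbol by blast
  fix A assume "A \<in> QT"
  then obtain a where a: "has_symbol A a" using QT_iff_has_symbol by blast
  show "r *\<^sub>R A \<in> QT" for r using has_symbol_scaleR[OF a] QT_iff_has_symbol by blast
  fix B assume "B \<in> QT"
  then obtain b where b: "has_symbol B b" using QT_iff_has_symbol by blast
  show "A + B \<in> QT" using has_symbol_add[OF a b] QT_iff_has_symbol by blast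
  show "A o\<^sub>L B \<in> QT" using has_symbol_compose[OF a b] QT_iff_has_symbol by blast
qed (rule closed_QT)


section \<open>The symbol of the ALM mean\<close>

lemma qt_symbol_positive:
  assumes "A \<in> QT" "positive_definite A" "t \<in> {0..2*pi}"
  shows "Re (qt_symbol A t) > 0" "qt_symbol A t = of_real (Re (qt_symbol A t))"
  using symbol_at_positive[OF assms(2) qt_symbol_symbol_at[OF assms(1,3)]]
  by (auto simp: complex_eq_iff)

text \<open>At t, let x, y and a be the values of the mean, the inverse of \<open>A\<close> and
  \<open>A\<close>. The Riccati equation reads x y x = b with b the value of \<open>B\<close>, and a
  y = 1, so x^2 = a b. Positivity selects the root.\<close>

lemma qt_symbol_geo_mean:
  assumes A: "A \<in> QT" "positive_definite A" and B: "B \<in> QT" "positive_definite B"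
    and t: "t \<in> {0..2*pi}"
  shows "(qt_symbol (A #\<^sub>g B) t)\<^sup>2 = qt_symbol A t * qt_symbol B t"
proof -
  let ?X = "A #\<^sub>g B" and ?I = "op_inverse A"
  have X: "?X \<in> QT" by (rule geo_mean_props(1)[OF closed_algebra_QT A(1) B(1) A(2) B(2)])
  have I: "?I \<in> QT" "A o\<^sub>L ?I = id_blinfun"
    by (rule positive_definite_inverse[OF closed_algebra_QT A])+
  have lin: "?X \<in> bounded_ops" "A \<in> bounded_ops" "?X o\<^sub>L ?I \<in> bounded_ops"
    using X I A QT_subset_bounded_ops closed_algebra_compose[OF closed_algebra_QT] by blast+
  note s = qt_symbol_symbol_at[OF _ t]
  have "symbol_at t (?X o\<^sub>L ?I o\<^sub>L ?X) (qt_symbol ?X t * qt_symbol ?I t * qt_symbol ?X t)"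
    by (intro symbol_at_compose lin s X I)
  then have "qt_symbol ?X t * qt_symbol ?I t * qt_symbol ?X t = qt_symbol B t"
    unfolding geo_mean_riccati[OF A(2) B(2)] using symbol_at_unique s[OF B(1)] by blast
  moreover have "symbol_at t (A o\<^sub>L ?I) (qt_symbol A t * qt_symbol ?I t)"
    by (intro symbol_at_compose lin s A I)
  then have "qt_symbol A t * qt_symbol ?I t = 1"
    unfolding I(2) using symbol_at_unique symbol_at_id by blast
  ultimately show ?thesis by (metis (no_types, lifting) mult.assoc mult.commute mult_1 power2_eq_square)
qed

lemma qt_symbol_tendsto:
  assumes X: "\<And>k. X k \<in> QT" "X \<longlonglongrightarrow> L" and L: "L \<in> QT" and t: "t \<in> {0..2*pi}"
  shows "(\<lambda>k. qt_symbol (X k) t) \<longlonglongrightarrow> qt_symbol L t"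
proof -
  have le: "cmod (qt_symbol (X k) t - qt_symbol L t) \<le> norm (X k - L)" for k
    by (rule symbol_at_norm_le[of t], rule symbol_at_diff) (intro qt_symbol_symbol_at X L t)+
  have "(\<lambda>k. norm (X k - L)) \<longlonglongrightarrow> 0" using X(2) by (intro tendsto_norm_zero) (simp add: LIM_zero)
  then have "(\<lambda>k. qt_symbol (X k) t - qt_symbol L t) \<longlonglongrightarrow> 0"
    by (rule Lim_null_comparison[OF always_eventually[OF allI[OF le]]])
  then show ?thesis by (rule LIM_zero_cancel)
qed

lemma qt_symbol_alm_mean:
  assumes p: "p \<ge> 2" and A: "\<And>i. i < p \<Longrightarrow> A i \<in> QT" "\<And>i. i < p \<Longrightarrow> positive_definite (A i)"
    and t: "t \<in> {0..2*pi}"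
  shows "alm_mean p A \<in> QT \<and> positive_definite (alm_mean p A) \<and>
    Re (qt_symbol (alm_mean p A) t) ^ p = (\<Prod>i<p. Re (qt_symbol (A i) t))"
proof -
  let ?Q = "QT \<inter> {A. positive_definite A}"
  have "alm_mean p A \<in> ?Q \<and> Re (qt_symbol (alm_mean p A) t) ^ p = (\<Prod>i<p. Re (qt_symbol (A i) t))"
  proof (rule alm_mean_multiplicative[where \<Q> = ?Q and f = "\<lambda>A. Re (qt_symbol A t)"])
    show "A #\<^sub>g B \<in> ?Q" if "A \<in> ?Q" "B \<in> ?Q" for A B
      using geo_mean_props(1,2)[OF closed_algebra_QT, of A B] that by simp
    show "L \<in> ?Q" if "\<And>k. X k \<in> ?Q" "X \<longlonglongrightarrow> L" "positive_definite L" for X L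
      using closed_sequentially[OF closed_QT, of X L] that by simp
    show "Re (qt_symbol A t) > 0" if "A \<in> ?Q" for A
      using qt_symbol_positive(1)[of A t] that t by simp
    show "(Re (qt_symbol (A #\<^sub>g B) t))\<^sup>2 = Re (qt_symbol A t) * Re (qt_symbol B t)"
      if "A \<in> ?Q" "B \<in> ?Q" for A B
    proof -
      have G: "A #\<^sub>g B \<in> QT" "positive_definite (A #\<^sub>g B)"
        using geo_mean_props(1,2)[OF closed_algebra_QT, of A B] that by auto
      have "of_real ((Re (qt_symbol (A #\<^sub>g B) t))\<^sup>2) = (qt_symbol (A #\<^sub>g B) t)\<^sup>2"
        using qt_symbol_positive(2)[OF G t] by (metis of_real_power)
      also have "\<dots> = qt_symbol A t * qt_symbol B t" using that t by (intro qt_symbol_geo_mean) auto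
      also have "\<dots> = of_real (Re (qt_symbol A t) * Re (qt_symbol B t))"
        using qt_symbol_positive(2)[of A t] qt_symbol_positive(2)[of B t] that t
        by (metis IntD1 IntD2 mem_Collect_eq of_real_mult)
      finally show ?thesis by (simp only: of_real_eq_iff)
    qed
    show "(\<lambda>k. Re (qt_symbol (X k) t)) \<longlonglongrightarrow> Re (qt_symbol L t)"
      if "\<And>k. X k \<in> ?Q" "X \<longlonglongrightarrow> L" "L \<in> ?Q" for X L
      by (intro tendsto_Re qt_symbol_tendsto t) (use that in auto)
  qed (use p A in auto)
  then show ?thesis by simp
qed

theorem theorem17:
  fixes p :: nat
    and a :: "nat \<Rightarrow> real \<Rightarrow> complex"
    and K A :: "nat \<Rightarrow> operator"
  assumes "p \<ge> 3"
    and "\<And>i. i < p \<Longrightarrow> a i \<in> C2pi"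
    and "\<And>i. i < p \<Longrightarrow> K i \<in> bounded_ops \<and> compact_op (K i)"
    and "\<And>i. i < p \<Longrightarrow> A i = toeplitz (a i) + K i"
    and "\<And>i. i < p \<Longrightarrow> positive_definite (A i)"
  shows "alm_mean p A \<in> QT \<and>
    (\<forall>t\<in>{0..2*pi}. qt_symbol (alm_mean p A) t = (\<Prod>i<p. a i t) powr (1 / of_nat p))"
proof -
  let ?G = "alm_mean p A"
  have p: "p \<ge> 2" using assms(1) by simp
  have sym: "has_symbol (A i) (a i)" if "i < p" for i
    using has_symbolI_C2pi assms(2-4) that by simp
  have QT: "A i \<in> QT" if "i < p" for i using sym[OF that] QT_iff_has_symbol by blast
  have G: "?G \<in> QT \<and> positive_definite ?G \<and>
      Re (qt_symbol ?G t) ^ p = (\<Prod>i<p. Re (qt_symbol (A i) t))" if "t \<in> {0..2*pi}" for t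
    by (rule qt_symbol_alm_mean[OF p _ _ that]) (use QT assms(5) in auto)
  \<comment> \<open>These two facts do not depend on t, so any point of the interval provides
    them.\<close>
  have GQ: "?G \<in> QT" "positive_definite ?G" using G[of 0] by auto
  have "qt_symbol ?G t = (\<Prod>i<p. a i t) powr (1 / of_nat p)" if t: "t \<in> {0..2*pi}" for t
  proof -
    let ?g = "Re (qt_symbol ?G t)"
    have g: "?g > 0" by (rule qt_symbol_positive(1)[OF GQ t])
    have "a i t = of_real (Re (qt_symbol (A i) t))" if "i < p" for i
      using qt_symbol_positive(2)[OF QT assms(5) t, of i] qt_symbol_eq[OF sym[OF that]] that t by simp
    then have "(\<Prod>i<p. a i t) = of_real (\<Prod>i<p. Re (qt_symbol (A i) t))" by simp
    also have "\<dots> = of_real (?g ^ p)" using G[OF t] by simp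
    finally have "(\<Prod>i<p. a i t) powr (1 / of_nat p) = of_real (?g ^ p) powr of_real (1 / real p)"
      by simp
    \<comment> \<open>The base is a positive real number, so the principal branch of the complex
      power is the real power.\<close>
    also have "\<dots> = of_real ((?g ^ p) powr (1 / real p))" using g by (intro powr_of_real) simp_all
    also have "(?g ^ p) powr (1 / real p) = ?g"
      using g p by (simp add: powr_powr flip: powr_realpow)
    also have "of_real ?g = qt_symbol ?G t" by (rule qt_symbol_positive(2)[OF GQ t, symmetric])
    finally show ?thesis by simp
  qed
  with GQ(1) show ?thesis by blast
qed

end
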